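(* Let $\Omega=\{\omega_1,\dots,\omega_k\}\subseteq\mathbb{Z}^n$ be totally unimodular, $q\in\mathbb{R}^k$ with all $q_i>0$, and $\theta\in\operatorname{conv}\Omega$. (i) There is an interior-point algorithm (the one described in the context) that, given this instance and a precision $\delta\in(0,1)$, returns $x_\delta\in\mathbb{R}^n$ such that $F_\theta(x_\delta)\le F_\theta^*+\delta$ within $$O\!\left(\sqrt{k}\,\log\!\left(kn\,\frac1\delta\,\log\!\left(\frac{k\beta}{\delta}\right)\right)\right)=\tilde O\!\left(\sqrt{k}\,\log\!\left(\frac1\delta\right)\right)$$ iterations. (ii) Similarly, given this instance and a precision $\epsilon>0$, the same algorithm returns $x_\epsilon\in\mathbb{R}^n$ such that $\|\nabla F_\theta(x_\epsilon)\|_2\le\epsilon$ within $$O\!\left(\sqrt{k}\,\log\!\left(kn\,\frac1\epsilon\,\log\!\left(\frac{kn\beta}{\epsilon}\right)\right)\right)=\tilde O\!\left(\sqrt{k}\,\log\!\left(\frac1\epsilon\right)\right)$$ iterations. Here the notation $\tilde O$ hides terms inside the logarithm that are polynomial in the input length.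
   Context: $\log$ is the natural logarithm and the constants implicit in $O(\cdot)$ are absolute. $\Omega=\{\omega_1,\dots,\omega_k\}\subseteq\mathbb{Z}^n$ is totally unimodular if the $n\times k$ matrix with columns $\omega_1,\dots,\omega_k$ is totally unimodular, i.e. every square submatrix has determinant $0$, $1$ or $-1$. $F_\theta(x)=\log\sum_{i=1}^k q_i e^{\langle \omega_i-\theta,x\rangle}$ for $x\in\mathbb{R}^n$, $F_\theta^*=\inf_{x\in\mathbb{R}^n}F_\theta(x)$, $\beta=\|q\|_1/\min_{i\in[k]}q_i$. The algorithm takes an accuracy parameter $\delta\in(0,1)$ and a lower bound $\varphi_0>0$ on the facet gap of $\Omega$ (the smallest Euclidean distance from any $\omega\in\Omega$ to the affine hull of any facet of $\operatorname{conv}\Omega$ not containing $\omega$); here $\varphi_0=n^{-3/2}$, and in (ii) $\delta$ is a suitable explicit function of $\epsilon$ and $\max_i\|\omega_i-\theta\|_2$. Let $W=\operatorname{span}\{\omega_1-\theta,\dots,\omega_k-\theta\}$, let $E=W\times\mathbb{R}^k\times\mathbb{R}$ with its Euclidean inner product, let $R=\frac{n}{\varphi_0}\log\bigl(\frac{2\beta}{\delta/2}\bigr)$, and let $$D_{\theta,R}=\Bigl\{(x,z,t)\in E:\ \textstyle\sum_{i} z_i\le 1,\ q_ie^{\langle\omega_i-\theta,x\rangle}\le z_ie^t\ \forall i,\ t\le\log(5k\|q\|_1),\ \|x\|_2\le R\Bigr\}.$$ On the interior of $D_{\theta,R}$ use the barrier $$\Psi(x,z,t)=-\sum_i\log z_i-\sum_i\log\bigl(\log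 z_i-\langle\omega_i-\theta,x\rangle+t-\log q_i\bigr)-\log\bigl(\log(5k\|q\|_1)-t\bigr)-\log\bigl(1-\textstyle\sum_iz_i\bigr)-\log(R^2-\|x\|_2^2),$$ with gradient $g$, Hessian $H$, local norm $\|v\|_{(p)}=\sqrt{\langle v,H(p)v\rangle}$, and parameter $\nu=2k+3$. Let $c=(0;0;1)\in E$ and $p_0'=(0;\frac1{2k},\dots,\frac1{2k};\log(4k\|q\|_1))$. Preliminary stage: set $\mu_0=1$, $g_0=g(p_0')$, $i=0$. While $\|H(p_i')^{-1}g(p_i')\|_{(p_i')}>\frac16$: increase $i$ by one, set $\mu_i=(1-\frac{1}{8\sqrt\nu})\mu_{i-1}$ and $p_i'=p_{i-1}'-H(p_{i-1}')^{-1}(-\mu_ig_0+g(p_{i-1}'))$. After the loop set $\eta_0=(12\|H(p_i')^{-1}c\|_{(p_i')})^{-1}$ and $p_0=p_i'-H(p_i')^{-1}(\eta_0c+g(p_i'))$. Main stage: let $T=10\sqrt\nu\log\bigl(\frac65\frac{\nu}{\eta_0\delta/2}\bigr)$, rounded up to an integer. For $i=1,\dots,T$ set $\eta_i=(1+\frac1{8\sqrt\nu})\eta_{i-1}$ and $p_i=p_{i-1}-H(p_{i-1})^{-1}(\eta_ic+g(p_{i-1}))$. Output the $x$-component of $p_T=(x,z,t)$. The number of iterations is the total number of Newton steps (updates of $p'$ and $p$) performed in the two stages.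
   Formalization: Under O(·), outer log is read as max(1, log), and in (ii) the bound uses min(ε, max(1, max_i‖ω_i−θ‖)) in place of ε, since literally the bounds turn negative or undefined (k=n=1, δ→1; ε→∞). *)

theory Defs
  imports
    "HOL-Analysis.Analysis"
    "HOL-Library.Poly_Mapping"
    "HOL-Library.While_Combinator"
    "HOL-Computational_Algebra.Polynomial"
    "Jordan_Normal_Form.Determinant"
    "Jordan_Normal_Form.DL_Submatrix"
begin

section \<open>Euclidean spaces of all finite dimensions inside one type\<close>

text \<open>
  The constants implicit in \<open>O(-)\<close> must not depend on \<open>n\<close> and \<open>k\<close>, so both have to be
  quantified inside the scope of the existential quantifier over these constants, which is
  impossible if dimensions are types. Therefore \<open>\<real>\<^sup>n\<close> is represented by the subspace
  of the finitely supported real sequences that vanish from index \<open>n\<close> on, with the standard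
  inner product. Coordinates, and the indices of \<open>\<omega>\<close> and \<open>q\<close>, start at \<open>0\<close>.
\<close>

instantiation poly_mapping :: (type, real_vector) real_vector
begin

lift_definition scaleR_poly_mapping :: "real \<Rightarrow> ('a \<Rightarrow>\<^sub>0 'b) \<Rightarrow> 'a \<Rightarrow>\<^sub>0 'b"
  is "\<lambda>c f i. c *\<^sub>R f i"
  by (rule finite_subset) auto

instance
proof
  fix x y :: "'a \<Rightarrow>\<^sub>0 'b" and a b :: real
  show "a *\<^sub>R (x + y) = a *\<^sub>R x + a *\<^sub>R y"
    by (rule poly_mapping_eqI) (simp add: scaleR_poly_mapping.rep_eq lookup_add scaleR_add_right)
  show "(a + b) *\<^sub>R x = a *\<^sub>R x + b *\<^sub>R x"
    by (rule poly_mapping_eqI) (simp add: scaleR_poly_mapping.rep_eq lookup_add scaleR_add_left)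
  show "a *\<^sub>R b *\<^sub>R x = (a * b) *\<^sub>R x" "1 *\<^sub>R x = x"
    by (rule poly_mapping_eqI, simp add: scaleR_poly_mapping.rep_eq)+
qed

end

instantiation poly_mapping :: (type, real_inner) real_inner
begin

definition inner_poly_mapping :: "('a \<Rightarrow>\<^sub>0 'b) \<Rightarrow> ('a \<Rightarrow>\<^sub>0 'b) \<Rightarrow> real" where
  "inner_poly_mapping x y = (\<Sum>i\<in>Poly_Mapping.keys x. inner (Poly_Mapping.lookup x i) (Poly_Mapping.lookup y i))"

definition norm_poly_mapping :: "('a \<Rightarrow>\<^sub>0 'b) \<Rightarrow> real" where
  "norm_poly_mapping x = sqrt (inner x x)"

definition sgn_poly_mapping :: "('a \<Rightarrow>\<^sub>0 'b) \<Rightarrow> 'a \<Rightarrow>\<^sub>0 'b" where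
  "sgn_poly_mapping x = x /\<^sub>R norm x"

definition dist_poly_mapping :: "('a \<Rightarrow>\<^sub>0 'b) \<Rightarrow> ('a \<Rightarrow>\<^sub>0 'b) \<Rightarrow> real" where
  "dist_poly_mapping x y = norm (x - y)"

definition uniformity_poly_mapping :: "(('a \<Rightarrow>\<^sub>0 'b) \<times> ('a \<Rightarrow>\<^sub>0 'b)) filter" where
  "uniformity_poly_mapping = (INF e\<in>{0<..}. principal {(x, y). dist x y < e})"

definition open_poly_mapping :: "('a \<Rightarrow>\<^sub>0 'b) set \<Rightarrow> bool" where
  "open_poly_mapping U \<longleftrightarrow>
    (\<forall>x\<in>U. eventually (\<lambda>(x', y). x' = x \<longrightarrow> y \<in> U) uniformity)"

lemma inner_poly_mapping_superset:
  fixes x y :: "'a \<Rightarrow>\<^sub>0 'b"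
  assumes "finite A" "Poly_Mapping.keys x \<subseteq> A"
  shows "inner x y = (\<Sum>i\<in>A. inner (Poly_Mapping.lookup x i) (Poly_Mapping.lookup y i))"
  unfolding inner_poly_mapping_def
  by (rule sum.mono_neutral_left) (use assms in \<open>auto simp: in_keys_iff\<close>)

instance
proof
  fix x y z :: "'a \<Rightarrow>\<^sub>0 'b" and a :: real
  show "sgn x = x /\<^sub>R norm x" by (rule sgn_poly_mapping_def)
  show "dist x y = norm (x - y)" by (rule dist_poly_mapping_def)
  show "norm x = sqrt (inner x x)" by (rule norm_poly_mapping_def)
  show "(uniformity :: (('a \<Rightarrow>\<^sub>0 'b) \<times> ('a \<Rightarrow>\<^sub>0 'b)) filter)
      = (INF e\<in>{0<..}. principal {(x, y). dist x y < e})"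
    by (rule uniformity_poly_mapping_def)
  show "open U \<longleftrightarrow> (\<forall>x\<in>U. \<forall>\<^sub>F (x', y) in uniformity. x' = x \<longrightarrow> y \<in> U)"
    for U :: "('a \<Rightarrow>\<^sub>0 'b) set"
    by (rule open_poly_mapping_def)
  let ?A = "Poly_Mapping.keys x \<union> Poly_Mapping.keys y \<union> Poly_Mapping.keys z"
  have K: "finite ?A" "Poly_Mapping.keys x \<subseteq> ?A" "Poly_Mapping.keys y \<subseteq> ?A" "Poly_Mapping.keys (x + y) \<subseteq> ?A"
    using keys_add[of x y] by auto
  have "Poly_Mapping.keys (a *\<^sub>R x) \<subseteq> ?A"
    by (auto simp: in_keys_iff scaleR_poly_mapping.rep_eq)
  note I = inner_poly_mapping_superset[OF K(1)]
  show "inner x y = inner y x"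
    by (simp add: I[OF K(2)] I[OF K(3)] inner_commute)
  show "inner (x + y) z = inner x z + inner y z"
    by (simp add: I[OF K(2)] I[OF K(3)] I[OF K(4)] lookup_add inner_add_left sum.distrib)
  show "inner (a *\<^sub>R x) y = a * inner x y"
    by (simp add: I[OF K(2)] I[OF \<open>Poly_Mapping.keys (a *\<^sub>R x) \<subseteq> ?A\<close>] scaleR_poly_mapping.rep_eq sum_distrib_left)
  show "0 \<le> inner x x"
    by (simp add: inner_poly_mapping_def sum_nonneg)
  show "inner x x = 0 \<longleftrightarrow> x = 0"
    by (simp add: inner_poly_mapping_def sum_nonneg_eq_0_iff in_keys_iff poly_mapping_eq_iff fun_eq_iff)
qed

end

definition coord_space :: "nat \<Rightarrow> (nat \<Rightarrow>\<^sub>0 real) set" where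
  "coord_space n = {x. \<forall>j\<ge>n. Poly_Mapping.lookup x j = 0}"

definition int_coord_space :: "nat \<Rightarrow> (nat \<Rightarrow>\<^sub>0 real) set" where
  "int_coord_space n = {x \<in> coord_space n. \<forall>j. Poly_Mapping.lookup x j \<in> \<int>}"

section \<open>Total unimodularity\<close>

definition totally_unimodular :: "'a::comm_ring_1 mat \<Rightarrow> bool" where
  "totally_unimodular A \<longleftrightarrow>
    (\<forall>I J. I \<subseteq> {..<dim_row A} \<longrightarrow> J \<subseteq> {..<dim_col A} \<longrightarrow> card I = card J \<longrightarrow>
      Determinant.det (submatrix A I J) \<in> {0, 1, -1})"

definition column_matrix :: "nat \<Rightarrow> nat \<Rightarrow> (nat \<Rightarrow> nat \<Rightarrow>\<^sub>0 real) \<Rightarrow> real mat" where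
  "column_matrix n k \<omega> = mat n k (\<lambda>(r, c). Poly_Mapping.lookup (\<omega> c) r)"

section \<open>Differential calculus relative to a subspace\<close>

text \<open>
  Gradient, Hessian and Newton direction of a function on the inner product space \<open>V\<close>, a
  finite-dimensional subspace of the ambient type. The Hessian is the derivative of the gradient,
  and only its restriction to \<open>V\<close> is uniquely determined.
\<close>

definition grad_on :: "'a::real_inner set \<Rightarrow> ('a \<Rightarrow> real) \<Rightarrow> 'a \<Rightarrow> 'a" where
  "grad_on V f p = (THE g. g \<in> V \<and> (f has_derivative inner g) (at p within V))"

definition hess_on :: "'a::real_inner set \<Rightarrow> ('a \<Rightarrow> real) \<Rightarrow> 'a \<Rightarrow> 'a \<Rightarrow> 'a" where
  "hess_on V f p = frechet_derivative (grad_on V f) (at p within V)"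

definition hess_inv_on :: "'a::real_inner set \<Rightarrow> ('a \<Rightarrow> real) \<Rightarrow> 'a \<Rightarrow> 'a \<Rightarrow> 'a" where
  "hess_inv_on V f p = inv_into V (hess_on V f p)"

definition local_norm_on :: "'a::real_inner set \<Rightarrow> ('a \<Rightarrow> real) \<Rightarrow> 'a \<Rightarrow> 'a \<Rightarrow> real" where
  "local_norm_on V f p v = sqrt (inner v (hess_on V f p v))"

section \<open>The optimization problem\<close>

definition l1_norm :: "nat \<Rightarrow> (nat \<Rightarrow> real) \<Rightarrow> real" where
  "l1_norm k q = (\<Sum>i<k. \<bar>q i\<bar>)"

definition gp_beta :: "nat \<Rightarrow> (nat \<Rightarrow> real) \<Rightarrow> real" where
  "gp_beta k q = l1_norm k q / Min (q ` {..<k})"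

definition gp_fun :: "nat \<Rightarrow> (nat \<Rightarrow> 'a::real_inner) \<Rightarrow> (nat \<Rightarrow> real) \<Rightarrow> 'a \<Rightarrow> 'a \<Rightarrow> real" where
  "gp_fun k \<omega> q \<theta> x = ln (\<Sum>i<k. q i * exp (inner (\<omega> i - \<theta>) x))"

section \<open>The interior-point algorithm\<close>

definition span_W :: "nat \<Rightarrow> (nat \<Rightarrow> 'a::real_inner) \<Rightarrow> 'a \<Rightarrow> 'a set" where
  "span_W k \<omega> \<theta> = span ((\<lambda>i. \<omega> i - \<theta>) ` {..<k})"

definition ipm_space ::
  "nat \<Rightarrow> (nat \<Rightarrow> 'a::real_inner) \<Rightarrow> 'a \<Rightarrow> ('a \<times> (nat \<Rightarrow>\<^sub>0 real) \<times> real) set" where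
  "ipm_space k \<omega> \<theta> = span_W k \<omega> \<theta> \<times> coord_space k \<times> UNIV"

definition ipm_radius :: "nat \<Rightarrow> nat \<Rightarrow> (nat \<Rightarrow> real) \<Rightarrow> real \<Rightarrow> real \<Rightarrow> real" where
  "ipm_radius n k q \<phi>\<^sub>0 \<delta> = real n / \<phi>\<^sub>0 * ln (2 * gp_beta k q / (\<delta> / 2))"

definition ipm_domain ::
  "nat \<Rightarrow> (nat \<Rightarrow> 'a::real_inner) \<Rightarrow> (nat \<Rightarrow> real) \<Rightarrow> 'a \<Rightarrow> real
    \<Rightarrow> ('a \<times> (nat \<Rightarrow>\<^sub>0 real) \<times> real) set" where
  "ipm_domain k \<omega> q \<theta> R =
    {(x, z, t) \<in> ipm_space k \<omega> \<theta>.
      (\<Sum>i<k. Poly_Mapping.lookup z i) \<le> 1 \<and>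
      (\<forall>i<k. q i * exp (inner (\<omega> i - \<theta>) x) \<le> Poly_Mapping.lookup z i * exp t) \<and>
      t \<le> ln (5 * real k * l1_norm k q) \<and>
      norm x \<le> R}"

text \<open>The barrier is only meant on the interior of the domain relative to its ambient space.\<close>

definition ipm_barrier ::
  "nat \<Rightarrow> (nat \<Rightarrow> 'a::real_inner) \<Rightarrow> (nat \<Rightarrow> real) \<Rightarrow> 'a \<Rightarrow> real
    \<Rightarrow> 'a \<times> (nat \<Rightarrow>\<^sub>0 real) \<times> real \<Rightarrow> real" where
  "ipm_barrier k \<omega> q \<theta> R = (\<lambda>(x, z, t).
    if (x, z, t) \<in> top_of_set (ipm_space k \<omega> \<theta>) interior_of ipm_domain k \<omega> q \<theta> R then
      - (\<Sum>i<k. ln (Poly_Mapping.lookup z i))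
      - (\<Sum>i<k. ln (ln (Poly_Mapping.lookup z i) - inner (\<omega> i - \<theta>) x + t - ln (q i)))
      - ln (ln (5 * real k * l1_norm k q) - t)
      - ln (1 - (\<Sum>i<k. Poly_Mapping.lookup z i))
      - ln (R\<^sup>2 - (norm x)\<^sup>2)
    else undefined)"

definition ipm_start :: "nat \<Rightarrow> (nat \<Rightarrow> real) \<Rightarrow> 'a::real_inner \<times> (nat \<Rightarrow>\<^sub>0 real) \<times> real" where
  "ipm_start k q =
    (0, (\<Sum>i<k. Poly_Mapping.single i (1 / (2 * real k))), ln (4 * real k * l1_norm k q))"

text \<open>
  The result is the output together with the number of Newton steps, or \<open>None\<close> if the loop of the
  preliminary stage does not terminate. The state of that loop is \<open>(i, \<mu>\<^sub>i, p'\<^sub>i)\<close>, that of the main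
  stage is \<open>(\<eta>\<^sub>i, p\<^sub>i)\<close>. The Newton steps are the \<open>i\<close> updates in the loop, the one producing
  \<open>p\<^sub>0\<close>, and the \<open>T\<close> updates of the main stage.
\<close>

definition ipm ::
  "nat \<Rightarrow> nat \<Rightarrow> (nat \<Rightarrow> 'a::real_inner) \<Rightarrow> (nat \<Rightarrow> real) \<Rightarrow> 'a \<Rightarrow> real \<Rightarrow> real \<Rightarrow> ('a \<times> nat) option"
where
  "ipm n k \<omega> q \<theta> \<phi>\<^sub>0 \<delta> =
    (let E = ipm_space k \<omega> \<theta>;
         \<Psi> = ipm_barrier k \<omega> q \<theta> (ipm_radius n k q \<phi>\<^sub>0 \<delta>);
         g = grad_on E \<Psi>;
         Hinv = hess_inv_on E \<Psi>;
         lnorm = local_norm_on E \<Psi>;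
         \<nu> = 2 * real k + 3;
         c = (0, 0, 1);
         g\<^sub>0 = g (ipm_start k q)
     in map_option
       (\<lambda>(i, \<mu>, p').
         let \<eta>\<^sub>0 = 1 / (12 * lnorm p' (Hinv p' c));
             p\<^sub>0 = p' - Hinv p' (\<eta>\<^sub>0 *\<^sub>R c + g p');
             T = nat \<lceil>10 * sqrt \<nu> * ln (6 / 5 * (\<nu> / (\<eta>\<^sub>0 * (\<delta> / 2))))\<rceil>;
             (\<eta>, p) =
               ((\<lambda>(\<eta>, p). let \<eta>' = (1 + 1 / (8 * sqrt \<nu>)) * \<eta>
                           in (\<eta>', p - Hinv p (\<eta>' *\<^sub>R c + g p))) ^^ T) (\<eta>\<^sub>0, p\<^sub>0)
         in (fst p, i + 1 + T))
       (while_option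
         (\<lambda>(i, \<mu>, p'). lnorm p' (Hinv p' (g p')) > 1 / 6)
         (\<lambda>(i, \<mu>, p'). let \<mu>' = (1 - 1 / (8 * sqrt \<nu>)) * \<mu>
                        in (i + 1, \<mu>', p' - Hinv p' (- \<mu>' *\<^sub>R g\<^sub>0 + g p')))
         (0 :: nat, 1 :: real, ipm_start k q)))"

definition max_dist :: "nat \<Rightarrow> (nat \<Rightarrow> 'a::real_inner) \<Rightarrow> 'a \<Rightarrow> real" where
  "max_dist k \<omega> \<theta> = Max ((\<lambda>i. norm (\<omega> i - \<theta>)) ` {..<k})"

text \<open>
  The accuracy in function value that guarantees a gradient of norm at most \<open>\<epsilon>\<close>. With
  \<open>N = max\<^sub>i \<parallel>\<omega>\<^sub>i - \<theta>\<parallel>\<close>, the function \<open>F\<^sub>\<theta>\<close> is \<open>N\<^sup>2\<close>-smooth, so that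
  \<open>\<parallel>\<nabla>F\<^sub>\<theta>(x)\<parallel>\<^sup>2 \<le> 2 N\<^sup>2 (F\<^sub>\<theta>(x) - F\<^sub>\<theta>\<^sup>*)\<close>; hence \<open>\<delta> = \<epsilon>\<^sup>2 / (2 N\<^sup>2)\<close>. If \<open>\<epsilon> \<ge> N\<close>, every point
  qualifies and \<open>\<delta>\<close> is capped at \<open>1/2\<close>, which also covers \<open>N = 0\<close>.
\<close>

definition grad_accuracy ::
  "nat \<Rightarrow> (nat \<Rightarrow> 'a::real_inner) \<Rightarrow> 'a \<Rightarrow> real \<Rightarrow> real" where
  "grad_accuracy k \<omega> \<theta> \<epsilon> = \<epsilon>\<^sup>2 / (2 * (max \<epsilon> (max_dist k \<omega> \<theta>))\<^sup>2)"

section \<open>Complexity bounds\<close>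

text \<open>
  Under the \<open>O(-)\<close>, a logarithm is read as \<open>max 1 (ln -)\<close>. For accuracies at most \<open>1\<close> and \<open>k \<ge> 2\<close>
  this changes nothing: as \<open>\<beta> \<ge> k\<close>, its argument is then at least \<open>2 * ln 4 > exp 1\<close>. Otherwise
  the argument may be arbitrarily close to \<open>0\<close> (e.g. for \<open>k = n = 1\<close>, \<open>\<delta> \<rightarrow> 1\<close>), where the bare
  logarithm is not a bound.
\<close>

definition olog :: "real \<Rightarrow> real" where
  "olog y = max 1 (ln y)"

text \<open>
  \<open>\<parallel>\<nabla>F\<^sub>\<theta>\<parallel> \<le> N\<close> everywhere, so accuracies \<open>\<epsilon> \<ge> N\<close> impose no condition, while the
  algorithm still performs a number of steps that does not decrease to \<open>0\<close> as \<open>\<epsilon> \<rightarrow> \<infinity>\<close>. The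
  bound is therefore evaluated at \<open>\<epsilon>\<close> only up to \<open>max 1 N\<close>, and at this cap for larger \<open>\<epsilon>\<close>.
\<close>

definition capped_accuracy ::
  "nat \<Rightarrow> (nat \<Rightarrow> 'a::real_inner) \<Rightarrow> 'a \<Rightarrow> real \<Rightarrow> real" where
  "capped_accuracy k \<omega> \<theta> \<epsilon> = min \<epsilon> (max 1 (max_dist k \<omega> \<theta>))"

text \<open>
  A size measure of the instance for which the soft \<open>O(-)\<close> hides polynomials. Up to a constant factor it
  is a lower bound for the bit length of the instance when \<open>q\<close> is rational, so that hiding only
  polynomials in this quantity is the strongest reading.
\<close>

definition instance_size :: "nat \<Rightarrow> nat \<Rightarrow> (nat \<Rightarrow> real) \<Rightarrow> real" where
  "instance_size n k q = real n + real k + ln (gp_beta k q)"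

end

theory Submission
  imports Defs
begin

text \<open>
  The barrier is self-concordant with parameter \<open>2 k + 3\<close>, so Newton's method follows the central
  path with the stated step sizes: the local norm of the Newton step is at most \<open>1 / 4\<close> before and
  \<open>1 / 9\<close> after each update. The number of steps is governed by the dual norms of the starting
  gradient and of the objective, which are bounded by the extent of the domain because the unit ball
  of the local norm stays inside the domain on both sides.

  The radius suffices because of total unimodularity. Given \<open>x\<close>, let \<open>\<omega> m\<close> maximize
  \<open>\<langle>\<omega> m, x\<rangle>\<close> and truncate the gaps \<open>\<langle>\<omega> m - \<omega> i, x\<rangle>\<close> at \<open>ln (2 \<beta> / \<delta>)\<close>. The linear
  program that minimizes \<open>\<langle>\<omega> m - \<theta>, y\<rangle>\<close> subject to these lower bounds on the gaps of \<open>y\<close> has basic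
  solutions whose norm is bounded by Cramer's rule, and truncation changes \<open>F\<close> by at most \<open>\<delta> / 2\<close>.

  The gradient bound follows from the smoothness of \<open>F\<close>: one gradient step decreases \<open>F\<close> by
  \<open>\<parallel>\<nabla>F\<parallel>\<^sup>2 / (2 N\<^sup>2)\<close> with \<open>N = max\<^sub>i \<parallel>\<omega> i - \<theta>\<parallel>\<close>.
\<close>

section \<open>Self-concordant barriers\<close>

text \<open>No iterate is ever compared with a point of the central path. The invariant of both
  stages bounds the dual local norm of the residual, such as
  \<open>\<eta> *\<^sub>R c + g p\<close>, by means of test vectors in \<open>E\<close>. So no
  minimizer has to exist, compactness and completeness do not enter, and the axioms ask only for
  directional derivatives inside \<open>E\<close>. In the radius bound, the gaps are inner products
  with differences of columns, and such differences need not form a totally unimodular matrix.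
  Bordering by a column of ones keeps the columns themselves; the price is a factor of at most n for
  each entry of a dual vector. Together with at most n tight constraints and the passage to the
  Euclidean norm this gives n^(5/2), which is what n / \<phi> amounts to for \<phi> =
  n^(-3/2).\<close>

locale self_concordant_barrier =
  fixes E S :: "'b::real_inner set" and g :: "'b \<Rightarrow> 'b" and H :: "'b \<Rightarrow> 'b \<Rightarrow> 'b" and \<nu> :: real
  assumes subspace_E: "subspace E"
    and S_subset: "S \<subseteq> E"
    and convex_S: "convex S"
    and g_in: "p \<in> S \<Longrightarrow> g p \<in> E"
    and linear_H: "p \<in> S \<Longrightarrow> linear (H p)"
    and bij_H: "p \<in> S \<Longrightarrow> bij_betw (H p) E E"
    and H_sym: "p \<in> S \<Longrightarrow> u \<in> E \<Longrightarrow> v \<in> E \<Longrightarrow> inner u (H p v) = inner v (H p u)"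
    and H_pos: "p \<in> S \<Longrightarrow> v \<in> E \<Longrightarrow> v \<noteq> 0 \<Longrightarrow> 0 < inner v (H p v)"
    and dikin: "p \<in> S \<Longrightarrow> v \<in> E \<Longrightarrow> inner v (H p v) < 1 \<Longrightarrow> p + v \<in> S"
    and g_deriv: "p \<in> S \<Longrightarrow> v \<in> E \<Longrightarrow> u \<in> E \<Longrightarrow>
      ((\<lambda>s. inner (g (p + s *\<^sub>R v)) u) has_real_derivative inner u (H p v)) (at 0)"
    and H_deriv: "p \<in> S \<Longrightarrow> v \<in> E \<Longrightarrow> u \<in> E \<Longrightarrow>
      \<exists>D. ((\<lambda>s. inner u (H (p + s *\<^sub>R v) u)) has_real_derivative D) (at 0) \<and>
        \<bar>D\<bar> \<le> 2 * sqrt (inner v (H p v)) * inner u (H p u)"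
    and nu_ge: "5 \<le> \<nu>"
    and g_dual: "p \<in> S \<Longrightarrow> v \<in> E \<Longrightarrow> \<bar>inner (g p) v\<bar> \<le> sqrt \<nu> * sqrt (inner v (H p v))"
    and g_le_nu: "p \<in> S \<Longrightarrow> y \<in> S \<Longrightarrow> inner (g p) (y - p) \<le> \<nu>"
begin

section \<open>The local norm and its dual\<close>

definition nrm :: "'b \<Rightarrow> 'b \<Rightarrow> real" where
  "nrm p v = sqrt (inner v (H p v))"

text \<open>\<open>M\<close> bounds the norm of the functional \<open>inner w\<close> dual to the
  local norm at \<open>p\<close>. Test vectors take the place of the inverse Hessian, so that such
  bounds add, scale and pass from one point to another.\<close>

definition dual_le :: "'b \<Rightarrow> 'b \<Rightarrow> real \<Rightarrow> bool" where
  "dual_le p w M \<longleftrightarrow> (\<forall>v\<in>E. \<bar>inner w v\<bar> \<le> M * nrm p v)"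

abbreviation Hinv :: "'b \<Rightarrow> 'b \<Rightarrow> 'b" where
  "Hinv p \<equiv> inv_into E (H p)"

lemma H_nonneg: "p \<in> S \<Longrightarrow> v \<in> E \<Longrightarrow> 0 \<le> inner v (H p v)"
  using H_pos[of p v] by (cases "v = 0") auto

lemma nrm_nonneg: "p \<in> S \<Longrightarrow> v \<in> E \<Longrightarrow> 0 \<le> nrm p v"
  by (simp add: nrm_def H_nonneg)

lemma nrm_sq: "p \<in> S \<Longrightarrow> v \<in> E \<Longrightarrow> (nrm p v)\<^sup>2 = inner v (H p v)"
  by (simp add: nrm_def H_nonneg)

lemma nrm_pos: "p \<in> S \<Longrightarrow> v \<in> E \<Longrightarrow> v \<noteq> 0 \<Longrightarrow> 0 < nrm p v"
  by (simp add: nrm_def H_pos)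

lemma Hinv_in: "p \<in> S \<Longrightarrow> w \<in> E \<Longrightarrow> Hinv p w \<in> E"
  using bij_H by (metis bij_betw_def inv_into_into)

lemma H_Hinv: "p \<in> S \<Longrightarrow> w \<in> E \<Longrightarrow> H p (Hinv p w) = w"
  using bij_H by (metis bij_betw_inv_into_right)

lemmas E_intros = subspace_scale[OF subspace_E] subspace_add[OF subspace_E]
  subspace_diff[OF subspace_E] subspace_neg[OF subspace_E] subspace_0[OF subspace_E]

lemma nrm_scale: "p \<in> S \<Longrightarrow> nrm p (a *\<^sub>R v) = \<bar>a\<bar> * nrm p v"
  by (simp add: nrm_def linear_cmul[OF linear_H] real_sqrt_mult real_sqrt_abs2 flip: mult.assoc)

text \<open>Polarization for a symmetric form that may be indefinite. Scaling \<open>u\<close> by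
  the norm of \<open>v\<close> and conversely gives both vectors the norm \<open>a * b\<close>, so
  that the parallelogram law of the local norm produces the product of the norms.\<close>

lemma symmetric_form_bound:
  assumes p: "p \<in> S" and A: "linear A"
    and sym: "\<And>u v. u \<in> E \<Longrightarrow> v \<in> E \<Longrightarrow> inner u (A v) = inner v (A u)"
    and diag: "\<And>u. u \<in> E \<Longrightarrow> \<bar>inner u (A u)\<bar> \<le> \<kappa> * (nrm p u)\<^sup>2"
    and uv: "u \<in> E" "v \<in> E"
  shows "\<bar>inner u (A v)\<bar> \<le> \<kappa> * nrm p u * nrm p v"
proof (cases "u = 0 \<or> v = 0")
  case True
  then show ?thesis by (auto simp: linear_0[OF A] nrm_def linear_0[OF linear_H[OF p]])
next
  case False
  define a where "a = nrm p u"
  define b where "b = nrm p v"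
  have a: "a > 0" and b: "b > 0" using False uv nrm_pos[OF p] by (auto simp: a_def b_def)
  define u' where "u' = b *\<^sub>R u"
  define v' where "v' = a *\<^sub>R v"
  have in_E: "u' \<in> E" "v' \<in> E" using uv by (auto simp: u'_def v'_def intro: E_intros)
  note H = linear_H[OF p]
  have H_eq: "(nrm p (u' + v'))\<^sup>2 + (nrm p (u' - v'))\<^sup>2 = 2 * (nrm p u')\<^sup>2 + 2 * (nrm p v')\<^sup>2"
    using in_E by (simp add: nrm_sq[OF p] E_intros linear_add[OF H] linear_diff[OF H] algebra_simps inner_simps)
  have "4 * inner u' (A v') = inner (u' + v') (A (u' + v')) - inner (u' - v') (A (u' - v'))"
    using sym[OF in_E] by (simp add: linear_add[OF A] linear_diff[OF A] inner_simps)
  also have "\<bar>\<dots>\<bar> \<le> \<kappa> * (nrm p (u' + v'))\<^sup>2 + \<kappa> * (nrm p (u' - v'))\<^sup>2"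
    using diag[OF E_intros(2)[OF in_E]] diag[OF E_intros(3)[OF in_E]] by linarith
  also have "\<dots> = \<kappa> * (2 * (nrm p u')\<^sup>2 + 2 * (nrm p v')\<^sup>2)"
    by (subst distrib_left[symmetric], subst H_eq) (rule refl)
  also have "\<dots> = 4 * \<kappa> * (a * b)\<^sup>2"
    using a b by (simp add: u'_def v'_def nrm_scale[OF p] power_mult_distrib flip: a_def b_def)
  finally have "\<bar>inner u' (A v')\<bar> \<le> \<kappa> * (a * b)\<^sup>2" by simp
  moreover have "inner u' (A v') = a * b * inner u (A v)"
    by (simp add: u'_def v'_def linear_cmul[OF A])
  ultimately have "a * b * \<bar>inner u (A v)\<bar> \<le> a * b * (\<kappa> * a * b)"
    using a b by (simp add: abs_mult power2_eq_square mult_ac)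
  then show ?thesis using a b by (simp add: a_def b_def)
qed

lemma cauchy_schwarz_H:
  assumes "p \<in> S" "u \<in> E" "v \<in> E"
  shows "\<bar>inner u (H p v)\<bar> \<le> nrm p u * nrm p v"
  using symmetric_form_bound[OF assms(1) linear_H[OF assms(1)] H_sym[OF assms(1)] _ assms(2,3), of 1]
  by (simp add: nrm_sq[OF assms(1)] H_nonneg[OF assms(1)])

text \<open>The length of a Newton step is the dual norm of the gradient: one direction is
  Cauchy-Schwarz, the other tests with \<open>Hinv p w\<close> itself.\<close>

lemma nrm_Hinv_le_iff:
  assumes p: "p \<in> S" and w: "w \<in> E" and M: "M \<ge> 0"
  shows "nrm p (Hinv p w) \<le> M \<longleftrightarrow> dual_le p w M"
proof
  assume L: "nrm p (Hinv p w) \<le> M"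
  show "dual_le p w M" unfolding dual_le_def
  proof
    fix v assume v: "v \<in> E"
    have "\<bar>inner w v\<bar> = \<bar>inner v (H p (Hinv p w))\<bar>"
      by (simp add: H_Hinv[OF p w] inner_commute)
    also have "\<dots> \<le> nrm p v * nrm p (Hinv p w)"
      by (rule cauchy_schwarz_H[OF p v Hinv_in[OF p w]])
    also have "\<dots> \<le> M * nrm p v"
      using mult_left_mono[OF L nrm_nonneg[OF p v]] by (simp add: mult.commute)
    finally show "\<bar>inner w v\<bar> \<le> M * nrm p v" .
  qed
next
  assume "dual_le p w M"
  then have "\<bar>inner w (Hinv p w)\<bar> \<le> M * nrm p (Hinv p w)"
    using Hinv_in[OF p w] by (simp add: dual_le_def)
  moreover have "inner w (Hinv p w) = (nrm p (Hinv p w))\<^sup>2"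
    using nrm_sq[OF p Hinv_in[OF p w]] by (simp add: H_Hinv[OF p w] inner_commute)
  ultimately have "nrm p (Hinv p w) * nrm p (Hinv p w) \<le> M * nrm p (Hinv p w)"
    by (simp add: power2_eq_square)
  then show "nrm p (Hinv p w) \<le> M"
    using nrm_nonneg[OF p Hinv_in[OF p w]] M
    by (cases "nrm p (Hinv p w) = 0") (simp_all add: mult_le_cancel_right)
qed

lemma dual_le_g: "p \<in> S \<Longrightarrow> dual_le p (g p) (sqrt \<nu>)"
  using g_dual by (simp add: dual_le_def nrm_def)

lemma dual_le_add:
  assumes "dual_le p w M" "dual_le p w' M'"
  shows "dual_le p (w + w') (M + M')"
  unfolding dual_le_def
proof
  fix v assume "v \<in> E"
  then have "\<bar>inner w v\<bar> \<le> M * nrm p v" "\<bar>inner w' v\<bar> \<le> M' * nrm p v"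
    using assms by (auto simp: dual_le_def)
  then show "\<bar>inner (w + w') v\<bar> \<le> (M + M') * nrm p v"
    unfolding inner_add_left distrib_right by linarith
qed

lemma dual_le_scale:
  "dual_le p w M \<Longrightarrow> dual_le p (a *\<^sub>R w) (\<bar>a\<bar> * M)"
  unfolding dual_le_def by (simp add: abs_mult mult.assoc mult_left_mono)

lemma dual_le_mono:
  assumes "p \<in> S" "dual_le p w M" "M \<le> M'"
  shows "dual_le p w M'"
  unfolding dual_le_def
proof
  fix v assume v: "v \<in> E"
  show "\<bar>inner w v\<bar> \<le> M' * nrm p v"
    using mult_right_mono[OF assms(3) nrm_nonneg[OF assms(1) v]] assms(2) v
    by (fastforce simp: dual_le_def)
qed

text \<open>Membership of \<open>p + v\<close> in \<open>S\<close> is available only for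
  \<open>nrm p v < 1\<close>, so a vector is divided by slightly more than its norm and the excess
  tends to 0. This also covers \<open>v = 0\<close>.\<close>

lemma dual_leI:
  assumes p: "p \<in> S" and M: "0 \<le> M" and le: "\<And>v. v \<in> E \<Longrightarrow> nrm p v < 1 \<Longrightarrow> \<bar>inner c v\<bar> \<le> M"
  shows "dual_le p c M"
  unfolding dual_le_def
proof
  fix v assume v: "v \<in> E"
  show "\<bar>inner c v\<bar> \<le> M * nrm p v"
  proof (rule field_le_epsilon)
    fix e :: real assume e: "0 < e"
    define r where "r = nrm p v + e / (M + 1)"
    have r: "0 < r" "nrm p v < r" using e M nrm_nonneg[OF p v] by (auto simp: r_def add_nonneg_pos)
    have "nrm p ((1 / r) *\<^sub>R v) < 1" using r nrm_nonneg[OF p v] by (simp add: nrm_scale[OF p])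
    then have "\<bar>inner c ((1 / r) *\<^sub>R v)\<bar> \<le> M" by (intro le E_intros v)
    then have "\<bar>inner c v\<bar> \<le> M * r" using r by (simp add: abs_mult pos_divide_le_eq)
    also have "M * r = M * nrm p v + M / (M + 1) * e" by (simp add: r_def distrib_left)
    also have "M / (M + 1) * e \<le> 1 * e" using M e by (intro mult_right_mono) auto
    finally show "\<bar>inner c v\<bar> \<le> M * nrm p v + e" by simp
  qed
qed

section \<open>Self-concordance along lines\<close>

lemma g_line_deriv:
  assumes "p + s *\<^sub>R v \<in> S" "v \<in> E" "u \<in> E"
  shows "((\<lambda>s. inner (g (p + s *\<^sub>R v)) u) has_real_derivative inner u (H (p + s *\<^sub>R v) v)) (at s)"
proof -
  have "((\<lambda>x. inner (g (p + (x + s) *\<^sub>R v)) u) has_real_derivative inner u (H (p + s *\<^sub>R v) v)) (at 0)"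
    using g_deriv[OF assms] by (simp add: scaleR_add_left ac_simps)
  then show ?thesis
    using DERIV_shift[of "\<lambda>s. inner (g (p + s *\<^sub>R v)) u" _ 0 s] by simp
qed

lemma H_line_deriv:
  assumes "p + s *\<^sub>R v \<in> S" "v \<in> E" "u \<in> E"
  obtains D where "((\<lambda>s. inner u (H (p + s *\<^sub>R v) u)) has_real_derivative D) (at s)"
    "\<bar>D\<bar> \<le> 2 * nrm (p + s *\<^sub>R v) v * inner u (H (p + s *\<^sub>R v) u)"
proof -
  obtain D where D: "((\<lambda>x. inner u (H (p + s *\<^sub>R v + x *\<^sub>R v) u)) has_real_derivative D) (at 0)"
    "\<bar>D\<bar> \<le> 2 * nrm (p + s *\<^sub>R v) v * inner u (H (p + s *\<^sub>R v) u)"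
    using H_deriv[OF assms] by (auto simp: nrm_def)
  have "((\<lambda>x. inner u (H (p + (x + s) *\<^sub>R v) u)) has_real_derivative D) (at 0)"
    using D(1) by (simp add: scaleR_add_left ac_simps)
  then show ?thesis
    using that D(2) DERIV_shift[of "\<lambda>s. inner u (H (p + s *\<^sub>R v) u)" _ 0 s] by simp
qed

text \<open>The usual reformulation of self-concordance: with b the second derivative along the
  line, b^(-1/2) has derivative - b' / (2 b^(3/2)), and |b'| \<le> 2 b^(3/2).\<close>

lemma inverse_nrm_deriv:
  assumes p: "p + s *\<^sub>R v \<in> S" and v: "v \<in> E" "v \<noteq> 0"
  obtains D where "((\<lambda>s. 1 / nrm (p + s *\<^sub>R v) v) has_real_derivative D) (at s)" "\<bar>D\<bar> \<le> 1"
proof -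
  obtain D where D: "((\<lambda>s. inner v (H (p + s *\<^sub>R v) v)) has_real_derivative D) (at s)"
    "\<bar>D\<bar> \<le> 2 * nrm (p + s *\<^sub>R v) v * inner v (H (p + s *\<^sub>R v) v)"
    by (rule H_line_deriv[OF p v(1) v(1)])
  define b where "b = inner v (H (p + s *\<^sub>R v) v)"
  have b: "b > 0" using H_pos[OF p v] by (simp add: b_def)
  have "((\<lambda>s. 1 / nrm (p + s *\<^sub>R v) v) has_real_derivative - (D / (2 * sqrt b * b))) (at s)"
    unfolding nrm_def
    by (rule derivative_eq_intros refl D(1) | use b in \<open>simp add: b_def[symmetric] field_simps\<close>)+
  moreover have "\<bar>- (D / (2 * sqrt b * b))\<bar> \<le> 1"
    using D(2) b by (simp add: b_def[symmetric] nrm_def abs_mult)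
  ultimately show ?thesis using that by blast
qed

lemma in_S_segment:
  assumes "p \<in> S" "y \<in> S" "0 \<le> s" "s \<le> 1"
  shows "p + s *\<^sub>R (y - p) \<in> S"
proof -
  have "(1 - s) *\<^sub>R p + s *\<^sub>R y \<in> S"
    using convex_S assms by (auto simp: convex_alt)
  then show ?thesis by (simp add: algebra_simps)
qed

text \<open>The reciprocal of the norm has derivative at least - 1, so it drops by at most s on the
  way to \<open>p + s *\<^sub>R h\<close>.\<close>

lemma nrm_line_upper:
  assumes p: "p \<in> S" and h: "h \<in> E" and r: "nrm p h < 1" and s: "0 \<le> s" "s \<le> 1"
    and S: "\<And>s. 0 \<le> s \<Longrightarrow> s \<le> 1 \<Longrightarrow> p + s *\<^sub>R h \<in> S"
  shows "nrm (p + s *\<^sub>R h) h \<le> nrm p h / (1 - s * nrm p h)"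
proof (cases "h = 0")
  case True
  then show ?thesis using p by (simp add: nrm_def)
next
  case False
  define r where "r = nrm p h"
  have r0: "0 < r" "r < 1" using nrm_pos[OF p h False] r by (auto simp: r_def)
  have pos: "0 < nrm (p + s *\<^sub>R h) h" using nrm_pos[OF S[OF s] h False] .
  have "1 / nrm (p + 0 *\<^sub>R h) h + 0 \<le> 1 / nrm (p + s *\<^sub>R h) h + s"
  proof (rule DERIV_nonneg_imp_nondecreasing[OF s(1)])
    fix x assume x: "0 \<le> x" "x \<le> s"
    obtain D where D: "((\<lambda>s. 1 / nrm (p + s *\<^sub>R h) h) has_real_derivative D) (at x)" "\<bar>D\<bar> \<le> 1"
      using inverse_nrm_deriv[OF S[of x] h False] x s by auto
    have "((\<lambda>s. 1 / nrm (p + s *\<^sub>R h) h + s) has_real_derivative D + 1) (at x)"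
      by (intro derivative_intros D)
    then show "\<exists>y. ((\<lambda>s. 1 / nrm (p + s *\<^sub>R h) h + s) has_real_derivative y) (at x) \<and> 0 \<le> y"
      using D(2) by (intro exI[of _ "D + 1"]) auto
  qed
  then have "1 / r - s \<le> 1 / nrm (p + s *\<^sub>R h) h" by (simp add: r_def)
  moreover have "s * r < 1" using mult_right_mono[of s 1 r] r0 s by linarith
  ultimately show ?thesis
    using r0 pos by (simp add: r_def[symmetric] field_simps)
qed

text \<open>The reciprocal of the norm grows by at most s. Unlike the upper bound this asks for no
  smallness of \<open>y - p\<close>, so it serves for the distant comparison points of
  \<open>objective_gap\<close>.\<close>

lemma nrm_line_lower:
  assumes p: "p \<in> S" and y: "y \<in> S" and s: "0 \<le> s" "s \<le> 1"
  shows "nrm p (y - p) / (1 + s * nrm p (y - p)) \<le> nrm (p + s *\<^sub>R (y - p)) (y - p)"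
proof (cases "y = p")
  case True
  then show ?thesis using linear_0[OF linear_H[OF p]] by (simp add: nrm_def)
next
  case False
  define h where "h = y - p"
  have h: "h \<in> E" "h \<noteq> 0" using p y S_subset False by (auto simp: h_def intro: E_intros)
  define r where "r = nrm p h"
  have r0: "0 < r" using nrm_pos[OF p h] by (auto simp: r_def)
  note S = in_S_segment[OF p y, folded h_def]
  have pos: "0 < nrm (p + s *\<^sub>R h) h" using nrm_pos[OF S[OF s] h] .
  have "1 / nrm (p + s *\<^sub>R h) h - s \<le> 1 / nrm (p + 0 *\<^sub>R h) h - 0"
  proof (rule DERIV_nonpos_imp_nonincreasing[OF s(1)])
    fix x assume x: "0 \<le> x" "x \<le> s"
    obtain D where D: "((\<lambda>s. 1 / nrm (p + s *\<^sub>R h) h) has_real_derivative D) (at x)" "\<bar>D\<bar> \<le> 1"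
      using inverse_nrm_deriv[OF S[of x] h] x s by auto
    have "((\<lambda>s. 1 / nrm (p + s *\<^sub>R h) h - s) has_real_derivative D - 1) (at x)"
      by (intro derivative_intros D)
    then show "\<exists>y. ((\<lambda>s. 1 / nrm (p + s *\<^sub>R h) h - s) has_real_derivative y) (at x) \<and> y \<le> 0"
      using D(2) by (intro exI[of _ "D - 1"]) auto
  qed
  then have *: "1 / nrm (p + s *\<^sub>R h) h \<le> s + 1 / r" by (simp add: r_def)
  have "0 < 1 + s * r" using r0 s by (simp add: add_pos_nonneg)
  then have "r / (1 + s * r) = 1 / (s + 1 / r)" using r0 by (simp add: field_simps)
  also have "\<dots> \<le> 1 / (1 / nrm (p + s *\<^sub>R h) h)"
    by (intro divide_left_mono * mult_pos_pos) (use pos r0 s in \<open>auto intro: add_nonneg_pos\<close>)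
  finally show ?thesis by (simp add: r_def h_def)
qed

text \<open>The derivative of ln (u^T H u) along the segment is at most 2 r / (1 - x r) in absolute
  value, and this is the derivative of - 2 ln (1 - x r). Integrating both inequalities gives the
  factor (1 - s r)^2.\<close>

lemma H_line_bounds:
  assumes p: "p \<in> S" and h: "h \<in> E" and r: "nrm p h < 1" and s: "0 \<le> s" "s \<le> 1" and u: "u \<in> E"
  shows "p + s *\<^sub>R h \<in> S"
    and "(1 - s * nrm p h)\<^sup>2 * inner u (H p u) \<le> inner u (H (p + s *\<^sub>R h) u)"
    and "inner u (H (p + s *\<^sub>R h) u) \<le> inner u (H p u) / (1 - s * nrm p h)\<^sup>2"
proof -
  define r where "r = nrm p h"
  have r0: "0 \<le> r" "r < 1" using nrm_nonneg[OF p h] r by (auto simp: r_def)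
  have sr: "x * r < 1" if "0 \<le> x" "x \<le> 1" for x
    using mult_right_mono[of x 1 r] r0 that by linarith
  have S: "p + x *\<^sub>R h \<in> S" if x: "0 \<le> x" "x \<le> 1" for x
  proof (rule dikin[OF p])
    show "x *\<^sub>R h \<in> E" using h by (rule E_intros)
    have "nrm p (x *\<^sub>R h) < 1" using sr[OF x] x by (simp add: nrm_scale[OF p] r_def)
    then show "inner (x *\<^sub>R h) (H p (x *\<^sub>R h)) < 1" by (simp add: nrm_def)
  qed
  then show "p + s *\<^sub>R h \<in> S" using s .
  have D: "\<exists>D. ((\<lambda>x. ln (inner u (H (p + x *\<^sub>R h) u))) has_real_derivative D) (at x) \<and> \<bar>D\<bar> \<le> 2 * (r / (1 - x * r))"
    if u0: "u \<noteq> 0" and x: "0 \<le> x" "x \<le> s" for x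
  proof -
    have x1: "x \<le> 1" using x s by simp
    have pos: "0 < inner u (H (p + x *\<^sub>R h) u)" using H_pos[OF S u u0] x x1 by simp
    obtain D where D: "((\<lambda>x. inner u (H (p + x *\<^sub>R h) u)) has_real_derivative D) (at x)"
      "\<bar>D\<bar> \<le> 2 * nrm (p + x *\<^sub>R h) h * inner u (H (p + x *\<^sub>R h) u)"
      using H_line_deriv[OF S h u] x x1 by blast
    have "((\<lambda>x. ln (inner u (H (p + x *\<^sub>R h) u))) has_real_derivative D / inner u (H (p + x *\<^sub>R h) u)) (at x)"
      by (rule derivative_eq_intros D(1) refl | use pos in simp)+
    moreover have "\<bar>D / inner u (H (p + x *\<^sub>R h) u)\<bar> \<le> 2 * nrm (p + x *\<^sub>R h) h"
      using D(2) pos by (simp add: abs_div_pos[symmetric] pos_divide_le_eq)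
    ultimately show ?thesis
      using nrm_line_upper[OF p h r x(1) x1 S] by (intro exI conjI) (auto simp: r_def)
  qed
  have lnD: "((\<lambda>x. 2 * ln (1 - x * r)) has_real_derivative - (2 * (r / (1 - x * r)))) (at x)"
    if "0 \<le> x" "x \<le> s" for x
    by (rule derivative_eq_intros refl | use sr[of x] that s in \<open>simp add: field_simps\<close>)+
  have key: "(1 - s * r)\<^sup>2 * inner u (H p u) \<le> inner u (H (p + s *\<^sub>R h) u) \<and>
    inner u (H (p + s *\<^sub>R h) u) * (1 - s * r)\<^sup>2 \<le> inner u (H p u)"
  proof (cases "u = 0")
    case False
    have pos: "0 < inner u (H p u)" "0 < inner u (H (p + s *\<^sub>R h) u)" "0 < 1 - s * r"
      using H_pos[OF p u False] H_pos[OF S u False] s sr[of s] by auto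
    have "ln (inner u (H (p + 0 *\<^sub>R h) u)) - 2 * ln (1 - 0 * r)
        \<le> ln (inner u (H (p + s *\<^sub>R h) u)) - 2 * ln (1 - s * r)"
    proof (rule DERIV_nonneg_imp_nondecreasing[OF s(1)])
      fix x assume x: "0 \<le> x" "x \<le> s"
      obtain D where "((\<lambda>x. ln (inner u (H (p + x *\<^sub>R h) u))) has_real_derivative D) (at x)" "\<bar>D\<bar> \<le> 2 * (r / (1 - x * r))"
        using D[OF False x] by blast
      then show "\<exists>y. ((\<lambda>s. ln (inner u (H (p + s *\<^sub>R h) u)) - 2 * ln (1 - s * r)) has_real_derivative y) (at x) \<and> 0 \<le> y"
        using lnD[OF x] by (intro exI[of _ "D - - (2 * (r / (1 - x * r)))"] conjI derivative_intros) auto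
    qed
    moreover have "ln (inner u (H (p + s *\<^sub>R h) u)) + 2 * ln (1 - s * r)
       \<le> ln (inner u (H (p + 0 *\<^sub>R h) u)) + 2 * ln (1 - 0 * r)"
    proof (rule DERIV_nonpos_imp_nonincreasing[OF s(1)])
      fix x assume x: "0 \<le> x" "x \<le> s"
      obtain D where "((\<lambda>x. ln (inner u (H (p + x *\<^sub>R h) u))) has_real_derivative D) (at x)" "\<bar>D\<bar> \<le> 2 * (r / (1 - x * r))"
        using D[OF False x] by blast
      then show "\<exists>y. ((\<lambda>s. ln (inner u (H (p + s *\<^sub>R h) u)) + 2 * ln (1 - s * r)) has_real_derivative y) (at x) \<and> y \<le> 0"
        using lnD[OF x] by (intro exI[of _ "D + - (2 * (r / (1 - x * r)))"] conjI derivative_intros) auto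
    qed
    ultimately have "ln ((1 - s * r)\<^sup>2 * inner u (H p u)) \<le> ln (inner u (H (p + s *\<^sub>R h) u))"
      "ln (inner u (H (p + s *\<^sub>R h) u) * (1 - s * r)\<^sup>2) \<le> ln (inner u (H p u))"
      using pos by (simp_all add: ln_mult_pos ln_realpow)
    then show ?thesis using pos by simp
  qed simp
  then show "(1 - s * nrm p h)\<^sup>2 * inner u (H p u) \<le> inner u (H (p + s *\<^sub>R h) u)" by (simp add: r_def)
  have "0 < (1 - s * r)\<^sup>2" using sr[of s] s by simp
  then show "inner u (H (p + s *\<^sub>R h) u) \<le> inner u (H p u) / (1 - s * nrm p h)\<^sup>2"
    using key by (simp add: pos_le_divide_eq r_def)
qed

text \<open>Along the segment the remainder has derivative u^T (H (p + x h) - H p) h.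
  \<open>H_line_bounds\<close> controls this difference of forms on the diagonal,
  \<open>symmetric_form_bound\<close> carries the control over to the pair u, h, and integration
  yields the quadratic bound.\<close>

lemma gradient_taylor:
  assumes p: "p \<in> S" and h: "h \<in> E" and r: "nrm p h < 1" and u: "u \<in> E"
  shows "\<bar>inner (g (p + h) - g p - H p h) u\<bar> \<le> (nrm p h)\<^sup>2 / (1 - nrm p h) * nrm p u"
proof -
  define r where "r = nrm p h"
  have r0: "0 \<le> r" "r < 1" using nrm_nonneg[OF p h] r by (auto simp: r_def)
  have sr: "x * r < 1" if "0 \<le> x" "x \<le> 1" for x
    using mult_right_mono[of x 1 r] r0 that by linarith
  define \<phi> where "\<phi> x = inner (g (p + x *\<^sub>R h)) u - x * inner u (H p h)" for x
  \<comment> \<open>An antiderivative of the bound \<open>D'\<close> below; \<open>b 1 - b 0\<close>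
    is r^2 / (1 - r) times the norm of u.\<close>
  define b where "b x = (1 / (1 - x * r) - x * r) * nrm p u" for x
  define D where "D x = inner u (H (p + x *\<^sub>R h) h) - inner u (H p h)" for x
  define D' where "D' x = (r / (1 - x * r)\<^sup>2 - r) * nrm p u" for x
  have D: "(\<phi> has_real_derivative D x) (at x)" "(b has_real_derivative D' x) (at x)" "\<bar>D x\<bar> \<le> D' x"
    if x: "0 \<le> x" "x \<le> 1" for x
  proof -
    note S = H_line_bounds(1)[OF p h r x h]
    show "(\<phi> has_real_derivative D x) (at x)" unfolding \<phi>_def D_def
      by (rule derivative_eq_intros g_line_deriv[OF S h u] refl | simp)+
    show "(b has_real_derivative D' x) (at x)" unfolding b_def D'_def
      by (rule derivative_eq_intros refl | use sr[OF x] in \<open>simp add: power2_eq_square\<close>)+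
    define \<kappa> where "\<kappa> = 1 / (1 - x * r)\<^sup>2 - 1"
    have d: "\<bar>inner w (H (p + x *\<^sub>R h) w - H p w)\<bar> \<le> \<kappa> * (nrm p w)\<^sup>2" if w: "w \<in> E" for w
    proof -
      have y: "0 < (1 - x * r)\<^sup>2" "(1 - x * r)\<^sup>2 \<le> 1"
        using sr[OF x] r0 x by (auto simp: power_le_one)
      \<comment> \<open>With y = (1 - x r)^2 this is 2 \<le> y + 1 / y: the possible decrease of the
        form is covered by the bound for its increase.\<close>
      have "1 - (1 - x * r)\<^sup>2 \<le> \<kappa>"
        using y sum_squares_bound[of 1 "(1 - x * r)\<^sup>2"] zero_le_power2[of "(1 - x * r)\<^sup>2 - 1"]
        by (simp add: \<kappa>_def field_simps power2_eq_square[of "_ - 1"])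
      then have "(1 - (1 - x * r)\<^sup>2) * inner w (H p w) \<le> \<kappa> * inner w (H p w)"
        by (intro mult_right_mono H_nonneg p w)
      then show ?thesis
        using H_line_bounds(2,3)[OF p h r x w, folded r_def]
        unfolding nrm_sq[OF p w] by (simp add: \<kappa>_def inner_diff_right algebra_simps abs_le_iff)
    qed
    have "\<bar>inner u (H (p + x *\<^sub>R h) h - H p h)\<bar> \<le> \<kappa> * nrm p u * nrm p h"
    proof (rule symmetric_form_bound[where A = "\<lambda>w. H (p + x *\<^sub>R h) w - H p w", OF p _ _ _ u h])
      show "linear (\<lambda>w. H (p + x *\<^sub>R h) w - H p w)"
        by (intro linear_compose_sub linear_H S p)
      show "inner a (H (p + x *\<^sub>R h) c - H p c) = inner c (H (p + x *\<^sub>R h) a - H p a)"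
        if "a \<in> E" "c \<in> E" for a c
        using H_sym[OF S that] H_sym[OF p that] by (simp add: inner_diff_right)
    qed (rule d)
    then show "\<bar>D x\<bar> \<le> D' x"
      by (simp add: D_def D'_def \<kappa>_def inner_diff_right algebra_simps flip: r_def)
  qed
  have "\<phi> 1 - b 1 \<le> \<phi> 0 - b 0"
  proof (rule DERIV_nonpos_imp_nonincreasing[of 0 1 "\<lambda>x. \<phi> x - b x"])
    show "\<exists>y. ((\<lambda>x. \<phi> x - b x) has_real_derivative y) (at x) \<and> y \<le> 0" if "0 \<le> x" "x \<le> 1" for x
      using D[OF that] by (intro exI[of _ "D x - D' x"] conjI derivative_intros) auto
  qed simp
  moreover have "\<phi> 0 + b 0 \<le> \<phi> 1 + b 1"
  proof (rule DERIV_nonneg_imp_nondecreasing[of 0 1 "\<lambda>x. \<phi> x + b x"])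
    show "\<exists>y. ((\<lambda>x. \<phi> x + b x) has_real_derivative y) (at x) \<and> 0 \<le> y" if "0 \<le> x" "x \<le> 1" for x
      using D[OF that] by (intro exI[of _ "D x + D' x"] conjI derivative_intros) auto
  qed simp
  ultimately have "\<bar>\<phi> 1 - \<phi> 0\<bar> \<le> b 1 - b 0" by simp
  moreover have "\<phi> 1 - \<phi> 0 = inner (g (p + h) - g p - H p h) u"
    by (simp add: \<phi>_def inner_diff_left inner_commute[of u])
  moreover have "b 1 - b 0 = r\<^sup>2 / (1 - r) * nrm p u"
    using r0 by (simp add: b_def field_simps power2_eq_square)
  ultimately show ?thesis by (simp add: r_def)
qed

text \<open>The Newton direction cancels the linear part of the residual, so the new residual is the
  Taylor remainder. One factor 1 / (1 - r) comes from the remainder, the other from passing to the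
  norm at the new point.\<close>

lemma newton_step:
  assumes p: "p \<in> S" and d: "d \<in> E" and l: "dual_le p (d + g p) l" "0 \<le> l" "l < 1"
  shows "p - Hinv p (d + g p) \<in> S"
    and "dual_le (p - Hinv p (d + g p)) (d + g (p - Hinv p (d + g p))) ((l / (1 - l))\<^sup>2)"
proof -
  have w: "d + g p \<in> E" using d g_in[OF p] by (rule E_intros)
  define h where "h = - Hinv p (d + g p)"
  have h: "h \<in> E" using Hinv_in[OF p w] by (simp add: h_def E_intros)
  have Hh: "H p h = - (d + g p)"
    using H_Hinv[OF p w] linear_neg[OF linear_H[OF p]] by (simp add: h_def)
  define r where "r = nrm p h"
  have "r = nrm p (Hinv p (d + g p))" using nrm_scale[OF p, of "-1"] by (simp add: r_def h_def)
  then have r: "0 \<le> r" "r \<le> l" "r < 1"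
    using nrm_Hinv_le_iff[OF p w l(2)] l nrm_nonneg[OF p h] by (auto simp: r_def)
  have q: "p + h \<in> S" using H_line_bounds(1)[OF p h _ _ _ h, of 1] r by (simp add: r_def)
  then show "p - Hinv p (d + g p) \<in> S" by (simp add: h_def)
  have "dual_le (p + h) (d + g (p + h)) ((l / (1 - l))\<^sup>2)" unfolding dual_le_def
  proof
    fix u assume u: "u \<in> E"
    have "d + g (p + h) = g (p + h) - g p - H p h" by (simp add: Hh)
    then have "\<bar>inner (d + g (p + h)) u\<bar> \<le> r\<^sup>2 / (1 - r) * nrm p u"
      using gradient_taylor[OF p h _ u] r by (simp only: r_def)
    also have "\<dots> \<le> r\<^sup>2 / (1 - r) * (nrm (p + h) u / (1 - r))"
    proof (rule mult_left_mono)
      have "((1 - r) * nrm p u)\<^sup>2 \<le> (nrm (p + h) u)\<^sup>2"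
        using H_line_bounds(2)[OF p h _ _ _ u, of 1] r
        by (simp add: r_def power_mult_distrib nrm_sq[OF p u] nrm_sq[OF q u])
      then have "(1 - r) * nrm p u \<le> nrm (p + h) u"
        by (rule power2_le_imp_le) (rule nrm_nonneg[OF q u])
      then show "nrm p u \<le> nrm (p + h) u / (1 - r)" using r by (simp add: field_simps)
    qed (use r in simp)
    also have "\<dots> = (r / (1 - r))\<^sup>2 * nrm (p + h) u"
      by (simp add: power2_eq_square)
    also have "\<dots> \<le> (l / (1 - l))\<^sup>2 * nrm (p + h) u"
      by (intro mult_right_mono power_mono nrm_nonneg q u frac_le) (use r l in auto)
    finally show "\<bar>inner (d + g (p + h)) u\<bar> \<le> (l / (1 - l))\<^sup>2 * nrm (p + h) u" .
  qed
  then show "dual_le (p - Hinv p (d + g p)) (d + g (p - Hinv p (d + g p))) ((l / (1 - l))\<^sup>2)"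
    by (simp add: h_def)
qed

lemma newton_step_quarter:
  assumes p: "p \<in> S" and d: "d \<in> E" and l: "dual_le p (d + g p) (1 / 4)"
  shows "p - Hinv p (d + g p) \<in> S"
    and "dual_le (p - Hinv p (d + g p)) (d + g (p - Hinv p (d + g p))) (1 / 9)"
  using newton_step[OF p d l] by (simp_all add: power2_eq_square)

text \<open>
  No minimizer of the centered problem is needed: on the segment from \<open>p\<close> to \<open>y\<close>, the derivative
  \<open>\<phi>'\<close> of the barrier satisfies \<open>\<phi>' 0 + b\<^sup>2 s / (1 + b s) \<le> \<phi>' s \<le> \<nu> / (1 - s)\<close> with
  \<open>b = nrm p (y - p)\<close>, which is used at \<open>s = 1 / 40\<close>.
\<close>

lemma objective_gap:
  assumes p: "p \<in> S" and y: "y \<in> S" and l: "dual_le p (\<eta> *\<^sub>R c + g p) (1 / 9)"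
  shows "\<eta> * inner c (p - y) \<le> 53 / 50 * \<nu>"
proof -
  define h where "h = y - p"
  have h: "h \<in> E" using p y S_subset by (auto simp: h_def intro: E_intros)
  define b where "b = nrm p h"
  have b: "b \<ge> 0" using nrm_nonneg[OF p h] by (simp add: b_def)
  note S = in_S_segment[OF p y, folded h_def]
  define \<phi> where "\<phi> s = inner (g (p + s *\<^sub>R h)) h" for s
  \<comment> \<open>A small \<open>s0\<close> keeps the factor 1 / (1 - s0) = 40 / 39 near 1, a
    large one strengthens the quadratic term; with 1 / 40 the total stays within 53 / 50 \<nu> for
    \<nu> \<ge> 5.\<close>
  define s0 :: real where "s0 = 1 / 40"
  \<comment> \<open>- b / (1 + s b) is an antiderivative of (b / (1 + s b))^2, the lower bound for
    the derivative of \<open>\<phi>\<close>.\<close>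
  have "\<phi> 0 + b / (1 + 0 * b) \<le> \<phi> s0 + b / (1 + s0 * b)"
  proof (rule DERIV_nonneg_imp_nondecreasing[of 0 s0 "\<lambda>s. \<phi> s + b / (1 + s * b)"])
    fix x assume x: "0 \<le> x" "x \<le> s0"
    then have x1: "x \<le> 1" by (simp add: s0_def)
    have pos: "0 < 1 + x * b" using x b by (simp add: add_pos_nonneg)
    have "((\<lambda>s. \<phi> s + b / (1 + s * b)) has_real_derivative inner h (H (p + x *\<^sub>R h) h) - (b / (1 + x * b))\<^sup>2) (at x)"
      unfolding \<phi>_def
      by (rule derivative_eq_intros g_line_deriv[OF S[OF x(1) x1] h h] refl | use pos in \<open>simp add: power2_eq_square\<close>)+
    moreover have "(b / (1 + x * b))\<^sup>2 \<le> (nrm (p + x *\<^sub>R h) h)\<^sup>2"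
      using nrm_line_lower[OF p y x(1) x1] b pos
      by (intro power_mono) (auto simp: b_def h_def)
    ultimately show "\<exists>y. ((\<lambda>s. \<phi> s + b / (1 + s * b)) has_real_derivative y) (at x) \<and> 0 \<le> y"
      by (auto simp: nrm_sq[OF S[OF x(1) x1] h])
  qed (simp add: s0_def)
  moreover have "(1 - s0) * \<phi> s0 \<le> \<nu>"
  proof -
    have "y - (p + s0 *\<^sub>R h) = (1 - s0) *\<^sub>R h" by (simp add: h_def algebra_simps)
    then show ?thesis
      using g_le_nu[OF S y, of s0] by (simp add: \<phi>_def s0_def)
  qed
  ultimately have 1: "\<phi> 0 + b - b / (1 + b / 40) \<le> 40 / 39 * \<nu>" by (simp add: s0_def)
  have 2: "b / 9 - (b - b / (1 + b / 40)) \<le> 14 / 100"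
  proof -
    have "b / 9 - (b - b / (1 + b / 40)) = (b / 9 * (40 + b) - b * b) / (40 + b)"
      using b by (simp add: field_simps)
    also have "\<dots> \<le> 14 / 100"
    proof -
      \<comment> \<open>Multiplied by 450, the next inequality reads 400 b^2 - 1937 b + 2520 \<ge>
        0. This is its completed square, and (1937 / 40)^2 < 2520.\<close>
      have "0 \<le> (20 * b - 1937 / 40)\<^sup>2" by simp
      then have "b / 9 * (40 + b) - b * b \<le> 14 / 100 * (40 + b)"
        by (simp add: power2_eq_square algebra_simps)
      then show ?thesis using b by (simp add: divide_le_eq)
    qed
    finally show ?thesis .
  qed
  have "\<eta> * inner c (p - y) = - inner (\<eta> *\<^sub>R c + g p) h + \<phi> 0"
    by (simp add: h_def \<phi>_def inner_simps algebra_simps)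
  also have "- inner (\<eta> *\<^sub>R c + g p) h \<le> b / 9"
    using l h unfolding dual_le_def b_def by force
  finally show ?thesis using 1 2 nu_ge by linarith
qed

section \<open>Following the central path\<close>

definition \<kappa> :: real where "\<kappa> = 1 / (8 * sqrt \<nu>)"

lemma kappa_bounds: "0 < \<kappa>" "\<kappa> \<le> 1 / 16" "\<kappa> * sqrt \<nu> = 1 / 8"
proof -
  have "sqrt 4 \<le> sqrt \<nu>" using nu_ge by (subst real_sqrt_le_iff) simp
  then have s: "2 \<le> sqrt \<nu>" by simp
  then show "0 < \<kappa>" "\<kappa> \<le> 1 / 16" "\<kappa> * sqrt \<nu> = 1 / 8"
    using nu_ge by (auto simp: \<kappa>_def field_simps)
qed

text \<open>A change of the parameter scales the old residual 1/9 by 1 + \<kappa> or 1 - \<kappa>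
  and adds at most \<kappa> sqrt \<nu> = 1/8. The total stays within 1/4, which a Newton step turns
  back into ((1/4) / (3/4))^2 = 1/9.\<close>

lemma kappa_sums: "\<bar>1 + \<kappa>\<bar> * (1 / 9) + \<bar>- \<kappa>\<bar> * sqrt \<nu> \<le> 1 / 4"
  "\<bar>1 - \<kappa>\<bar> * (1 / 9) + \<bar>\<kappa>\<bar> * sqrt \<nu> \<le> 1 / 4"
proof -
 have a: "\<bar>1 + \<kappa>\<bar> = 1 + \<kappa>" "\<bar>1 - \<kappa>\<bar> = 1 - \<kappa>" "\<bar>- \<kappa>\<bar> = \<kappa>" "\<bar>\<kappa>\<bar> = \<kappa>"
    using kappa_bounds by auto
  show "\<bar>1 + \<kappa>\<bar> * (1 / 9) + \<bar>- \<kappa>\<bar> * sqrt \<nu> \<le> 1 / 4"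
    "\<bar>1 - \<kappa>\<bar> * (1 / 9) + \<bar>\<kappa>\<bar> * sqrt \<nu> \<le> 1 / 4"
    unfolding a kappa_bounds(3) using kappa_bounds(1,2) by (simp_all add: field_simps)
qed

text \<open>The residual for the new parameter is 1 + \<kappa> times the old one minus \<kappa>
  \<open>g p\<close>. Expressing the change through \<open>g p\<close> rather than \<open>c\<close>
  lets \<nu> control it.\<close>

lemma main_step:
  assumes p: "p \<in> S" and c: "c \<in> E" and l: "dual_le p (\<eta> *\<^sub>R c + g p) (1 / 9)"
  defines "q \<equiv> p - Hinv p (((1 + \<kappa>) * \<eta>) *\<^sub>R c + g p)"
  shows "q \<in> S" "dual_le q (((1 + \<kappa>) * \<eta>) *\<^sub>R c + g q) (1 / 9)"
proof -
  have "((1 + \<kappa>) * \<eta>) *\<^sub>R c + g p = (1 + \<kappa>) *\<^sub>R (\<eta> *\<^sub>R c + g p) + (- \<kappa>) *\<^sub>R g p"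
    by (simp add: algebra_simps)
  then have "dual_le p (((1 + \<kappa>) * \<eta>) *\<^sub>R c + g p) (\<bar>1 + \<kappa>\<bar> * (1 / 9) + \<bar>- \<kappa>\<bar> * sqrt \<nu>)"
    by (simp only:) (rule dual_le_add[OF dual_le_scale[OF l] dual_le_scale[OF dual_le_g[OF p]]])
  then have "dual_le p (((1 + \<kappa>) * \<eta>) *\<^sub>R c + g p) (1 / 4)"
    by (rule dual_le_mono[OF p]) (rule kappa_sums)
  from newton_step_quarter[OF p _ this] show "q \<in> S" "dual_le q (((1 + \<kappa>) * \<eta>) *\<^sub>R c + g q) (1 / 9)"
    using c by (auto simp: q_def E_intros)
qed

lemma preliminary_step:
  assumes p: "p \<in> S" and g0: "g0 \<in> E" and l: "dual_le p (- \<mu> *\<^sub>R g0 + g p) (1 / 9)"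
  defines "q \<equiv> p - Hinv p (- ((1 - \<kappa>) * \<mu>) *\<^sub>R g0 + g p)"
  shows "q \<in> S" "dual_le q (- ((1 - \<kappa>) * \<mu>) *\<^sub>R g0 + g q) (1 / 9)"
proof -
  have eq: "(1 - \<kappa>) *\<^sub>R (- \<mu> *\<^sub>R g0 + g p) + \<kappa> *\<^sub>R g p = - ((1 - \<kappa>) * \<mu>) *\<^sub>R g0 + g p"
    unfolding scaleR_add_right scaleR_scaleR scaleR_diff_left mult_minus_right by (simp only: add.assoc diff_add_cancel scaleR_one)
  have "dual_le p ((1 - \<kappa>) *\<^sub>R (- \<mu> *\<^sub>R g0 + g p) + \<kappa> *\<^sub>R g p) (\<bar>1 - \<kappa>\<bar> * (1 / 9) + \<bar>\<kappa>\<bar> * sqrt \<nu>)"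
    by (rule dual_le_add[OF dual_le_scale[OF l] dual_le_scale[OF dual_le_g[OF p]]])
  then have le: "dual_le p (- ((1 - \<kappa>) * \<mu>) *\<^sub>R g0 + g p) (1 / 4)"
    unfolding eq by (rule dual_le_mono[OF p]) (rule kappa_sums)
  have E: "- ((1 - \<kappa>) * \<mu>) *\<^sub>R g0 \<in> E" by (rule E_intros(1)[OF g0])
  show "q \<in> S" "dual_le q (- ((1 - \<kappa>) * \<mu>) *\<^sub>R g0 + g q) (1 / 9)"
    unfolding q_def by (rule newton_step_quarter[OF p E le])+
qed

lemma main_stage:
  assumes p: "p \<in> S" and c: "c \<in> E" and l: "dual_le p (\<eta> *\<^sub>R c + g p) (1 / 9)"
  obtains q where "((\<lambda>(\<eta>, p). let \<eta>' = (1 + 1 / (8 * sqrt \<nu>)) * \<eta> in (\<eta>', p - Hinv p (\<eta>' *\<^sub>R c + g p))) ^^ T) (\<eta>, p)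
      = ((1 + \<kappa>) ^ T * \<eta>, q)"
    "q \<in> S" "dual_le q (((1 + \<kappa>) ^ T * \<eta>) *\<^sub>R c + g q) (1 / 9)"
proof -
  let ?f = "\<lambda>T. ((\<lambda>(\<eta>, p). let \<eta>' = (1 + 1 / (8 * sqrt \<nu>)) * \<eta> in (\<eta>', p - Hinv p (\<eta>' *\<^sub>R c + g p))) ^^ T) (\<eta>, p)"
  have "\<exists>q. ?f T = ((1 + \<kappa>) ^ T * \<eta>, q) \<and> q \<in> S \<and> dual_le q (((1 + \<kappa>) ^ T * \<eta>) *\<^sub>R c + g q) (1 / 9)"
  proof (induction T)
    case 0
    then show ?case using p l by simp
  next
    case (Suc T)
    then obtain q where "?f T = ((1 + \<kappa>) ^ T * \<eta>, q) \<and> q \<in> S \<and> dual_le q (((1 + \<kappa>) ^ T * \<eta>) *\<^sub>R c + g q) (1 / 9)" ..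
    then have e: "?f T = ((1 + \<kappa>) ^ T * \<eta>, q)" and q: "q \<in> S" "dual_le q (((1 + \<kappa>) ^ T * \<eta>) *\<^sub>R c + g q) (1 / 9)"
      by simp_all
    have "?f (Suc T) = ((1 + \<kappa>) ^ Suc T * \<eta>,
        q - Hinv q (((1 + \<kappa>) * ((1 + \<kappa>) ^ T * \<eta>)) *\<^sub>R c + g q))"
      unfolding funpow.simps o_apply e by (simp add: Let_def \<kappa>_def mult.assoc)
    then show ?case
      using main_step[OF q(1) c q(2)] by (simp add: mult.assoc)
  qed
  then show ?thesis using that by blast
qed

text \<open>The residual bound 1/9 leaves \<open>g p'\<close> with dual norm at most 1/9 + \<mu> G,
  and this is at most 1/6 once \<mu> \<le> 1 / (18 G). As \<mu> decays like exp (- \<kappa> i), the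
  loop stops after about ln (18 G) / \<kappa> steps.\<close>

lemma preliminary_stage:
  assumes p: "p \<in> S" and G: "\<And>q. q \<in> S \<Longrightarrow> dual_le q (g p) G" and G1: "1 \<le> G"
  obtains i \<mu> q where
    "while_option (\<lambda>(i, \<mu>, p'). nrm p' (Hinv p' (g p')) > 1 / 6)
      (\<lambda>(i, \<mu>, p'). let \<mu>' = (1 - 1 / (8 * sqrt \<nu>)) * \<mu> in (i + 1, \<mu>', p' - Hinv p' (- \<mu>' *\<^sub>R g p + g p')))
      (0 :: nat, 1, p) = Some (i, \<mu>, q)"
    "q \<in> S" "dual_le q (g q) (1 / 6)" "real i \<le> 8 * sqrt \<nu> * ln (18 * G) + 1"
proof -
  let ?b = "\<lambda>(i::nat, \<mu>::real, p'). nrm p' (Hinv p' (g p')) > 1 / 6"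
  let ?c = "\<lambda>(i, \<mu>, p'). let \<mu>' = (1 - 1 / (8 * sqrt \<nu>)) * \<mu> in (i + 1, \<mu>', p' - Hinv p' (- \<mu>' *\<^sub>R g p + g p'))"
  define X where "X = 8 * sqrt \<nu> * ln (18 * G)"
  define P where "P = (\<lambda>(i::nat, \<mu>::real, p'). p' \<in> S \<and> \<mu> = (1 - \<kappa>) ^ i \<and>
    dual_le p' (- \<mu> *\<^sub>R g p + g p') (1 / 9) \<and> real i \<le> X + 1)"
  have X0: "0 \<le> X" using G1 nu_ge by (simp add: X_def)
  \<comment> \<open>For \<mu> = 1 the starting point lies exactly on its path: the residual is
    0.\<close>
  have P0: "P (0, 1, p)"
    using p X0 by (simp add: P_def dual_le_def nrm_nonneg)
  \<comment> \<open>The guard can hold only up to step X. So the bound X + 1 in the invariant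
    survives one more increment, and it supplies the termination measure.\<close>
  have small: "real i \<le> X" if "P (i, \<mu>, p')" "?b (i, \<mu>, p')" for i \<mu> p'
  proof (rule ccontr)
    assume "\<not> real i \<le> X"
    then have i: "X < real i" by simp
    have S: "p' \<in> S" and \<mu>: "\<mu> = (1 - \<kappa>) ^ i" and l: "dual_le p' (- \<mu> *\<^sub>R g p + g p') (1 / 9)"
      using that(1) by (auto simp: P_def)
    have k: "8 * sqrt \<nu> * \<kappa> = 1" using kappa_bounds(3) by (simp add: mult_ac)
    have "1 - \<kappa> \<le> exp (- \<kappa>)" using exp_ge_add_one_self[of "- \<kappa>"] by simp
    then have "\<mu> \<le> exp (- \<kappa>) ^ i" unfolding \<mu> using kappa_bounds by (intro power_mono) auto
    also have "\<dots> = exp (- \<kappa> * real i)" by (simp add: exp_of_nat_mult[symmetric] mult.commute)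
    also have "\<dots> \<le> exp (- \<kappa> * X)" using i kappa_bounds(1) by simp
    also have "- \<kappa> * X = - ln (18 * G)" unfolding X_def using k by (simp add: mult_ac)
    also have "exp (- ln (18 * G)) = 1 / (18 * G)" using G1 by (simp add: exp_minus field_simps)
    finally have "\<mu> * G \<le> 1 / 18" using G1 by (simp add: field_simps)
    moreover have "0 \<le> \<mu>" unfolding \<mu> using kappa_bounds by simp
    ultimately have le: "1 / 9 + \<bar>\<mu>\<bar> * G \<le> 1 / 6" by simp
    have "dual_le p' (- \<mu> *\<^sub>R g p + g p' + \<mu> *\<^sub>R g p) (1 / 9 + \<bar>\<mu>\<bar> * G)"
      by (intro dual_le_add l dual_le_scale G S)
    then have "dual_le p' (g p') (1 / 9 + \<bar>\<mu>\<bar> * G)" by simp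
    from dual_le_mono[OF S this le] have "dual_le p' (g p') (1 / 6)" .
    then show False using that(2) nrm_Hinv_le_iff[OF S g_in[OF S], of "1 / 6"] by simp
  qed
  have step: "P (?c s)" if P: "P s" and b: "?b s" for s
  proof -
    obtain i \<mu> p' where s: "s = (i, \<mu>, p')" by (cases s) auto
    have S: "p' \<in> S" and \<mu>: "\<mu> = (1 - \<kappa>) ^ i" and l: "dual_le p' (- \<mu> *\<^sub>R g p + g p') (1 / 9)"
      using P by (auto simp: P_def s)
    show ?thesis
      using preliminary_step[OF S g_in[OF p] l] small P b
      by (auto simp: s P_def Let_def \<mu> simp flip: \<kappa>_def)
  qed
  have "\<exists>t. while_option ?b ?c (0, 1, p) = Some t"
  proof (rule measure_while_option_Some[of P _ _ "\<lambda>(i, \<mu>, p'). nat \<lceil>X + 1\<rceil> - i"])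
    fix s assume P: "P s" and b: "?b s"
    obtain i \<mu> p' where s: "s = (i, \<mu>, p')" by (cases s) auto
    have "real i < X + 1" using small P b by (force simp: s)
    then have "i < nat \<lceil>X + 1\<rceil>" by linarith
    then show "P (?c s) \<and> (case ?c s of (i, \<mu>, p') \<Rightarrow> nat \<lceil>X + 1\<rceil> - i) < (case s of (i, \<mu>, p') \<Rightarrow> nat \<lceil>X + 1\<rceil> - i)"
      using step[OF P b] by (simp add: s Let_def)
  qed (rule P0)
  then obtain i \<mu> q where t: "while_option ?b ?c (0, 1, p) = Some (i, \<mu>, q)" by auto
  have "P (i, \<mu>, q)" by (rule while_option_rule[OF step t P0])
  then have "q \<in> S" "real i \<le> X + 1" by (auto simp: P_def)
  moreover have "\<not> ?b (i, \<mu>, q)" by (rule while_option_stop[OF t])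
  then have "dual_le q (g q) (1 / 6)"
    using nrm_Hinv_le_iff[OF \<open>q \<in> S\<close> g_in[OF \<open>q \<in> S\<close>], of "1 / 6"] by simp
  ultimately show ?thesis using that t by (simp add: X_def)
qed

end

section \<open>The barrier of the geometric program\<close>

lemma self_minus_ln_one_plus_le:
  fixes \<zeta> :: real
  assumes "\<bar>\<zeta>\<bar> < 1"
  shows "\<zeta> - ln (1 + \<zeta>) \<le> \<zeta>\<^sup>2 / (2 * (1 - \<bar>\<zeta>\<bar>))"
proof (cases "0 \<le> \<zeta>")
  case True
  have "0\<^sup>2 / 2 - 0 + ln (1 + 0) \<le> \<zeta>\<^sup>2 / 2 - \<zeta> + ln (1 + \<zeta>)"
  proof (rule DERIV_nonneg_imp_nondecreasing[OF True, where f = "\<lambda>\<zeta>. \<zeta>\<^sup>2 / 2 - \<zeta> + ln (1 + \<zeta>)"])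
    fix x :: real assume x: "0 \<le> x"
    have "((\<lambda>\<zeta>. \<zeta>\<^sup>2 / 2 - \<zeta> + ln (1 + \<zeta>)) has_real_derivative x\<^sup>2 / (1 + x)) (at x)"
      by (rule derivative_eq_intros refl | use x in \<open>simp add: field_simps power2_eq_square\<close>)+
    then show "\<exists>y. ((\<lambda>\<zeta>. \<zeta>\<^sup>2 / 2 - \<zeta> + ln (1 + \<zeta>)) has_real_derivative y) (at x) \<and> 0 \<le> y"
      using x by (intro exI[of _ "x\<^sup>2 / (1 + x)"] conjI) auto
  qed
  then have "\<zeta> - ln (1 + \<zeta>) \<le> \<zeta>\<^sup>2 / 2" by simp
  also have "\<zeta>\<^sup>2 / 2 \<le> \<zeta>\<^sup>2 / (2 * (1 - \<bar>\<zeta>\<bar>))"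
    using assms by (intro divide_left_mono) auto
  finally show ?thesis .
next
  case False
  define \<xi> where "\<xi> = - \<zeta>"
  have \<xi>: "0 \<le> \<xi>" "\<xi> < 1" using False assms by (auto simp: \<xi>_def)
  have "0\<^sup>2 / (2 * (1 - 0)) + 0 + ln (1 - 0) \<le> \<xi>\<^sup>2 / (2 * (1 - \<xi>)) + \<xi> + ln (1 - \<xi>)"
  proof (rule DERIV_nonneg_imp_nondecreasing[OF \<xi>(1), where f = "\<lambda>\<xi>. \<xi>\<^sup>2 / (2 * (1 - \<xi>)) + \<xi> + ln (1 - \<xi>)"])
    fix x :: real assume x: "0 \<le> x" "x \<le> \<xi>"
    have x1: "x < 1" using x \<xi> by simp
    have "((\<lambda>\<xi>. \<xi>\<^sup>2 / (2 * (1 - \<xi>)) + \<xi> + ln (1 - \<xi>)) has_real_derivative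
      (2 * x * (2 * (1 - x)) - x\<^sup>2 * (- 2)) / (2 * (1 - x))\<^sup>2 + 1 - 1 / (1 - x)) (at x)"
      by (rule derivative_eq_intros refl | use x1 in \<open>simp add: power2_eq_square\<close>)+
    moreover have "(2 * x * (2 * (1 - x)) - x\<^sup>2 * (- 2)) / (2 * (1 - x))\<^sup>2 + 1 - 1 / (1 - x) = x\<^sup>2 / (2 * (1 - x)\<^sup>2)"
      using x1 by (simp add: power2_eq_square divide_simps) (simp add: algebra_simps)
    ultimately show "\<exists>y. ((\<lambda>\<xi>. \<xi>\<^sup>2 / (2 * (1 - \<xi>)) + \<xi> + ln (1 - \<xi>)) has_real_derivative y) (at x) \<and> 0 \<le> y"
      by (intro exI[of _ "x\<^sup>2 / (2 * (1 - x)\<^sup>2)"] conjI) auto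
  qed
  then show ?thesis using \<xi> by (simp add: \<xi>_def)
qed

text \<open>\<open>w\<close> is a slack ln z - y, \<zeta> the relative change of z and
  \<open>a\<close> the relative change of the linearized slack, so the last expression is the new
  slack. If it were not positive, the estimate of the logarithm and the hypothesis would give (1 + a
  - |\<zeta>|)^2 < 0.\<close>

lemma dikin_log_exp:
  fixes w \<zeta> a :: real
  assumes w: "0 < w" and less: "(1 + 1 / w) * \<zeta>\<^sup>2 + a\<^sup>2 < 1"
  shows "\<bar>\<zeta>\<bar> < 1" and "0 < w * (1 + a) + ln (1 + \<zeta>) - \<zeta>"
proof -
  define t where "t = \<zeta>\<^sup>2 / w"
  have n: "0 \<le> t" "0 \<le> a\<^sup>2" "0 \<le> \<zeta>\<^sup>2" using w by (auto simp: t_def)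
  have less': "\<zeta>\<^sup>2 + t + a\<^sup>2 < 1" using less by (simp add: t_def algebra_simps)
  have "\<zeta>\<^sup>2 < 1" "a\<^sup>2 < 1" using less' n by linarith+
  then have z: "\<bar>\<zeta>\<bar> < 1" and a: "\<bar>a\<bar> < 1" by (simp_all add: abs_square_less_1)
  show "\<bar>\<zeta>\<bar> < 1" by (rule z)
  define \<xi> where "\<xi> = \<bar>\<zeta>\<bar>"
  have \<xi>: "0 \<le> \<xi>" "\<xi> < 1" "\<xi>\<^sup>2 = \<zeta>\<^sup>2" using z by (auto simp: \<xi>_def)
  have "\<not> w * (1 + a) \<le> \<xi>\<^sup>2 / (2 * (1 - \<xi>))"
  proof
    assume "w * (1 + a) \<le> \<xi>\<^sup>2 / (2 * (1 - \<xi>))"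
    then have "2 * (1 + a) * (1 - \<xi>) \<le> t"
      using w \<xi> by (simp add: t_def field_simps)
    then have "\<xi>\<^sup>2 + 2 * (1 + a) * (1 - \<xi>) + a\<^sup>2 < 1" using less' \<xi>(3) by linarith
    then have "(1 + a - \<xi>)\<^sup>2 < 0" by (simp add: power2_eq_square algebra_simps)
    then show False by simp
  qed
  then show "0 < w * (1 + a) + ln (1 + \<zeta>) - \<zeta>"
    using self_minus_ln_one_plus_le[OF z] \<xi>(3) by (simp add: \<xi>_def)
qed

lemma two_term_cauchy_schwarz:
  fixes x y m l s :: real
  assumes "0 < s"
  shows "(x * m + y * l)\<^sup>2 \<le> (s * x\<^sup>2 + y\<^sup>2) * (m\<^sup>2 / s + l\<^sup>2)"
proof -
  have "(s * x\<^sup>2 + y\<^sup>2) * (m\<^sup>2 / s + l\<^sup>2) - (x * m + y * l)\<^sup>2 = s * (x * l - y * m / s)\<^sup>2"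
    using assms by (simp add: field_simps power2_eq_square)
  moreover have "0 \<le> s * (x * l - y * m / s)\<^sup>2" using assms by simp
  ultimately show ?thesis by linarith
qed

text \<open>The third derivative of the barrier \<open>- ln z - ln (ln z - y)\<close>, with \<open>s = 1 / (ln z - y)\<close>.\<close>

lemma log_exp_third_derivative_bound:
  fixes x y Z A s :: real
  assumes s: "0 < s"
  shows "\<bar>x * (2 * Z\<^sup>2 * (1 + s) + 2 * A * Z * s) + y * (Z\<^sup>2 * s + 2 * A\<^sup>2)\<bar>
    \<le> 2 * sqrt ((1 + s) * x\<^sup>2 + y\<^sup>2) * ((1 + s) * Z\<^sup>2 + A\<^sup>2)"
proof -
  define m where "m = 2 * Z\<^sup>2 * (1 + s) + 2 * A * Z * s"
  define l where "l = Z\<^sup>2 * s + 2 * A\<^sup>2"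
  define N where "N = (1 + s) * Z\<^sup>2 + A\<^sup>2"
  have N: "0 \<le> N" using s by (simp add: N_def)
  \<comment> \<open>The third derivative is the linear form x m + y l in the direction (x, y). By
    Cauchy-Schwarz for the weights 1 + s and 1 it remains to bound the dual norm of (m, l); the
    difference is exhibited as a combination of squares with nonnegative coefficients.\<close>
  have "m\<^sup>2 / (1 + s) + l\<^sup>2 \<le> 4 * N\<^sup>2"
  proof -
    have "(4 * N\<^sup>2 - (m\<^sup>2 / (1 + s) + l\<^sup>2)) * (1 + s) = Z\<^sup>2 * (Z\<^sup>2 * (s * (4 + 3 * s)) * (1 + s) - 8 * Z * A * s * (1 + s) + A\<^sup>2 * (8 + 12 * s))"
      using s unfolding N_def m_def l_def by (simp add: divide_simps) (simp add: power2_eq_square algebra_simps)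
    also have "Z\<^sup>2 * (s * (4 + 3 * s)) * (1 + s) - 8 * Z * A * s * (1 + s) + A\<^sup>2 * (8 + 12 * s)
      = (1 + s) * (4 * s * Z\<^sup>2 + 3 * (s * Z - 4 / 3 * A)\<^sup>2 + 8 / 3 * A\<^sup>2) + 4 * s * A\<^sup>2"
      by (simp add: power2_eq_square algebra_simps)
    finally have "0 \<le> (4 * N\<^sup>2 - (m\<^sup>2 / (1 + s) + l\<^sup>2)) * (1 + s)" using s by simp
    then show ?thesis using s by (simp add: zero_le_mult_iff)
  qed
  then have "((1 + s) * x\<^sup>2 + y\<^sup>2) * (m\<^sup>2 / (1 + s) + l\<^sup>2) \<le> ((1 + s) * x\<^sup>2 + y\<^sup>2) * (4 * N\<^sup>2)"
    using s by (intro mult_left_mono) auto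
  then have "(x * m + y * l)\<^sup>2 \<le> ((1 + s) * x\<^sup>2 + y\<^sup>2) * (4 * N\<^sup>2)"
    using two_term_cauchy_schwarz[of "1 + s" x m y l] s by linarith
  then have "sqrt ((x * m + y * l)\<^sup>2) \<le> sqrt (((1 + s) * x\<^sup>2 + y\<^sup>2) * (4 * N\<^sup>2))"
    by (rule real_sqrt_le_mono)
  then show ?thesis using N by (simp add: real_sqrt_mult m_def l_def N_def mult_ac)
qed

text \<open>The third derivative of - ln (R^2 - |x|^2). With Q = R^2 - |x|^2, A and C are 2 <x, u> /
  Q and 2 <x, v> / Q, while B, B' and b are 2 / Q times <u, u>, <v, v> and <u, v>. The cross term
  with b is absorbed by the arithmetic-geometric mean inequality.\<close>

lemma ball_third_derivative_bound:
  fixes A C b B B' :: real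
  assumes B: "0 \<le> B" "0 \<le> B'" and b: "b\<^sup>2 \<le> B * B'"
  shows "\<bar>B * C + 2 * A * b + 2 * A\<^sup>2 * C\<bar> \<le> 2 * sqrt (C\<^sup>2 + B') * (A\<^sup>2 + B)"
proof -
  define m where "m = B + 2 * A\<^sup>2"
  have "(C * m + 2 * A * b)\<^sup>2 \<le> (C\<^sup>2 + B') * (m\<^sup>2 + 4 * A\<^sup>2 * B)"
  proof -
    have 1: "(C * m + 2 * A * b)\<^sup>2 = (C * m)\<^sup>2 + 2 * (C * m) * (2 * A * b) + 4 * A\<^sup>2 * b\<^sup>2"
      by (simp add: power2_eq_square algebra_simps)
    have 2: "4 * A\<^sup>2 * b\<^sup>2 \<le> 4 * A\<^sup>2 * (B * B')" using b by (intro mult_left_mono) auto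
    define r where "r = sqrt (B * B')"
    have r: "\<bar>b\<bar> \<le> r" using b by (simp add: r_def real_le_rsqrt)
    have "2 * (C * m) * (2 * A * b) \<le> \<bar>4 * A * C * m\<bar> * \<bar>b\<bar>"
      using abs_ge_self[of "4 * A * C * m * b"] by (simp add: abs_mult mult_ac)
    also have "\<dots> \<le> \<bar>4 * A * C * m\<bar> * r" using r by (intro mult_left_mono) auto
    also have "\<dots> = 2 * \<bar>2 * A * C * sqrt B\<bar> * \<bar>m * sqrt B'\<bar>"
      using B by (simp add: r_def real_sqrt_mult abs_mult)
    also have "\<dots> \<le> \<bar>2 * A * C * sqrt B\<bar>\<^sup>2 + \<bar>m * sqrt B'\<bar>\<^sup>2" by (rule sum_squares_bound)
    also have "\<dots> = 4 * A\<^sup>2 * C\<^sup>2 * B + m\<^sup>2 * B'"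
      using B by (simp add: power_mult_distrib)
    finally show ?thesis using 1 2 by (simp add: algebra_simps power_mult_distrib)
  qed
  also have "m\<^sup>2 + 4 * A\<^sup>2 * B \<le> 4 * (A\<^sup>2 + B)\<^sup>2"
  proof -
    have "4 * (A\<^sup>2 + B)\<^sup>2 - (m\<^sup>2 + 4 * A\<^sup>2 * B) = 3 * B\<^sup>2"
      by (simp add: m_def power2_eq_square algebra_simps)
    moreover have "0 \<le> 3 * B\<^sup>2" by simp
    ultimately show ?thesis by linarith
  qed
  finally have "(C * m + 2 * A * b)\<^sup>2 \<le> (C\<^sup>2 + B') * (4 * (A\<^sup>2 + B)\<^sup>2)"
    using B by (simp add: mult_left_mono)
  then have "sqrt ((C * m + 2 * A * b)\<^sup>2) \<le> sqrt ((C\<^sup>2 + B') * (4 * (A\<^sup>2 + B)\<^sup>2))"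
    by (rule real_sqrt_le_mono)
  also have "sqrt ((C\<^sup>2 + B') * (4 * (A\<^sup>2 + B)\<^sup>2)) = 2 * sqrt (C\<^sup>2 + B') * (A\<^sup>2 + B)"
    using B by (simp add: real_sqrt_mult)
  also have "sqrt ((C * m + 2 * A * b)\<^sup>2) = \<bar>B * C + 2 * A * b + 2 * A\<^sup>2 * C\<bar>"
    by (simp add: m_def algebra_simps)
  finally show ?thesis .
qed

text \<open>1 - A - B / 2 is the factor by which R^2 - |x|^2 changes when x moves. It is positive
  because A^2 < 1 - B \<le> (1 - B / 2)^2.\<close>

lemma dikin_ball:
  fixes A B :: real
  assumes "A\<^sup>2 + B < 1" "0 \<le> B"
  shows "0 < 1 - A - B / 2"
proof -
  have "B \<le> 1" using assms zero_le_power2[of A] by linarith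
  have "(1 - B / 2)\<^sup>2 = 1 - B + (B / 2)\<^sup>2" by (simp add: power2_eq_square algebra_simps)
  then have "A\<^sup>2 < (1 - B / 2)\<^sup>2" using assms zero_le_power2[of "B / 2"] by linarith
  then have "\<bar>A\<bar>\<^sup>2 < (1 - B / 2)\<^sup>2" by simp
  then have "\<bar>A\<bar> < 1 - B / 2" by (rule power2_less_imp_less) (use \<open>B \<le> 1\<close> in simp)
  then show ?thesis by linarith
qed

text \<open>Cauchy-Schwarz for two blocks. Iterated, it adds up the barrier parameters m, n of the
  pieces to that of the whole barrier.\<close>

lemma square_add_le:
  fixes a b m n P Q :: real
  assumes "a\<^sup>2 \<le> m * P" "b\<^sup>2 \<le> n * Q" "0 \<le> m" "0 \<le> n" "0 \<le> P" "0 \<le> Q"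
  shows "(a + b)\<^sup>2 \<le> (m + n) * (P + Q)"
proof -
  have "\<bar>a * b\<bar> = sqrt (a\<^sup>2 * b\<^sup>2)" by (simp add: real_sqrt_mult abs_mult)
  also have "\<dots> \<le> sqrt ((m * P) * (n * Q))"
    using assms by (intro real_sqrt_le_mono mult_mono) auto
  also have "\<dots> = sqrt (m * Q) * sqrt (n * P)" by (simp add: real_sqrt_mult)
  finally have "2 * \<bar>a * b\<bar> \<le> 2 * sqrt (m * Q) * sqrt (n * P)" by simp
  also have "\<dots> \<le> (sqrt (m * Q))\<^sup>2 + (sqrt (n * P))\<^sup>2" by (rule sum_squares_bound)
  also have "\<dots> = m * Q + n * P" using assms by simp
  finally have "2 * (a * b) \<le> m * Q + n * P" by linarith
  then show ?thesis using assms by (simp add: power2_eq_square algebra_simps)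
qed

section \<open>Finitely supported sequences, and derivatives within subspaces\<close>

lemma inner_single_left [simp]:
  "inner (Poly_Mapping.single i c) z = c * Poly_Mapping.lookup z i" for z :: "'a \<Rightarrow>\<^sub>0 real"
  by (simp add: inner_poly_mapping_def when_def)

lemma inner_single_right [simp]:
  "inner z (Poly_Mapping.single i c) = c * Poly_Mapping.lookup z i" for z :: "'a \<Rightarrow>\<^sub>0 real"
  by (simp add: inner_commute[of z])

lemma lookup_scaleR [simp]: "Poly_Mapping.lookup (c *\<^sub>R z) i = c *\<^sub>R Poly_Mapping.lookup z i"
  by (simp add: scaleR_poly_mapping.rep_eq)

lemma lookup_sum: "Poly_Mapping.lookup (\<Sum>i\<in>A. f i) j = (\<Sum>i\<in>A. Poly_Mapping.lookup (f i) j)"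
  by (induction A rule: infinite_finite_induct) (simp_all add: lookup_add)

lemma bounded_linear_lookup: "bounded_linear (\<lambda>z :: 'a \<Rightarrow>\<^sub>0 real. Poly_Mapping.lookup z i)"
  using bounded_linear_inner_left[of "Poly_Mapping.single i 1 :: 'a \<Rightarrow>\<^sub>0 real"] by simp

lemma subspace_coord_space: "subspace (coord_space n)"
  by (auto simp: coord_space_def intro!: subspaceI simp: lookup_add)

lemma coord_space_eq_0I:
  assumes "x \<in> coord_space n" "\<And>l. l < n \<Longrightarrow> Poly_Mapping.lookup x l = 0"
  shows "x = 0"
proof (rule poly_mapping_eqI)
  fix l show "Poly_Mapping.lookup x l = Poly_Mapping.lookup 0 l"
    using assms by (cases "l < n") (auto simp: coord_space_def)
qed

text \<open>Dimension count inside a type of infinite dimension. The image of a basis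
  \<open>C\<close> is independent, lies in \<open>span C\<close> and has as many elements; a vector
  of \<open>C\<close> outside its span could be added to it, against the exchange bound.\<close>

lemma bij_betw_injective_on_span:
  fixes f :: "'a::real_vector \<Rightarrow> 'a"
  assumes f: "linear f" and fin: "finite B" and V: "V = span B"
    and maps_V: "\<And>v. v \<in> V \<Longrightarrow> f v \<in> V"
    and inj_V: "\<And>v. v \<in> V \<Longrightarrow> f v = 0 \<Longrightarrow> v = 0"
  shows "bij_betw f V V"
proof -
  note maps = maps_V[unfolded V] and inj = inj_V[unfolded V]
  obtain C where C: "C \<subseteq> B" "independent C" "B \<subseteq> span C"
    using maximal_independent_subset[of B] by blast
  have sp: "span C = span B"
    using span_mono[OF C(1)] span_minimal[OF C(3) subspace_span] by (rule subset_antisym)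
  have finC: "finite C" using C(1) fin finite_subset by blast
  have inj_on: "inj_on f (span C)"
  proof (rule inj_onI)
    fix x y assume xy: "x \<in> span C" "y \<in> span C" "f x = f y"
    have "x - y \<in> span B" using span_diff[OF xy(1,2)] by (simp only: sp)
    moreover have "f (x - y) = 0" using xy(3) by (simp add: linear_diff[OF f])
    ultimately show "x = y" using inj[of "x - y"] by simp
  qed
  have ind: "independent (f ` C)"
    by (rule linear_independent_injective_image[OF f C(2) inj_on])
  have sub: "f ` C \<subseteq> span C"
    using maps span_superset[of C] unfolding sp[symmetric] by blast
  have card: "card (f ` C) = card C"
    by (rule card_image[OF inj_on_subset[OF inj_on span_superset]])
  have "C \<subseteq> span (f ` C)"
  proof
    fix x assume x: "x \<in> C"
    show "x \<in> span (f ` C)"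
    proof (rule ccontr)
      assume nx: "x \<notin> span (f ` C)"
      then have "independent (insert x (f ` C))" using ind by (rule independent_insertI)
      moreover have "insert x (f ` C) \<subseteq> span C" using sub span_base[OF x] by auto
      ultimately have "card (insert x (f ` C)) \<le> card C"
        by (intro conjunct2[OF independent_span_bound[OF finC]])
      moreover have "x \<notin> f ` C" using nx span_base[of x "f ` C"] by (rule contrapos_nn)
      ultimately show False using card finC by (simp add: card_insert_disjoint)
    qed
  qed
  then have "span C \<subseteq> span (f ` C)" by (rule span_minimal) (rule subspace_span)
  also have "\<dots> = f ` span C" by (rule linear_span_image[OF f])
  finally have "span C \<subseteq> f ` span C" .
  moreover have "f ` span C \<subseteq> span C" using maps unfolding sp by blast
  ultimately show ?thesis using inj_on unfolding bij_betw_def V sp by blast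
qed

lemma has_derivative_reciprocal:
  fixes f :: "'a::real_normed_vector \<Rightarrow> real"
  assumes "(f has_derivative f') (at x within A)" "f x \<noteq> 0"
  shows "((\<lambda>x. c / f x) has_derivative (\<lambda>h. - c * f' h / (f x)\<^sup>2)) (at x within A)"
  by (rule derivative_eq_intros assms refl | simp add: power2_eq_square divide_inverse mult_ac)+

lemma has_derivative_within_subspace_line:
  assumes f: "(f has_derivative f') (at p within V)" and V: "subspace V" and p: "p \<in> V" and v: "v \<in> V"
  shows "((\<lambda>s. f (p + s *\<^sub>R v)) has_vector_derivative f' v) (at 0)"
proof -
  have lin: "((\<lambda>s. p + s *\<^sub>R v) has_derivative (\<lambda>s. s *\<^sub>R v)) (at 0)"
    by (auto intro!: derivative_eq_intros)
  have "range (\<lambda>s. p + s *\<^sub>R v) \<subseteq> V"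
    using p v V by (auto intro: subspace_add subspace_scale)
  then have "(f has_derivative f') (at (p + 0 *\<^sub>R v) within range (\<lambda>s. p + s *\<^sub>R v))"
    using f has_derivative_subset by force
  from diff_chain_within[OF lin this]
  have "((\<lambda>s. f (p + s *\<^sub>R v)) has_derivative (\<lambda>s. f' (s *\<^sub>R v))) (at 0)"
    by (simp add: o_def)
  moreover have "f' (s *\<^sub>R v) = s *\<^sub>R f' v" for s
    using has_derivative_linear[OF f] by (rule linear_cmul)
  ultimately show ?thesis by (simp add: has_vector_derivative_def)
qed

lemma has_derivative_within_subspace_unique:
  assumes "(f has_derivative f') (at p within V)" "(f has_derivative f'') (at p within V)"
    and "subspace V" "p \<in> V" "v \<in> V"
  shows "f' v = f'' v"
  by (rule vector_derivative_unique_at[OF has_derivative_within_subspace_line[OF assms(1,3-5)]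
    has_derivative_within_subspace_line[OF assms(2-5)]])

lemma grad_on_eq:
  assumes V: "subspace V" "p \<in> V" and g: "g \<in> V" "(f has_derivative inner g) (at p within V)"
  shows "grad_on V f p = g"
  unfolding grad_on_def
proof (rule the_equality)
  fix g' assume g': "g' \<in> V \<and> (f has_derivative inner g') (at p within V)"
  then have "g' - g \<in> V" using V(1) g(1) by (auto intro: subspace_diff)
  then have "inner g' (g' - g) = inner g (g' - g)"
    using has_derivative_within_subspace_unique[OF _ g(2) V] g' by blast
  then have "inner (g' - g) (g' - g) = 0" by (simp only: inner_diff_left)
  then show "g' = g" by simp
qed (use g in blast)

lemma log_exp_piece_deriv:
  fixes \<zeta> W D :: "real \<Rightarrow> real"
  assumes z: "(\<zeta> has_real_derivative z') (at 0)" and w: "(W has_real_derivative w') (at 0)"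
    and d: "(D has_real_derivative d') (at 0)" and nz: "W 0 \<noteq> 0"
  shows "((\<lambda>s. (1 + 1 / W s) * (\<zeta> s)\<^sup>2 + (D s / W s)\<^sup>2) has_real_derivative
    - w' / (W 0)\<^sup>2 * (\<zeta> 0)\<^sup>2 + (1 + 1 / W 0) * (2 * \<zeta> 0 * z')
      + 2 * (D 0 / W 0) * ((d' * W 0 - D 0 * w') / (W 0)\<^sup>2)) (at 0)"
  by (rule DERIV_cong[OF DERIV_add[OF DERIV_mult[OF DERIV_add[OF DERIV_const DERIV_divide[OF DERIV_const w nz]]
      DERIV_power[OF z]] DERIV_power[OF DERIV_divide[OF d w nz]]]])
    (simp add: power2_eq_square mult_ac)

lemma ball_piece_deriv:
  fixes I Q :: "real \<Rightarrow> real"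
  assumes i: "(I has_real_derivative i') (at 0)" and q: "(Q has_real_derivative q') (at 0)" and nz: "Q 0 \<noteq> 0"
  shows "((\<lambda>s. (2 * I s / Q s)\<^sup>2 + c / Q s) has_real_derivative
    2 * (2 * I 0 / Q 0) * ((2 * i' * Q 0 - 2 * I 0 * q') / (Q 0)\<^sup>2) - c * q' / (Q 0)\<^sup>2) (at 0)"
  by (rule DERIV_cong[OF DERIV_add[OF DERIV_power[OF DERIV_divide[OF DERIV_cmult[OF i] q nz]]
      DERIV_divide[OF DERIV_const q nz]]])
    (simp add: power2_eq_square mult_ac)

section \<open>Weights, strictly feasible points and derivatives of the barrier\<close>

locale positive_weights =
  fixes k :: nat and q :: "nat \<Rightarrow> real"
  assumes k_pos: "0 < k" and q_pos: "\<And>i. i < k \<Longrightarrow> 0 < q i"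
begin

definition qmin :: real where "qmin = Min (q ` {..<k})"

lemma qmin_le: "i < k \<Longrightarrow> qmin \<le> q i"
  by (simp add: qmin_def)

lemma qmin_pos: "0 < qmin"
proof -
  have "qmin \<in> q ` {..<k}" unfolding qmin_def by (rule Min_in) (use k_pos in auto)
  then show ?thesis using q_pos by auto
qed

lemma l1_norm_eq: "l1_norm k q = (\<Sum>i<k. q i)"
  unfolding l1_norm_def by (intro sum.cong refl abs_of_pos q_pos) simp

lemma beta_eq: "gp_beta k q = l1_norm k q / qmin"
  by (simp add: gp_beta_def qmin_def)

lemma q_le_l1: "i < k \<Longrightarrow> q i \<le> l1_norm k q"
  unfolding l1_norm_eq by (rule member_le_sum) (auto intro: less_imp_le q_pos)

lemma l1_norm_pos: "0 < l1_norm k q"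
  using q_le_l1[of 0] q_pos[of 0] k_pos by linarith

lemma beta_ge_k: "real k \<le> gp_beta k q"
proof -
  have "(\<Sum>i<k. qmin) \<le> (\<Sum>i<k. q i)" by (rule sum_mono) (simp add: qmin_le)
  then show ?thesis using qmin_pos by (simp add: beta_eq l1_norm_eq pos_le_divide_eq)
qed

lemma beta_ge_1: "1 \<le> gp_beta k q"
  using beta_ge_k k_pos by linarith

end

type_synonym 'a point = "'a \<times> (nat \<Rightarrow>\<^sub>0 real) \<times> real"

locale gp_barrier = positive_weights k q for k :: nat and q :: "nat \<Rightarrow> real" +
  fixes \<omega> :: "nat \<Rightarrow> 'a::real_inner" and \<theta> :: 'a and R :: real
  assumes R_pos: "0 < R"
begin

abbreviation a :: "nat \<Rightarrow> 'a" where "a i \<equiv> \<omega> i - \<theta>"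

abbreviation xc :: "'a point \<Rightarrow> 'a" where "xc p \<equiv> fst p"

definition zc :: "'a point \<Rightarrow> nat \<Rightarrow> real" where
  "zc p i = Poly_Mapping.lookup (fst (snd p)) i"

abbreviation tc :: "'a point \<Rightarrow> real" where "tc p \<equiv> snd (snd p)"

definition \<tau> :: real where "\<tau> = ln (5 * real k * l1_norm k q)"

abbreviation E :: "'a point set" where "E \<equiv> ipm_space k \<omega> \<theta>"

abbreviation \<Psi> :: "'a point \<Rightarrow> real" where "\<Psi> \<equiv> ipm_barrier k \<omega> q \<theta> R"

text \<open>The slack of the exponential constraint with index i after taking logarithms, a concave
  function of the point where z is positive.\<close>

definition w :: "'a point \<Rightarrow> nat \<Rightarrow> real" where
  "w p i = ln (zc p i) - inner (a i) (xc p) + tc p - ln (q i)"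

definition Q :: "'a point \<Rightarrow> real" where
  "Q p = R\<^sup>2 - inner (xc p) (xc p)"

definition zs :: "'a point \<Rightarrow> real" where
  "zs p = (\<Sum>i<k. zc p i)"

definition U :: "'a point set" where
  "U = {p. (\<forall>i<k. 0 < zc p i) \<and> (\<forall>i<k. 0 < w p i) \<and> tc p < \<tau> \<and> zs p < 1 \<and> 0 < Q p}"

definition S :: "'a point set" where
  "S = E \<inter> U"

lemma in_U_D:
  assumes "p \<in> U"
  shows "\<And>i. i < k \<Longrightarrow> 0 < zc p i" "\<And>i. i < k \<Longrightarrow> 0 < w p i" "tc p < \<tau>" "zs p < 1" "0 < Q p"
  using assms by (auto simp: U_def)

lemma zc_add [simp]: "zc (p + v) i = zc p i + zc v i"
  and zc_diff [simp]: "zc (p - v) i = zc p i - zc v i"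
  and zc_scaleR [simp]: "zc (c *\<^sub>R p) i = c * zc p i"
  by (simp_all add: zc_def lookup_add lookup_minus)

lemma zs_add [simp]: "zs (p + v) = zs p + zs v"
  and zs_diff [simp]: "zs (p - v) = zs p - zs v"
  and zs_scaleR [simp]: "zs (c *\<^sub>R p) = c * zs p"
  by (simp_all add: zs_def sum.distrib sum_subtractf sum_distrib_left)

lemma bounded_linear_zc: "bounded_linear (\<lambda>p. zc p i)"
  unfolding zc_def
  by (intro bounded_linear_compose[OF bounded_linear_lookup] bounded_linear_fst_comp bounded_linear_snd_comp bounded_linear_ident)

lemma has_derivative_zc [derivative_intros]:
  "((\<lambda>p. zc p i) has_derivative (\<lambda>v. zc v i)) F"
  by (rule bounded_linear_imp_has_derivative[OF bounded_linear_zc])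

lemma continuous_on_zc [continuous_intros]: "continuous_on A (\<lambda>p. zc p i)"
  by (rule linear_continuous_on[OF bounded_linear_zc])

lemma subspace_E: "subspace E"
  unfolding ipm_space_def span_W_def
  by (intro subspace_Times subspace_span subspace_UNIV subspace_coord_space)

lemma E_iff: "p \<in> E \<longleftrightarrow> xc p \<in> span_W k \<omega> \<theta> \<and> fst (snd p) \<in> coord_space k"
  by (cases p) (auto simp: ipm_space_def)

lemma a_in_W: "i < k \<Longrightarrow> a i \<in> span_W k \<omega> \<theta>"
  by (auto simp: span_W_def intro: span_base)

lemma subspace_W: "subspace (span_W k \<omega> \<theta>)"
  by (simp add: span_W_def)

definition zvec :: "(nat \<Rightarrow> real) \<Rightarrow> nat \<Rightarrow>\<^sub>0 real" where
  "zvec c = (\<Sum>i<k. c i *\<^sub>R Poly_Mapping.single i 1)"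

lemma lookup_zvec: "Poly_Mapping.lookup (zvec c) j = (if j < k then c j else 0)"
proof -
  have "Poly_Mapping.lookup (zvec c) j = (\<Sum>i<k. if i = j then c i else 0)"
    unfolding zvec_def lookup_sum by (rule sum.cong) (auto simp: lookup_single when_def)
  then show ?thesis by simp
qed

lemma zvec_in: "zvec c \<in> coord_space k"
  by (simp add: coord_space_def lookup_zvec)

lemma inner_zvec: "inner (zvec c) z = (\<Sum>i<k. c i * Poly_Mapping.lookup z i)"
  by (simp add: zvec_def inner_sum_left)

text \<open>\<open>ln\<close> is not continuous at 0, so openness is read off the exponential form
  of the constraints, which is equivalent to \<open>0 < w p i\<close> where z is positive.\<close>

lemma open_U: "open U"
proof -
  have "U = (\<Inter>i\<in>{..<k}. {p. 0 < zc p i} \<inter> {p. q i * exp (inner (a i) (xc p) - tc p) < zc p i})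
      \<inter> {p. tc p < \<tau>} \<inter> {p. zs p < 1} \<inter> {p. 0 < Q p}"
  proof -
    have "0 < w p i \<longleftrightarrow> q i * exp (inner (a i) (xc p) - tc p) < zc p i" if "i < k" "0 < zc p i" for p i
    proof -
      have "0 < w p i \<longleftrightarrow> ln (q i * exp (inner (a i) (xc p) - tc p)) < ln (zc p i)"
        using q_pos[OF that(1)] by (simp add: ln_mult_pos w_def) linarith
      then show ?thesis using q_pos[OF that(1)] that(2) by simp
    qed
    then show ?thesis by (auto simp: U_def)
  qed
  also have "open \<dots>"
    unfolding zs_def Q_def
    by (intro open_Int open_INT ballI finite_lessThan open_Collect_less continuous_intros)
  finally show ?thesis .
qed

lemma S_nhd:
  assumes "p \<in> S"
  obtains d where "0 < d" "\<And>y. y \<in> E \<Longrightarrow> dist y p < d \<Longrightarrow> y \<in> S"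
  using open_U assms by (force simp: S_def open_dist)

lemma S_line:
  assumes "p \<in> S" "v \<in> E"
  shows "eventually (\<lambda>s. p + s *\<^sub>R v \<in> S) (nhds 0)"
proof -
  have "((\<lambda>s. p + s *\<^sub>R v) \<longlongrightarrow> p + 0 *\<^sub>R v) (nhds 0)"
    by (intro tendsto_intros filterlim_ident)
  then have "eventually (\<lambda>s. p + s *\<^sub>R v \<in> U) (nhds 0)"
    using open_U assms by (auto simp: S_def elim!: topological_tendstoD)
  moreover have "p + s *\<^sub>R v \<in> E" for s
    using assms subspace_E by (auto simp: S_def intro: subspace_add subspace_scale)
  ultimately show ?thesis by (simp add: S_def)
qed

lemma S_subset_domain: "S \<subseteq> ipm_domain k \<omega> q \<theta> R"
proof
  fix p assume "p \<in> S"
  then have p: "p \<in> E" "p \<in> U" by (auto simp: S_def)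
  note U = in_U_D[OF p(2)]
  have "q i * exp (inner (a i) (xc p)) \<le> zc p i * exp (tc p)" if i: "i < k" for i
  proof -
    have "exp (ln (q i) + inner (a i) (xc p)) \<le> exp (ln (zc p i) + tc p)"
      using U(2)[OF i] by (simp add: w_def)
    then show ?thesis using U(1)[OF i] q_pos[OF i] by (simp add: exp_add)
  qed
  moreover have "norm (xc p) \<le> R"
    using U(5) R_pos by (simp add: Q_def norm_le_square power2_eq_square)
  ultimately show "p \<in> ipm_domain k \<omega> q \<theta> R"
    using p(1) U(3,4) by (cases p) (auto simp: ipm_domain_def zs_def zc_def \<tau>_def)
qed

text \<open>\<open>ipm_barrier\<close> is given by its formula only on the relative interior of the
  domain. \<open>S\<close> is relatively open, so the formula holds in a whole neighborhood of each
  of its points.\<close>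

lemma S_subset_interior: "S \<subseteq> top_of_set E interior_of ipm_domain k \<omega> q \<theta> R"
  by (rule interior_of_maximal[OF S_subset_domain]) (simp add: S_def openin_open_Int[OF open_U])

lemma barrier_eq:
  assumes "p \<in> S"
  shows "\<Psi> p = - (\<Sum>i<k. ln (zc p i)) - (\<Sum>i<k. ln (w p i)) - ln (\<tau> - tc p) - ln (1 - zs p) - ln (Q p)"
  using assms S_subset_interior
  by (cases p) (auto simp: ipm_barrier_def w_def zc_def zs_def Q_def \<tau>_def power2_norm_eq_inner)

text \<open>The derivative of \<open>w p i\<close> in the direction \<open>v\<close>.\<close>

definition D :: "'a point \<Rightarrow> 'a point \<Rightarrow> nat \<Rightarrow> real" where
  "D p v i = zc v i / zc p i - inner (a i) (xc v) + tc v"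

definition grad :: "'a point \<Rightarrow> 'a point" where
  "grad p = ((\<Sum>i<k. (1 / w p i) *\<^sub>R a i) + (2 / Q p) *\<^sub>R xc p,
    zvec (\<lambda>i. - 1 / zc p i - 1 / (w p i * zc p i) + 1 / (1 - zs p)),
    1 / (\<tau> - tc p) - (\<Sum>i<k. 1 / w p i))"

definition hess :: "'a point \<Rightarrow> 'a point \<Rightarrow> 'a point" where
  "hess p u = ((\<Sum>i<k. (- D p u i / (w p i)\<^sup>2) *\<^sub>R a i) + (2 / Q p) *\<^sub>R xc u
      + (4 * inner (xc p) (xc u) / (Q p)\<^sup>2) *\<^sub>R xc p,
    zvec (\<lambda>i. (1 + 1 / w p i) * zc u i / (zc p i)\<^sup>2 + D p u i / ((w p i)\<^sup>2 * zc p i) + zs u / (1 - zs p)\<^sup>2),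
    (\<Sum>i<k. D p u i / (w p i)\<^sup>2) + tc u / (\<tau> - tc p)\<^sup>2)"

text \<open>The second derivative of the barrier, in relative changes of the arguments of the
  logarithms. The weight 1 / w stems from the curvature of ln z inside the slack, the product 2 <u,
  v> / Q from that of the ball.\<close>

definition form :: "'a point \<Rightarrow> 'a point \<Rightarrow> 'a point \<Rightarrow> real" where
  "form p u v = (\<Sum>i<k. (1 + 1 / w p i) * (zc u i / zc p i) * (zc v i / zc p i) + (D p u i / w p i) * (D p v i / w p i))
    + (tc u / (\<tau> - tc p)) * (tc v / (\<tau> - tc p)) + (zs u / (1 - zs p)) * (zs v / (1 - zs p))
    + (2 * inner (xc u) (xc v) / Q p + (2 * inner (xc p) (xc u) / Q p) * (2 * inner (xc p) (xc v) / Q p))"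

lemma inner_grad:
  "inner (grad p) v = - (\<Sum>i<k. zc v i / zc p i) - (\<Sum>i<k. D p v i / w p i) + tc v / (\<tau> - tc p)
    + zs v / (1 - zs p) + 2 * inner (xc p) (xc v) / Q p"
proof -
  have "(\<Sum>i<k. D p v i / w p i) = (\<Sum>i<k. 1 / (w p i * zc p i) * zc v i) - (\<Sum>i<k. 1 / w p i * inner (a i) (xc v)) + (\<Sum>i<k. 1 / w p i) * tc v"
    unfolding sum_distrib_right sum_subtractf[symmetric] sum.distrib[symmetric]
    by (intro sum.cong) (simp_all add: D_def add_divide_distrib diff_divide_distrib mult.commute)
  moreover have "inner (fst (snd (grad p))) (fst (snd v))
     = - (\<Sum>i<k. zc v i / zc p i) - (\<Sum>i<k. 1 / (w p i * zc p i) * zc v i) + zs v / (1 - zs p)"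
    by (simp add: grad_def inner_zvec zc_def[symmetric] zs_def algebra_simps sum.distrib sum_subtractf sum_negf sum_divide_distrib)
  ultimately show ?thesis
    by (simp add: grad_def inner_prod_def inner_add_left inner_sum_left algebra_simps diff_divide_distrib)
qed

lemma inner_hess: "inner v (hess p u) = form p u v"
proof -
  have 1: "inner (fst (snd v)) (fst (snd (hess p u)))
     = (\<Sum>i<k. (1 + 1 / w p i) * (zc u i / zc p i) * (zc v i / zc p i)) + (\<Sum>i<k. D p u i / (w p i)\<^sup>2 * (zc v i / zc p i))
       + zs u * zs v / (1 - zs p)\<^sup>2"
    by (simp add: inner_commute[of "fst (snd v)"] hess_def inner_zvec zc_def[symmetric] zs_def[of v] sum_distrib_left
        sum_divide_distrib power2_eq_square flip: sum.distrib) (auto intro!: sum.cong simp: field_simps)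
  have 2: "(\<Sum>i<k. (D p u i / w p i) * (D p v i / w p i)) = (\<Sum>i<k. D p u i / (w p i)\<^sup>2 * (zc v i / zc p i))
      - (\<Sum>i<k. D p u i / (w p i)\<^sup>2 * inner (a i) (xc v)) + (\<Sum>i<k. D p u i / (w p i)\<^sup>2) * tc v"
    unfolding sum_distrib_right sum_subtractf[symmetric] sum.distrib[symmetric]
    by (intro sum.cong) (simp_all add: D_def[of p v] power2_eq_square algebra_simps add_divide_distrib diff_divide_distrib)
  have 3: "inner (xc v) (fst (hess p u)) = - (\<Sum>i<k. D p u i / (w p i)\<^sup>2 * inner (a i) (xc v)) + 2 * inner (xc u) (xc v) / Q p
      + 4 * inner (xc p) (xc u) * inner (xc p) (xc v) / (Q p)\<^sup>2"
    unfolding hess_def fst_conv inner_add_right inner_sum_right inner_scaleR_right inner_commute[of "xc v"]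
    by (simp add: sum_negf)
  have 4: "tc v * tc (hess p u) = (\<Sum>i<k. D p u i / (w p i)\<^sup>2) * tc v + (tc u / (\<tau> - tc p)) * (tc v / (\<tau> - tc p))"
    by (simp add: hess_def power2_eq_square algebra_simps)
  show ?thesis
    unfolding form_def sum.distrib 2 using 1 3 4
    by (simp add: inner_prod_def power2_eq_square)
qed

lemma form_commute: "form p u v = form p v u"
  by (simp add: form_def mult_ac inner_commute)

lemma grad_in_E:
  assumes "p \<in> E" shows "grad p \<in> E"
  using assms subspace_W by (auto simp: E_iff grad_def zvec_in intro!: subspace_add subspace_sum subspace_scale a_in_W)

lemma hess_in_E:
  assumes "p \<in> E" "u \<in> E" shows "hess p u \<in> E"
  using assms subspace_W by (auto simp: E_iff hess_def zvec_in intro!: subspace_add subspace_diff subspace_neg subspace_sum subspace_scale a_in_W)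

lemma has_derivative_w [derivative_intros]:
  assumes "0 < zc p i"
  shows "((\<lambda>p. w p i) has_derivative (\<lambda>v. D p v i)) (at p within F)"
  unfolding w_def D_def
  by (rule derivative_eq_intros refl assms | simp add: assms field_simps)+

lemma has_derivative_zs [derivative_intros]: "(zs has_derivative zs) F"
  unfolding zs_def by (intro derivative_intros)

lemma has_derivative_Q [derivative_intros]: "(Q has_derivative (\<lambda>v. - 2 * inner (xc p) (xc v))) (at p within F)"
  unfolding Q_def by (rule derivative_eq_intros refl | simp add: inner_commute)+

lemma barrier_has_derivative:
  assumes p: "p \<in> S"
  shows "(\<Psi> has_derivative inner (grad p)) (at p within E)"
proof -
  obtain d where d: "0 < d" "\<And>y. y \<in> E \<Longrightarrow> dist y p < d \<Longrightarrow> y \<in> S" using S_nhd[OF p] by blast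
  have "p \<in> U" "p \<in> E" using p by (auto simp: S_def)
  note U = in_U_D[OF \<open>p \<in> U\<close>]
  have "((\<lambda>p. - (\<Sum>i<k. ln (zc p i)) - (\<Sum>i<k. ln (w p i)) - ln (\<tau> - tc p) - ln (1 - zs p) - ln (Q p))
     has_derivative inner (grad p)) (at p within E)"
    unfolding inner_grad
    by (rule derivative_eq_intros refl | use U in \<open>simp add: sum_negf field_simps\<close>)+
  then show ?thesis
    by (rule has_derivative_transform_within[OF _ d(1) \<open>p \<in> E\<close>]) (use d(2) barrier_eq in auto)
qed

lemma grad_on_barrier: "p \<in> S \<Longrightarrow> grad_on E \<Psi> p = grad p"
  by (rule grad_on_eq[OF subspace_E _ grad_in_E barrier_has_derivative]) (auto simp: S_def)

lemma grad_has_derivative: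
  assumes p: "p \<in> S"
  shows "(grad has_derivative hess p) (at p within E)"
proof -
  have "p \<in> U" using p by (auto simp: S_def)
  note U = in_U_D[OF this]
  have nz: "\<And>i. i < k \<Longrightarrow> zc p i \<noteq> 0" "\<And>i. i < k \<Longrightarrow> w p i \<noteq> 0" "\<tau> - tc p \<noteq> 0" "1 - zs p \<noteq> 0" "Q p \<noteq> 0"
    using U by (force+)
  have z: "((\<lambda>p. zc p i) has_derivative (\<lambda>v. zc v i)) (at p within E)" for i
    by (rule has_derivative_zc)
  have w': "((\<lambda>p. w p i) has_derivative (\<lambda>v. D p v i)) (at p within E)" if "i < k" for i
    by (rule has_derivative_w) (use U that in simp)
  have t: "((\<lambda>p. \<tau> - tc p) has_derivative (\<lambda>v. - tc v)) (at p within E)"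
    by (auto intro!: derivative_eq_intros)
  have zs: "((\<lambda>p. 1 - zs p) has_derivative (\<lambda>v. - zs v)) (at p within E)"
    by (auto intro!: derivative_eq_intros)
  note r = has_derivative_reciprocal
  have wz: "((\<lambda>p. w p i * zc p i) has_derivative (\<lambda>v. w p i * zc v i + D p v i * zc p i)) (at p within E)" if "i < k" for i
    by (rule has_derivative_mult[OF w'[OF that] z])
  have 1: "((\<lambda>p. (\<Sum>i<k. (1 / w p i) *\<^sub>R a i) + (2 / Q p) *\<^sub>R xc p) has_derivative (\<lambda>u. fst (hess p u))) (at p within E)"
    by (rule has_derivative_eq_rhs[OF has_derivative_add[OF
          has_derivative_sum[OF has_derivative_scaleR_left[OF r[OF w']]]
          has_derivative_scaleR[OF r[OF has_derivative_Q] has_derivative_fst[OF has_derivative_ident]]]])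
      (use nz in \<open>auto simp: hess_def fun_eq_iff algebra_simps\<close>)
  have 2: "((\<lambda>p. zvec (\<lambda>i. - 1 / zc p i - 1 / (w p i * zc p i) + 1 / (1 - zs p))) has_derivative (\<lambda>u. fst (snd (hess p u)))) (at p within E)"
    unfolding zvec_def
    by (rule has_derivative_eq_rhs[OF has_derivative_sum[OF has_derivative_scaleR_left[OF
          has_derivative_add[OF has_derivative_diff[OF r[OF z] r[OF wz]] r[OF zs]]]]])
      (use nz in \<open>auto simp: hess_def zvec_def fun_eq_iff power2_eq_square field_simps intro!: sum.cong\<close>)
  have 3: "((\<lambda>p. 1 / (\<tau> - tc p) - (\<Sum>i<k. 1 / w p i)) has_derivative (\<lambda>u. snd (snd (hess p u)))) (at p within E)"
    by (rule has_derivative_eq_rhs[OF has_derivative_diff[OF r[OF t] has_derivative_sum[OF r[OF w']]]])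
      (use nz in \<open>auto simp: hess_def fun_eq_iff sum_negf\<close>)
  show ?thesis
    using has_derivative_Pair[OF 1 has_derivative_Pair[OF 2 3]] by (simp add: grad_def[abs_def])
qed

lemma grad_on_has_derivative:
  assumes p: "p \<in> S"
  shows "(grad_on E \<Psi> has_derivative hess p) (at p within E)"
proof -
  obtain d where d: "0 < d" "\<And>y. y \<in> E \<Longrightarrow> dist y p < d \<Longrightarrow> y \<in> S" using S_nhd[OF p] by blast
  show ?thesis
    by (rule has_derivative_transform_within[OF grad_has_derivative[OF p] d(1)])
      (use p d(2) grad_on_barrier in \<open>auto simp: S_def\<close>)
qed

lemma hess_on_has_derivative:
  assumes p: "p \<in> S"
  shows "(grad_on E \<Psi> has_derivative hess_on E \<Psi> p) (at p within E)"
  unfolding hess_on_def using grad_on_has_derivative[OF p] by (metis differentiableI frechet_derivative_works)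

text \<open>\<open>frechet_derivative\<close> selects some derivative; derivatives within
  \<open>E\<close> agree on \<open>E\<close> only, hence the restriction to
  \<open>u \<in> E\<close>.\<close>

lemma hess_on_barrier:
  assumes p: "p \<in> S" and u: "u \<in> E"
  shows "hess_on E \<Psi> p u = hess p u"
  using has_derivative_within_subspace_unique[OF hess_on_has_derivative[OF p] grad_on_has_derivative[OF p] subspace_E _ u] p
  by (auto simp: S_def)

section \<open>Self-concordance of the barrier\<close>

definition log_exp_form :: "'a point \<Rightarrow> 'a point \<Rightarrow> nat \<Rightarrow> real" where
  "log_exp_form p u i = (1 + 1 / w p i) * (zc u i / zc p i)\<^sup>2 + (D p u i / w p i)\<^sup>2"

definition ball_form :: "'a point \<Rightarrow> 'a point \<Rightarrow> real" where
  "ball_form p u = (2 * inner (xc p) (xc u) / Q p)\<^sup>2 + 2 * inner (xc u) (xc u) / Q p"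

lemma form_self:
  "form p u u = (\<Sum>i<k. log_exp_form p u i) + (tc u / (\<tau> - tc p))\<^sup>2 + (zs u / (1 - zs p))\<^sup>2 + ball_form p u"
  by (simp add: form_def log_exp_form_def ball_form_def power2_eq_square mult.assoc)

lemma in_S_D: assumes "p \<in> S"
  shows "p \<in> E" "p \<in> U" "\<And>i. i < k \<Longrightarrow> 0 < zc p i" "\<And>i. i < k \<Longrightarrow> 0 < w p i" "tc p < \<tau>" "zs p < 1" "0 < Q p"
  using assms in_U_D by (auto simp: S_def)

lemma log_exp_form_nonneg: "p \<in> S \<Longrightarrow> i < k \<Longrightarrow> 0 \<le> log_exp_form p u i"
  using in_S_D(4)[of p i] by (simp add: log_exp_form_def)

lemma ball_form_nonneg: "p \<in> S \<Longrightarrow> 0 \<le> ball_form p u"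
  using in_S_D(7)[of p] by (simp add: ball_form_def)

lemma pieces_le_form:
  assumes p: "p \<in> S"
  shows "i < k \<Longrightarrow> log_exp_form p u i \<le> form p u u" "(tc u / (\<tau> - tc p))\<^sup>2 \<le> form p u u"
    "(zs u / (1 - zs p))\<^sup>2 \<le> form p u u" "ball_form p u \<le> form p u u"
proof -
  have s: "0 \<le> (\<Sum>i<k. log_exp_form p u i)" using log_exp_form_nonneg[OF p] by (intro sum_nonneg) auto
  have n: "0 \<le> (tc u / (\<tau> - tc p))\<^sup>2" "0 \<le> (zs u / (1 - zs p))\<^sup>2" "0 \<le> ball_form p u"
    using ball_form_nonneg[OF p] by auto
  show "(tc u / (\<tau> - tc p))\<^sup>2 \<le> form p u u"
    "(zs u / (1 - zs p))\<^sup>2 \<le> form p u u" "ball_form p u \<le> form p u u"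
    unfolding form_self using s n by linarith+
  assume i: "i < k"
  have "log_exp_form p u i \<le> (\<Sum>i<k. log_exp_form p u i)"
    using log_exp_form_nonneg[OF p] i by (intro member_le_sum) auto
  then show "log_exp_form p u i \<le> form p u u"
    unfolding form_self using n by linarith
qed

lemma Q_pos_iff: "0 < Q p \<longleftrightarrow> norm (xc p) < R"
  using R_pos by (simp add: Q_def norm_lt_square power2_eq_square)

lemma form_pos:
  assumes p: "p \<in> S" and v: "v \<in> E" "v \<noteq> 0"
  shows "0 < form p v v"
proof (rule ccontr)
  assume "\<not> 0 < form p v v"
  then have le: "form p v v \<le> 0" by simp
  note P = in_S_D[OF p]
  have l: "log_exp_form p v i \<le> 0" if "i < k" for i using pieces_le_form(1)[OF p that] le by (rule order_trans)
  have z: "zc v i = 0" if i: "i < k" for i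
  proof -
    have "(1 + 1 / w p i) * (zc v i / zc p i)\<^sup>2 \<le> 0"
      using l[OF i] zero_le_power2[of "D p v i / w p i"] unfolding log_exp_form_def by linarith
    moreover have "0 < 1 + 1 / w p i" using P(4)[OF i] by (simp add: add_pos_pos)
    ultimately have "(zc v i / zc p i)\<^sup>2 \<le> 0" by (simp add: mult_le_0_iff)
    then show ?thesis using P(3)[OF i] by simp
  qed
  have "(tc v / (\<tau> - tc p))\<^sup>2 \<le> 0" using pieces_le_form(2)[OF p] le by (rule order_trans)
  then have t: "tc v = 0" using P(5) by simp
  have "ball_form p v \<le> 0" using pieces_le_form(4)[OF p] le by (rule order_trans)
  then have "2 * inner (xc v) (xc v) / Q p \<le> 0"
    using zero_le_power2[of "2 * inner (xc p) (xc v) / Q p"] unfolding ball_form_def by linarith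
  then have "inner (xc v) (xc v) \<le> 0" using P(7) by (simp add: divide_le_0_iff)
  then have "inner (xc v) (xc v) = 0" by (rule antisym) (rule inner_ge_zero)
  then have x: "xc v = 0" by simp
  have "fst (snd v) = 0"
    using v(1) z by (intro coord_space_eq_0I) (auto simp: E_iff zc_def)
  then show False using x t v(2) by (simp add: prod_eq_iff)
qed

lemma ln_tangent: "0 < x \<Longrightarrow> 0 < y \<Longrightarrow> ln y \<le> ln x + (y - x) / x" for x y :: real
  using ln_le_minus_one[of "y / x"] by (simp add: ln_div diff_divide_distrib)

lemma w_le_tangent:
  assumes "i < k" "0 < zc p i" "0 < zc y i"
  shows "w y i \<le> w p i + D p (y - p) i"
  using ln_tangent[OF assms(2,3)] by (simp add: w_def D_def inner_diff_right)

lemma convex_S: "convex S"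
proof -
  have "convex U"
    unfolding convex_alt
  proof (intro ballI allI impI)
    fix p y and s :: real assume p: "p \<in> U" and y: "y \<in> U" and s: "0 \<le> s \<and> s \<le> 1"
    let ?c = "(1 - s) *\<^sub>R p + s *\<^sub>R y"
    note P = in_U_D[OF p] and Y = in_U_D[OF y]
    have cc: "0 < (1 - s) * A + s * B" if "0 < A" "0 < B" for A B :: real
      using that s convex_bound_lt[of "- A" 0 "- B" "1 - s" s] by simp
    have z: "0 < zc ?c i" if "i < k" for i
      using cc[OF P(1) Y(1)] that by simp
    have "0 < w ?c i" if i: "i < k" for i
    proof -
      have "(1 - s) * ln (zc p i) + s * ln (zc y i) \<le> ln ((1 - s) *\<^sub>R zc p i + s *\<^sub>R zc y i)"
        using s P(1)[OF i] Y(1)[OF i] by (intro concave_onD[OF ln_concave]) auto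
      then have "(1 - s) * w p i + s * w y i \<le> w ?c i"
        by (simp add: w_def inner_add_right algebra_simps)
      then show ?thesis using cc[OF P(2)[OF i] Y(2)[OF i]] by linarith
    qed
    moreover have "tc ?c < \<tau>" using cc[of "\<tau> - tc p" "\<tau> - tc y"] P(3) Y(3) by (simp add: algebra_simps)
    moreover have "zs ?c < 1" using cc[of "1 - zs p" "1 - zs y"] P(4) Y(4) by (simp add: algebra_simps)
    moreover have "0 < Q ?c"
    proof -
      have "xc ?c \<in> ball 0 R"
        using convexD_alt[OF convex_ball, of "xc p" 0 R "xc y" s] P(5) Y(5) s by (simp add: Q_pos_iff)
      then show ?thesis by (simp add: Q_pos_iff)
    qed
    ultimately show "?c \<in> U" using z by (auto simp: U_def)
  qed
  then show ?thesis
    unfolding S_def by (rule convex_Int[OF subspace_imp_convex[OF subspace_E]])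
qed

text \<open>Every piece of the form is below 1, so the constraints can be checked one at a time: the
  slacks by \<open>dikin_log_exp\<close>, the ball by \<open>dikin_ball\<close>.\<close>

lemma dikin:
  assumes p: "p \<in> S" and v: "v \<in> E" and less: "form p v v < 1"
  shows "p + v \<in> S"
proof -
  note P = in_S_D[OF p]
  have l: "log_exp_form p v i < 1" if "i < k" for i using pieces_le_form(1)[OF p that] less by (rule order_le_less_trans)
  have "p + v \<in> U" unfolding U_def
  proof (intro CollectI conjI allI impI)
    fix i assume i: "i < k"
    have d: "\<bar>zc v i / zc p i\<bar> < 1"
      "0 < w p i * (1 + D p v i / w p i) + ln (1 + zc v i / zc p i) - zc v i / zc p i"
      by (rule dikin_log_exp[OF P(4)[OF i] l[OF i, unfolded log_exp_form_def]])+
    have e: "zc p i + zc v i = zc p i * (1 + zc v i / zc p i)" using P(3)[OF i] by (simp add: field_simps)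
    have pos: "0 < 1 + zc v i / zc p i" using d(1) by linarith
    show z: "0 < zc (p + v) i" using e P(3)[OF i] pos by simp
    have "ln (zc p i + zc v i) = ln (zc p i) + ln (1 + zc v i / zc p i)"
      unfolding e using P(3)[OF i] pos by (simp add: ln_mult_pos)
    moreover have "w p i * (1 + D p v i / w p i) = w p i + D p v i" using P(4)[OF i] by (simp add: field_simps)
    ultimately show "0 < w (p + v) i" using d(2) by (simp add: w_def D_def inner_add_right)
  next
    have "(tc v / (\<tau> - tc p))\<^sup>2 < 1" using pieces_le_form(2)[OF p] less by (rule order_le_less_trans)
    then have "\<bar>tc v / (\<tau> - tc p)\<bar> < 1" by (simp add: abs_square_less_1)
    then have "tc v / (\<tau> - tc p) < 1" by linarith
    then show "tc (p + v) < \<tau>" using P(5) by (simp add: divide_less_eq)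
  next
    have "(zs v / (1 - zs p))\<^sup>2 < 1" using pieces_le_form(3)[OF p] less by (rule order_le_less_trans)
    then have "\<bar>zs v / (1 - zs p)\<bar> < 1" by (simp add: abs_square_less_1)
    then have "zs v / (1 - zs p) < 1" by linarith
    then show "zs (p + v) < 1" using P(6) by (simp add: divide_less_eq)
  next
    define A where "A = 2 * inner (xc p) (xc v) / Q p"
    define B where "B = 2 * inner (xc v) (xc v) / Q p"
    have "A\<^sup>2 + B < 1" using pieces_le_form(4)[OF p] less unfolding ball_form_def A_def B_def by (rule order_le_less_trans)
    then have "0 < 1 - A - B / 2" using P(7) by (intro dikin_ball) (auto simp: B_def)
    then have "0 < Q p * (1 - A - B / 2)" using P(7) by simp
    also have "Q p * (1 - A - B / 2) = Q (p + v)"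
    proof -
      have "Q p * A = 2 * inner (xc p) (xc v)" "Q p * B = 2 * inner (xc v) (xc v)"
        using P(7) by (simp_all add: A_def B_def)
      then have "Q p * (1 - A - B / 2) = Q p - 2 * inner (xc p) (xc v) - inner (xc v) (xc v)"
        by (simp add: algebra_simps)
      then show ?thesis by (simp add: Q_def inner_add_left inner_add_right inner_commute)
    qed
    finally show "0 < Q (p + v)" .
  qed
  then show ?thesis using P(1) v subspace_E by (auto simp: S_def intro: subspace_add)
qed

text \<open>Each of the 2 k + 3 logarithms contributes at most 1: its argument f is concave, so the
  linearization of f at \<open>p\<close> is nonnegative at \<open>y\<close>, which says that - f' (y
  - p) / f is at most 1.\<close>

lemma grad_le_parameter:
  assumes p: "p \<in> S" and y: "y \<in> S"
  shows "inner (grad p) (y - p) \<le> 2 * real k + 3"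
proof -
  note P = in_S_D[OF p] and Y = in_S_D[OF y]
  have "(\<Sum>i<k. - (zc (y - p) i / zc p i)) \<le> (\<Sum>i<k. 1)"
  proof (rule sum_mono)
    fix i assume "i \<in> {..<k}"
    then show "- (zc (y - p) i / zc p i) \<le> 1"
      using P(3)[of i] Y(3)[of i] by (simp add: diff_divide_distrib)
  qed
  moreover have "(\<Sum>i<k. - (D p (y - p) i / w p i)) \<le> (\<Sum>i<k. 1)"
  proof (rule sum_mono)
    fix i assume "i \<in> {..<k}"
    then have i: "i < k" by simp
    have "0 \<le> w p i + D p (y - p) i"
      using w_le_tangent[OF i P(3)[OF i] Y(3)[OF i]] Y(4)[OF i] by linarith
    then have "- 1 \<le> D p (y - p) i / w p i"
      unfolding pos_le_divide_eq[OF P(4)[OF i]] by linarith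
    then show "- (D p (y - p) i / w p i) \<le> 1" by linarith
  qed
  moreover have "tc (y - p) / (\<tau> - tc p) \<le> 1" using P(5) Y(5) by (simp add: divide_le_eq)
  moreover have "zs (y - p) / (1 - zs p) \<le> 1" using P(6) Y(6) by (simp add: divide_le_eq)
  moreover have "2 * inner (xc p) (xc (y - p)) / Q p \<le> 1"
  proof -
    have "0 \<le> inner (xc p - xc y) (xc p - xc y)" by simp
    then have "2 * inner (xc p) (xc y) \<le> inner (xc p) (xc p) + inner (xc y) (xc y)"
      by (simp add: inner_diff_left inner_diff_right inner_commute)
    then have "2 * inner (xc p) (xc (y - p)) \<le> Q p"
      using Y(7) by (simp add: Q_def inner_diff_right)
    then show ?thesis using P(7) by (simp add: divide_le_eq)
  qed
  ultimately show ?thesis unfolding inner_grad by (simp add: sum_negf)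
qed

lemma grad_dual_bound:
  assumes p: "p \<in> S"
  shows "\<bar>inner (grad p) v\<bar> \<le> sqrt (2 * real k + 3) * sqrt (form p v v)"
proof -
  note P = in_S_D[OF p]
  define A where "A = - (\<Sum>i<k. zc v i / zc p i)"
  define B where "B = - (\<Sum>i<k. D p v i / w p i)"
  define c where "c = tc v / (\<tau> - tc p)"
  define d where "d = zs v / (1 - zs p)"
  define e where "e = 2 * inner (xc p) (xc v) / Q p"
  define PA where "PA = (\<Sum>i<k. (zc v i / zc p i)\<^sup>2)"
  define PB where "PB = (\<Sum>i<k. (D p v i / w p i)\<^sup>2)"
  have n: "0 \<le> PA" "0 \<le> PB" by (auto simp: PA_def PB_def sum_nonneg)
  have A: "A\<^sup>2 \<le> real k * PA"
    using sum_squared_le_sum_of_squares[of "\<lambda>i. zc v i / zc p i" "{..<k}"] by (simp add: A_def PA_def mult.commute)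
  have B: "B\<^sup>2 \<le> real k * PB"
    using sum_squared_le_sum_of_squares[of "\<lambda>i. D p v i / w p i" "{..<k}"] by (simp add: B_def PB_def mult.commute)
  have "((((A + B) + c) + d) + e)\<^sup>2 \<le> ((((real k + real k) + 1) + 1) + 1) * ((((PA + PB) + c\<^sup>2) + d\<^sup>2) + e\<^sup>2)"
    by (intro square_add_le A B) (use n in auto)
  also have "\<dots> \<le> (2 * real k + 3) * form p v v"
  proof (intro mult_mono)
    have "PA + PB \<le> (\<Sum>i<k. log_exp_form p v i)"
      unfolding PA_def PB_def sum.distrib[symmetric]
    proof (rule sum_mono)
      fix i assume "i \<in> {..<k}"
      then have "1 * (zc v i / zc p i)\<^sup>2 \<le> (1 + 1 / w p i) * (zc v i / zc p i)\<^sup>2"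
        using P(4)[of i] by (intro mult_right_mono) auto
      then show "(zc v i / zc p i)\<^sup>2 + (D p v i / w p i)\<^sup>2 \<le> log_exp_form p v i" by (simp add: log_exp_form_def)
    qed
    moreover have "e\<^sup>2 \<le> ball_form p v" using P(7) by (simp add: ball_form_def e_def)
    ultimately show "PA + PB + c\<^sup>2 + d\<^sup>2 + e\<^sup>2 \<le> form p v v"
      unfolding form_self c_def d_def by linarith
  qed (use n in auto)
  finally have "(inner (grad p) v)\<^sup>2 \<le> (2 * real k + 3) * form p v v"
    by (simp add: inner_grad A_def B_def c_def d_def e_def)
  then have "sqrt ((inner (grad p) v)\<^sup>2) \<le> sqrt ((2 * real k + 3) * form p v v)"
    by (rule real_sqrt_le_mono)
  then show ?thesis by (simp add: real_sqrt_mult)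
qed

lemma sum_deriv_bound:
  fixes f :: "nat \<Rightarrow> real \<Rightarrow> real"
  assumes "\<And>i. i < k \<Longrightarrow> \<exists>T. (f i has_real_derivative T) (at 0) \<and> \<bar>T\<bar> \<le> M * f i 0"
  shows "\<exists>T. ((\<lambda>s. \<Sum>i<k. f i s) has_real_derivative T) (at 0) \<and> \<bar>T\<bar> \<le> M * (\<Sum>i<k. f i 0)"
proof -
  obtain T where T: "\<And>i. i < k \<Longrightarrow> (f i has_real_derivative T i) (at 0) \<and> \<bar>T i\<bar> \<le> M * f i 0"
    using assms by metis
  have "((\<lambda>s. \<Sum>i<k. f i s) has_real_derivative (\<Sum>i<k. T i)) (at 0)"
    using T by (intro DERIV_sum) auto
  moreover have "\<bar>\<Sum>i<k. T i\<bar> \<le> (\<Sum>i<k. M * f i 0)"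
    using T by (intro order_trans[OF sum_abs] sum_mono) auto
  ultimately show ?thesis unfolding sum_distrib_left by blast
qed

lemma log_exp_form_deriv:
  assumes p: "p \<in> S" and i: "i < k"
  shows "\<exists>T. ((\<lambda>s. log_exp_form (p + s *\<^sub>R v) u i) has_real_derivative T) (at 0) \<and>
    \<bar>T\<bar> \<le> 2 * sqrt (form p v v) * log_exp_form p u i"
proof -
  note P = in_S_D[OF p]
  define W where "W = w p i"
  \<comment> \<open>Relative changes of z and of the slack, along the line (\<open>x\<close>,
    \<open>y\<close>) and in the test direction (\<open>Z\<close>, \<open>A\<close>): the variables
    of \<open>log_exp_third_derivative_bound\<close>.\<close>
  define x where "x = zc v i / zc p i"
  define y where "y = D p v i / W"
  define Z where "Z = zc u i / zc p i"
  define A where "A = D p u i / W"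
  define s where "s = 1 / W"
  have W: "0 < W" and z: "0 < zc p i" using P(3,4)[OF i] by (auto simp: W_def)
  have hw: "((\<lambda>s. w (p + s *\<^sub>R v) i) has_real_derivative W * y) (at 0)"
    unfolding w_def
    by (rule derivative_eq_intros refl | use z W in \<open>simp add: y_def D_def inner_add_right field_simps\<close>)+
  have hZ: "((\<lambda>s. zc u i / zc (p + s *\<^sub>R v) i) has_real_derivative - (Z * x)) (at 0)"
    by simp (rule derivative_eq_intros refl | use z in \<open>simp add: Z_def x_def field_simps\<close>)+
  have hD: "((\<lambda>s. D (p + s *\<^sub>R v) u i) has_real_derivative - (Z * x)) (at 0)"
    unfolding D_def by (rule derivative_eq_intros hZ refl | simp)+
  have w0: "w (p + 0 *\<^sub>R v) i = W" "zc (p + 0 *\<^sub>R v) i = zc p i" "D (p + 0 *\<^sub>R v) u i = W * A" by (simp_all add: W_def A_def W[unfolded W_def, THEN less_imp_neq, symmetric])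
  define T where "T = - (x * (2 * Z\<^sup>2 * (1 + s) + 2 * A * Z * s) + y * (Z\<^sup>2 * s + 2 * A\<^sup>2))"
  have "- (W * y) / W\<^sup>2 * Z\<^sup>2 + (1 + 1 / W) * (2 * Z * - (Z * x))
      + 2 * (W * A / W) * ((- (Z * x) * W - W * A * (W * y)) / W\<^sup>2) = T"
    unfolding T_def s_def using W by (simp add: power2_eq_square field_simps)
  moreover have "((\<lambda>s. log_exp_form (p + s *\<^sub>R v) u i) has_real_derivative
      - (W * y) / W\<^sup>2 * Z\<^sup>2 + (1 + 1 / W) * (2 * Z * - (Z * x))
      + 2 * (W * A / W) * ((- (Z * x) * W - W * A * (W * y)) / W\<^sup>2)) (at 0)"
    using log_exp_piece_deriv[OF hZ hw hD] W unfolding log_exp_form_def w0 Z_def[symmetric] by simp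
  ultimately have 1: "((\<lambda>s. log_exp_form (p + s *\<^sub>R v) u i) has_real_derivative T) (at 0)" by simp
  have "\<bar>T\<bar> \<le> 2 * sqrt ((1 + s) * x\<^sup>2 + y\<^sup>2) * ((1 + s) * Z\<^sup>2 + A\<^sup>2)"
    unfolding T_def abs_minus_cancel by (rule log_exp_third_derivative_bound) (use W in \<open>simp add: s_def\<close>)
  also have "\<dots> = 2 * sqrt (log_exp_form p v i) * log_exp_form p u i"
    by (simp add: log_exp_form_def x_def y_def Z_def A_def s_def W_def)
  also have "\<dots> \<le> 2 * sqrt (form p v v) * log_exp_form p u i"
    using pieces_le_form(1)[OF p i] log_exp_form_nonneg[OF p i] by (intro mult_right_mono mult_left_mono) auto
  finally show ?thesis using 1 by blast
qed

lemma linear_piece_deriv: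
  fixes b c r :: real
  assumes b: "0 < b" and r: "(c / b)\<^sup>2 \<le> F"
  shows "\<exists>T. ((\<lambda>s. (r / (b - s * c))\<^sup>2) has_real_derivative T) (at 0) \<and> \<bar>T\<bar> \<le> 2 * sqrt F * (r / b)\<^sup>2"
proof (intro exI conjI)
  show "((\<lambda>s. (r / (b - s * c))\<^sup>2) has_real_derivative 2 * (c / b) * (r / b)\<^sup>2) (at 0)"
    by (rule derivative_eq_intros refl | use b in \<open>simp add: power2_eq_square field_simps\<close>)+
  have "\<bar>c / b\<bar> \<le> sqrt F" using r by (rule real_le_rsqrt[of "\<bar>c / b\<bar>", unfolded power2_abs])
  then have "2 * \<bar>c / b\<bar> * (r / b)\<^sup>2 \<le> 2 * sqrt F * (r / b)\<^sup>2" by (intro mult_right_mono) auto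
  then show "\<bar>2 * (c / b) * (r / b)\<^sup>2\<bar> \<le> 2 * sqrt F * (r / b)\<^sup>2" by (simp add: abs_mult)
qed

lemma ball_form_deriv:
  assumes p: "p \<in> S"
  shows "\<exists>T. ((\<lambda>s. ball_form (p + s *\<^sub>R v) u) has_real_derivative T) (at 0) \<and>
    \<bar>T\<bar> \<le> 2 * sqrt (form p v v) * ball_form p u"
proof -
  define q0 where "q0 = Q p"
  have q0: "0 < q0" using in_S_D(7)[OF p] by (simp add: q0_def)
  define A where "A = 2 * inner (xc p) (xc u) / q0"
  define C where "C = 2 * inner (xc p) (xc v) / q0"
  define b where "b = 2 * inner (xc v) (xc u) / q0"
  define B where "B = 2 * inner (xc u) (xc u) / q0"
  define B' where "B' = 2 * inner (xc v) (xc v) / q0"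
  have hQ: "((\<lambda>s. Q (p + s *\<^sub>R v)) has_real_derivative - (q0 * C)) (at 0)"
    unfolding Q_def
    by (rule derivative_eq_intros refl | use q0 in \<open>simp add: C_def inner_add_left inner_add_right inner_commute\<close>)+
  have hI: "((\<lambda>s. inner (xc (p + s *\<^sub>R v)) (xc u)) has_real_derivative q0 * b / 2) (at 0)"
    by (rule derivative_eq_intros refl | use q0 in \<open>simp add: b_def inner_add_left\<close>)+
  have z: "Q (p + 0 *\<^sub>R v) = q0" "inner (xc (p + 0 *\<^sub>R v)) (xc u) = q0 * A / 2" using q0 by (simp_all add: q0_def A_def)
  define T where "T = B * C + 2 * A * b + 2 * A\<^sup>2 * C"
  have "2 * (2 * (q0 * A / 2) / q0) * ((2 * (q0 * b / 2) * q0 - 2 * (q0 * A / 2) * - (q0 * C)) / q0\<^sup>2)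
      - 2 * inner (xc u) (xc u) * - (q0 * C) / q0\<^sup>2 = T"
    unfolding T_def B_def using q0 by (simp add: power2_eq_square field_simps)
  moreover have "((\<lambda>s. ball_form (p + s *\<^sub>R v) u) has_real_derivative
      2 * (2 * (q0 * A / 2) / q0) * ((2 * (q0 * b / 2) * q0 - 2 * (q0 * A / 2) * - (q0 * C)) / q0\<^sup>2)
      - 2 * inner (xc u) (xc u) * - (q0 * C) / q0\<^sup>2) (at 0)"
    using ball_piece_deriv[OF hI hQ, of "2 * inner (xc u) (xc u)"] q0 unfolding ball_form_def z by simp
  ultimately have 1: "((\<lambda>s. ball_form (p + s *\<^sub>R v) u) has_real_derivative T) (at 0)" by simp
  have "b\<^sup>2 \<le> B * B'"
    using Cauchy_Schwarz_ineq[of "xc v" "xc u"] q0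
    by (simp add: b_def B_def B'_def power2_eq_square divide_right_mono mult_ac)
  then have "\<bar>T\<bar> \<le> 2 * sqrt (C\<^sup>2 + B') * (A\<^sup>2 + B)"
    unfolding T_def using q0 by (intro ball_third_derivative_bound) (auto simp: B_def B'_def)
  also have "\<dots> = 2 * sqrt (ball_form p v) * ball_form p u"
    by (simp add: ball_form_def C_def B'_def A_def B_def q0_def)
  also have "\<dots> \<le> 2 * sqrt (form p v v) * ball_form p u"
    using pieces_le_form(4)[OF p] ball_form_nonneg[OF p] by (intro mult_right_mono mult_left_mono) auto
  finally show ?thesis using 1 by blast
qed

lemma form_deriv:
  assumes p: "p \<in> S"
  shows "\<exists>T. ((\<lambda>s. form (p + s *\<^sub>R v) u u) has_real_derivative T) (at 0) \<and>
    \<bar>T\<bar> \<le> 2 * sqrt (form p v v) * form p u u"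
proof -
  let ?M = "2 * sqrt (form p v v)"
  note P = in_S_D[OF p]
  obtain T1 where 1: "((\<lambda>s. \<Sum>i<k. log_exp_form (p + s *\<^sub>R v) u i) has_real_derivative T1) (at 0)" "\<bar>T1\<bar> \<le> ?M * (\<Sum>i<k. log_exp_form p u i)"
    using sum_deriv_bound[of "\<lambda>i s. log_exp_form (p + s *\<^sub>R v) u i" ?M] log_exp_form_deriv[OF p] by auto
  obtain T2 where 2: "((\<lambda>s. (tc u / (\<tau> - tc (p + s *\<^sub>R v)))\<^sup>2) has_real_derivative T2) (at 0)" "\<bar>T2\<bar> \<le> ?M * (tc u / (\<tau> - tc p))\<^sup>2"
    using linear_piece_deriv[of "\<tau> - tc p" "tc v" "form p v v" "tc u"] pieces_le_form(2)[OF p] P(5) by (auto simp: diff_diff_eq)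
  obtain T3 where 3: "((\<lambda>s. (zs u / (1 - zs (p + s *\<^sub>R v)))\<^sup>2) has_real_derivative T3) (at 0)" "\<bar>T3\<bar> \<le> ?M * (zs u / (1 - zs p))\<^sup>2"
    using linear_piece_deriv[of "1 - zs p" "zs v" "form p v v" "zs u"] pieces_le_form(3)[OF p] P(6) by (auto simp: diff_diff_eq)
  obtain T4 where 4: "((\<lambda>s. ball_form (p + s *\<^sub>R v) u) has_real_derivative T4) (at 0)" "\<bar>T4\<bar> \<le> ?M * ball_form p u"
    using ball_form_deriv[OF p] by blast
  have "((\<lambda>s. form (p + s *\<^sub>R v) u u) has_real_derivative T1 + T2 + T3 + T4) (at 0)"
    unfolding form_self by (intro DERIV_add 1 2 3 4)
  moreover have "\<bar>T1 + T2 + T3 + T4\<bar> \<le> ?M * form p u u"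
    unfolding form_self[of p u] distrib_left using 1(2) 2(2) 3(2) 4(2) by linarith
  ultimately show ?thesis by blast
qed

text \<open>The finite generating set through which \<open>bij_betw_injective_on_span\<close>
  applies to the Hessian.\<close>

lemma E_eq_span:
  "E = span ((\<lambda>i. (a i, 0, 0)) ` {..<k} \<union> (\<lambda>i. (0, Poly_Mapping.single i 1, 0)) ` {..<k} \<union> {(0, 0, 1)})" (is "E = span ?B")
proof
  have "?B \<subseteq> E"
    using a_in_W by (auto simp: ipm_space_def coord_space_def lookup_single when_def span_W_def intro: span_zero)
  then show "span ?B \<subseteq> E" by (rule span_minimal[OF _ subspace_E])
  show "E \<subseteq> span ?B"
  proof
    fix p assume p: "p \<in> E"
    obtain x z t where xzt: "p = (x, z, t)" by (cases p)
    have x: "x \<in> span (a ` {..<k})" and z: "z \<in> coord_space k"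
      using p by (auto simp: xzt ipm_space_def span_W_def)
    have "linear (\<lambda>x::'a. (x, 0 :: nat \<Rightarrow>\<^sub>0 real, 0 :: real))" by (auto intro!: linearI)
    from linear_span_image[OF this] x have "(x, 0 :: nat \<Rightarrow>\<^sub>0 real, 0 :: real) \<in> span ((\<lambda>x. (x, 0, 0)) ` a ` {..<k})"
      by (simp only:) (rule imageI)
    then have 1: "(x, 0, 0) \<in> span ?B"
      by (rule subsetD[OF span_mono, rotated]) auto
    have "z = zvec (Poly_Mapping.lookup z)"
      using z by (intro poly_mapping_eqI) (auto simp: lookup_zvec coord_space_def)
    then have "(0 :: 'a, z, 0 :: real) = (0, zvec (Poly_Mapping.lookup z), 0)" by simp
    also have "\<dots> = (\<Sum>i<k. Poly_Mapping.lookup z i *\<^sub>R (0, Poly_Mapping.single i 1, 0))"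
      by (simp add: zvec_def prod_eq_iff fst_sum snd_sum)
    also have "\<dots> \<in> span ?B"
      by (intro span_sum span_scale span_base) auto
    finally have 2: "(0, z, 0) \<in> span ?B" .
    have "t *\<^sub>R (0, 0, 1) \<in> span ?B" by (intro span_scale span_base) auto
    from span_add[OF span_add[OF 1 2] this] show "p \<in> span ?B" by (simp add: xzt)
  qed
qed

lemma self_concordant_barrier:
  "self_concordant_barrier E S (grad_on E \<Psi>) (hess_on E \<Psi>) (2 * real k + 3)"
proof (rule self_concordant_barrier.intro)
  show "subspace E" by (rule subspace_E)
  show "S \<subseteq> E" by (auto simp: S_def)
  show "convex S" by (rule convex_S)
  show "5 \<le> 2 * real k + 3" using k_pos by simp
  fix p assume p: "p \<in> S"
  note P = in_S_D[OF p] and h = hess_on_barrier[OF p]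
  show "grad_on E \<Psi> p \<in> E" using grad_in_E P(1) by (simp add: grad_on_barrier[OF p])
  show lin: "linear (hess_on E \<Psi> p)"
    by (rule has_derivative_linear[OF hess_on_has_derivative[OF p]])
  show "bij_betw (hess_on E \<Psi> p) E E"
  proof (rule bij_betw_injective_on_span[OF lin _ E_eq_span])
    fix v assume v: "v \<in> E"
    show "hess_on E \<Psi> p v \<in> E" using hess_in_E[OF P(1) v] h[OF v] by simp
    assume "hess_on E \<Psi> p v = 0"
    then have "form p v v = 0" using inner_hess[of v p v] h[OF v] by simp
    then show "v = 0" using form_pos[OF p v] by (cases "v = 0") simp_all
  qed simp
  fix v assume v: "v \<in> E"
  have vv: "inner v (hess_on E \<Psi> p v) = form p v v" by (simp add: h[OF v] inner_hess)
  show "0 < inner v (hess_on E \<Psi> p v)" if "v \<noteq> 0" using form_pos[OF p v that] vv by simp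
  show "p + v \<in> S" if "inner v (hess_on E \<Psi> p v) < 1" using dikin[OF p v] that vv by simp
  show "\<bar>inner (grad_on E \<Psi> p) v\<bar> \<le> sqrt (2 * real k + 3) * sqrt (inner v (hess_on E \<Psi> p v))"
    unfolding vv using grad_dual_bound[OF p] by (simp add: grad_on_barrier[OF p])
  fix u assume u: "u \<in> E"
  show "inner v (hess_on E \<Psi> p u) = inner u (hess_on E \<Psi> p v)"
    by (simp add: h[OF v] h[OF u] inner_hess form_commute)
  have "((\<lambda>s. grad_on E \<Psi> (p + s *\<^sub>R v)) has_vector_derivative hess_on E \<Psi> p v) (at 0)"
    by (rule has_derivative_within_subspace_line[OF hess_on_has_derivative[OF p] subspace_E P(1) v])
  then have "((\<lambda>s. grad_on E \<Psi> (p + s *\<^sub>R v)) has_derivative (\<lambda>s. s *\<^sub>R hess_on E \<Psi> p v)) (at 0)"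
    by (simp add: has_vector_derivative_def)
  from has_derivative_inner_left[OF this, of u]
  show "((\<lambda>s. inner (grad_on E \<Psi> (p + s *\<^sub>R v)) u) has_real_derivative inner u (hess_on E \<Psi> p v)) (at 0)"
    by (simp add: has_field_derivative_def inner_commute[of u] mult.commute[of "inner _ u"] mult_commute_abs)
  obtain T where T: "((\<lambda>s. form (p + s *\<^sub>R v) u u) has_real_derivative T) (at 0)"
    "\<bar>T\<bar> \<le> 2 * sqrt (form p v v) * form p u u"
    using form_deriv[OF p] by blast
  \<comment> \<open>Off \<open>S\<close> the Hessian may differ from the formula, but near s = 0 the
    line stays in \<open>S\<close>.\<close>
  have "((\<lambda>s. inner u (hess_on E \<Psi> (p + s *\<^sub>R v) u)) has_real_derivative T) (at 0)"
  proof (rule DERIV_cong_ev[THEN iffD2, OF refl _ refl T(1)])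
    show "\<forall>\<^sub>F s in nhds 0. inner u (hess_on E \<Psi> (p + s *\<^sub>R v) u) = form (p + s *\<^sub>R v) u u"
      using S_line[OF p v] by (rule eventually_mono) (simp add: hess_on_barrier[OF _ u] inner_hess)
  qed
  then show "\<exists>D. ((\<lambda>s. inner u (hess_on E \<Psi> (p + s *\<^sub>R v) u)) has_real_derivative D) (at 0) \<and>
      \<bar>D\<bar> \<le> 2 * sqrt (inner v (hess_on E \<Psi> p v)) * inner u (hess_on E \<Psi> p u)"
    using T(2) unfolding vv by (auto simp: h[OF u] inner_hess)
next
  fix p y assume p: "p \<in> S" and y: "y \<in> S"
  show "inner (grad_on E \<Psi> p) (y - p) \<le> 2 * real k + 3"
    using grad_le_parameter[OF p y] by (simp add: grad_on_barrier[OF p])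
qed

end

section \<open>Totally unimodular systems\<close>

text \<open>\<open>submatrix\<close> lists the chosen indices in increasing order; the permutation
  translates the enumeration \<open>f\<close> into that order.\<close>

lemma pick_image_permutation:
  fixes f :: "nat \<Rightarrow> nat"
  assumes inj: "inj_on f {..<m}"
  obtains \<sigma> where "\<sigma> permutes {0..<m}" "\<And>i. i < m \<Longrightarrow> pick (f ` {..<m}) (\<sigma> i) = f i"
proof -
  define I where "I = f ` {..<m}"
  have I: "finite I" "card I = m" using inj by (auto simp: I_def card_image)
  define \<sigma> where "\<sigma> i = (if i < m then card {a \<in> I. a < f i} else i)" for i
  have pick: "pick I (\<sigma> i) = f i" if "i < m" for i
    using that pick_card_in_set[of "f i" I] by (simp add: \<sigma>_def I_def)
  have "bij_betw \<sigma> {0..<m} {0..<m}"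
  proof (rule bij_betw_imageI)
    show inj': "inj_on \<sigma> {0..<m}"
    proof (rule inj_onI)
      fix i j assume "i \<in> {0..<m}" "j \<in> {0..<m}" "\<sigma> i = \<sigma> j"
      then have "f i = f j" using pick[of i] pick[of j] by simp
      then show "i = j" using \<open>i \<in> _\<close> \<open>j \<in> _\<close> inj by (auto dest: inj_onD)
    qed
    have "\<sigma> ` {0..<m} \<subseteq> {0..<m}"
    proof
      fix y assume "y \<in> \<sigma> ` {0..<m}"
      then obtain i where i: "i < m" "y = card {a \<in> I. a < f i}" by (auto simp: \<sigma>_def)
      have "{a \<in> I. a < f i} \<subset> I" using i by (auto simp: I_def)
      then have "y < m" using psubset_card_mono[OF I(1)] I(2) i(2) by metis
      then show "y \<in> {0..<m}" by simp
    qed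
    then show "\<sigma> ` {0..<m} = {0..<m}" using inj' by (simp add: endo_inj_surj)
  qed
  then have "\<sigma> permutes {0..<m}" by (rule bij_imp_permutes) (simp add: \<sigma>_def)
  then show ?thesis using that pick by (simp add: I_def)
qed

text \<open>Rows and columns may be listed in any order and with repetitions. A repetition makes the
  determinant 0, and reordering changes only its sign.\<close>

lemma totally_unimodular_det_le_1:
  fixes A :: "real mat"
  assumes tu: "totally_unimodular A"
    and f: "\<And>i. i < m \<Longrightarrow> f i < dim_row A" and g: "\<And>j. j < m \<Longrightarrow> g j < dim_col A"
  shows "\<bar>Determinant.det (mat m m (\<lambda>(i, j). A $$ (f i, g j)))\<bar> \<le> 1"
proof -
  let ?M = "mat m m (\<lambda>(i, j). A $$ (f i, g j))"
  have M: "?M \<in> carrier_mat m m" by simp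
  show ?thesis
  proof (cases "inj_on f {..<m} \<and> inj_on g {..<m}")
    case False
    then consider (f) i j where "i < m" "j < m" "i \<noteq> j" "f i = f j"
      | (g) i j where "i < m" "j < m" "i \<noteq> j" "g i = g j"
      by (auto simp: inj_on_def)
    then have "Determinant.det ?M = 0"
    proof cases
      case f
      then show ?thesis by (intro Determinant.det_identical_rows[OF M f(3,1,2)] eq_vecI) auto
    next
      case g
      then show ?thesis by (intro Determinant.det_identical_columns[OF M g(3,1,2)] eq_vecI) auto
    qed
    then show ?thesis by simp
  next
    case True
    then have inj: "inj_on f {..<m}" "inj_on g {..<m}" by auto
    define I where "I = f ` {..<m}"
    define J where "J = g ` {..<m}"
    have sub: "I \<subseteq> {..<dim_row A}" "J \<subseteq> {..<dim_col A}" using f g by (auto simp: I_def J_def)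
    have card: "card I = m" "card J = m" using inj by (auto simp: I_def J_def card_image)
    have sets: "{i. i < dim_row A \<and> i \<in> I} = I" "{j. j < dim_col A \<and> j \<in> J} = J" using sub by auto
    obtain \<sigma> where \<sigma>: "\<sigma> permutes {0..<m}" "\<And>i. i < m \<Longrightarrow> pick I (\<sigma> i) = f i"
      using pick_image_permutation[OF inj(1)] unfolding I_def by blast
    obtain \<rho> where \<rho>: "\<rho> permutes {0..<m}" "\<And>i. i < m \<Longrightarrow> pick J (\<rho> i) = g i"
      using pick_image_permutation[OF inj(2)] unfolding J_def by blast
    define B where "B = submatrix A I J"
    have B: "B \<in> carrier_mat m m" by (auto simp: B_def dim_submatrix sets card)
    have Bij: "B $$ (i, j) = A $$ (pick I i, pick J j)" if "i < m" "j < m" for i j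
      using that by (simp add: B_def submatrix_def sets card)
    have p\<sigma>: "\<sigma> i < m" if "i < m" for i using permutes_in_image[OF \<sigma>(1), of i] that by simp
    have p\<rho>: "\<rho> i < m" if "i < m" for i using permutes_in_image[OF \<rho>(1), of i] that by simp
    define C where "C = mat m m (\<lambda>(i, j). B $$ (\<sigma> i, j))"
    have C: "C \<in> carrier_mat m m" by (simp add: C_def)
    have C': "Determinant.det C = signof \<sigma> * Determinant.det B"
      unfolding C_def by (rule Determinant.det_permute_rows[OF B \<sigma>(1)])
    have "mat m m (\<lambda>(i, j). transpose_mat C $$ (\<rho> i, j)) = transpose_mat ?M"
      using p\<sigma> p\<rho> Bij \<sigma>(2) \<rho>(2) by (auto simp: C_def intro!: eq_matI)
    then have "Determinant.det (transpose_mat ?M) = signof \<rho> * Determinant.det (transpose_mat C)"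
      using Determinant.det_permute_rows[OF _ \<rho>(1), of "transpose_mat C"] C by simp
    then have "Determinant.det ?M = signof \<rho> * (signof \<sigma> * Determinant.det B)"
      unfolding Determinant.det_transpose[OF M] Determinant.det_transpose[OF C] C' .
    moreover have "Determinant.det B \<in> {0, 1, -1}"
      using tu sub card by (auto simp: totally_unimodular_def B_def)
    moreover have "\<bar>signof \<pi> :: real\<bar> = 1" for \<pi> :: "nat \<Rightarrow> nat" by (simp add: sign_def)
    ultimately show ?thesis by (auto simp: abs_mult)
  qed
qed

text \<open>Padding with zero rows makes the matrix square and singular, since its last row is
  0.\<close>

lemma nontrivial_kernel:
  fixes M :: "nat \<Rightarrow> nat \<Rightarrow> real"
  assumes "r < c"
  obtains v where "\<exists>j<c. v j \<noteq> 0" "\<And>i. i < r \<Longrightarrow> (\<Sum>j<c. M i j * v j) = 0"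
proof -
  define A where "A = mat c c (\<lambda>(i, j). if i < r then M i j else 0)"
  have A: "A \<in> carrier_mat c c" by (simp add: A_def)
  have "transpose_mat A *\<^sub>v unit_vec c (c - 1) = 0\<^sub>v c"
    using assms by (intro eq_vecI) (auto simp: A_def scalar_prod_right_unit)
  moreover have "unit_vec c (c - 1) \<noteq> (0\<^sub>v c :: real vec)" using assms by simp
  ultimately have "Determinant.det (transpose_mat A) = 0"
    using A by (subst det_0_iff_vec_prod_zero[of _ c]) (auto intro!: exI[of _ "unit_vec c (c - 1)"])
  then have "Determinant.det A = 0" by (simp add: Determinant.det_transpose[OF A])
  then obtain v where v: "v \<in> carrier_vec c" "v \<noteq> 0\<^sub>v c" "A *\<^sub>v v = 0\<^sub>v c"
    using det_0_iff_vec_prod_zero[OF A] by blast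
  have "\<exists>j<c. v $ j \<noteq> 0"
  proof (rule ccontr)
    assume "\<not> (\<exists>j<c. v $ j \<noteq> 0)"
    then have "v = 0\<^sub>v c" using v(1) by (intro eq_vecI) auto
    then show False using v(2) by simp
  qed
  moreover have "(\<Sum>j<c. M i j * v $ j) = 0" if "i < r" for i
  proof -
    have "(A *\<^sub>v v) $ i = (\<Sum>j<c. M i j * v $ j)"
      using that assms v(1) by (auto simp: A_def scalar_prod_def lessThan_atLeast0 intro!: sum.cong)
    then show ?thesis using v(3) that assms by simp
  qed
  ultimately show ?thesis using that[of "\<lambda>j. v $ j"] by blast
qed

lemma det_of_integers:
  fixes A :: "real mat"
  assumes A: "A \<in> carrier_mat n n" and int: "\<And>i j. i < n \<Longrightarrow> j < n \<Longrightarrow> A $$ (i, j) \<in> \<int>"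
  shows "Determinant.det A \<in> \<int>"
  unfolding det_def'[OF A]
proof (intro Ints_sum Ints_mult Ints_prod)
  fix p i assume "p \<in> {p. p permutes {0..<n}}" "i \<in> {0..<n}"
  then have "p i < n" using permutes_in_image[of p "{0..<n}" i] by simp
  then show "A $$ (i, p i) \<in> \<int>" using int \<open>i \<in> _\<close> by simp
qed (simp add: sign_def)

text \<open>
  Laplace expansion along the column of ones leaves minors of the totally unimodular matrix; this
  is Cramer's rule for systems in the differences of its columns.
\<close>

lemma bordered_solution_bound:
  fixes A :: "real mat"
  assumes tu: "totally_unimodular A"
    and int: "\<And>i j. i < dim_row A \<Longrightarrow> j < dim_col A \<Longrightarrow> A $$ (i, j) \<in> \<int>"
    and f: "\<And>l. l < r \<Longrightarrow> f l < dim_row A" and g: "\<And>i. i < Suc r \<Longrightarrow> g i < dim_col A"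
    and ker: "\<And>s u. (\<And>i. i < Suc r \<Longrightarrow> s + (\<Sum>l<r. A $$ (f l, g i) * u l) = 0) \<Longrightarrow> (\<forall>l<r. u l = 0)"
    and sol: "\<And>i. i < Suc r \<Longrightarrow> s + (\<Sum>l<r. A $$ (f l, g i) * u l) = (if i = j then c else 0)"
    and j: "j < Suc r" and l: "l < r"
  shows "\<bar>u l\<bar> \<le> real r * \<bar>c\<bar>"
proof -
  define B where "B = mat (Suc r) (Suc r) (\<lambda>(i, l). if l = 0 then 1 else A $$ (f (l - 1), g i))"
  have B: "B \<in> carrier_mat (Suc r) (Suc r)" by (simp add: B_def)
  have mult: "(B *\<^sub>v v) $ i = v $ 0 + (\<Sum>l<r. A $$ (f l, g i) * v $ Suc l)"
    if "v \<in> carrier_vec (Suc r)" "i < Suc r" for v i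
  proof -
    have "(B *\<^sub>v v) $ i = (\<Sum>l<Suc r. B $$ (i, l) * v $ l)"
      using that B by (simp add: scalar_prod_def lessThan_atLeast0)
    also have "\<dots> = v $ 0 + (\<Sum>l<r. A $$ (f l, g i) * v $ Suc l)"
      using that(2) by (simp only: sum.lessThan_Suc_shift) (simp add: B_def)
    finally show ?thesis .
  qed
  have det: "Determinant.det B \<noteq> 0"
  proof
    assume "Determinant.det B = 0"
    then obtain v where v: "v \<in> carrier_vec (Suc r)" "v \<noteq> 0\<^sub>v (Suc r)" "B *\<^sub>v v = 0\<^sub>v (Suc r)"
      using det_0_iff_vec_prod_zero[OF B] by blast
    have eq: "v $ 0 + (\<Sum>l<r. A $$ (f l, g i) * v $ Suc l) = 0" if "i < Suc r" for i
      using mult[OF v(1) that] v(3) that by simp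
    have z: "\<forall>l<r. v $ Suc l = 0" by (rule ker[OF eq])
    then have "v $ 0 = 0" using eq[of 0] by simp
    then have "v $ i = 0" if "i < Suc r" for i using z that by (cases i) auto
    then have "v = 0\<^sub>v (Suc r)" using v(1) by (intro eq_vecI) auto
    then show False using v(2) by simp
  qed
  \<comment> \<open>A nonzero integer, so the denominator in Cramer's rule is at least 1.\<close>
  have "Determinant.det B \<in> \<int>"
    by (rule det_of_integers[OF B]) (use int f g in \<open>auto simp: B_def\<close>)
  then have det1: "1 \<le> \<bar>Determinant.det B\<bar>"
    using det by (auto elim!: Ints_cases)
  define v where "v = vec (Suc r) (\<lambda>l. if l = 0 then s else u (l - 1))"
  have v: "v \<in> carrier_vec (Suc r)" by (simp add: v_def)
  have Bv: "B *\<^sub>v v = vec (Suc r) (\<lambda>i. if i = j then c else 0)"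
    using sol mult[OF v] B by (intro eq_vecI) (auto simp: v_def)
  \<comment> \<open>Cramer's rule in adjugate form. The right-hand side is supported at row j, so a
    single cofactor remains.\<close>
  have "Determinant.det B * u l = ((Determinant.det B \<cdot>\<^sub>m 1\<^sub>m (Suc r)) *\<^sub>v v) $ Suc l"
    using l by (simp add: v_def scalar_prod_left_unit)
  also have "\<dots> = ((adj_mat B * B) *\<^sub>v v) $ Suc l" using adj_mat(3)[OF B] by simp
  also have "(adj_mat B * B) *\<^sub>v v = adj_mat B *\<^sub>v (B *\<^sub>v v)"
    by (rule assoc_mult_mat_vec[OF adj_mat(1)[OF B] B v])
  also have "(adj_mat B *\<^sub>v (B *\<^sub>v v)) $ Suc l = cofactor B j (Suc l) * c"
    using l j B unfolding Bv
    by (simp add: adj_mat_def scalar_prod_def if_distrib[of "\<lambda>x. _ * x"] sum.delta cong: if_cong)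
  finally have cramer: "\<bar>Determinant.det B\<bar> * \<bar>u l\<bar> = \<bar>cofactor B j (Suc l)\<bar> * \<bar>c\<bar>"
    by (metis abs_mult)
  define C where "C = mat_delete B j (Suc l)"
  have C: "C \<in> carrier_mat r r" using mat_delete_carrier[OF B] by (simp add: C_def)
  have Cij: "C $$ (i, m) = (if m = 0 then 1 else A $$ (f (if m < Suc l then m - 1 else m), g (if i < j then i else Suc i)))"
    if "i < r" "m < r" for i m
    using that l B by (auto simp: C_def mat_delete_def B_def)
  \<comment> \<open>With the column of ones removed as well, the transpose of a submatrix of
    \<open>A\<close> is left. Column 0 of \<open>C\<close> consists of ones, so the expansion has r
    terms of absolute value at most 1.\<close>
  have "\<bar>cofactor C i 0\<bar> \<le> 1" if i: "i < r" for i
  proof -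
    let ?F = "\<lambda>m. f (if Suc m < Suc l then m else Suc m)"
    let ?s = "\<lambda>i'. if i' < i then i' else Suc i'"
    let ?G = "\<lambda>i'. g (if ?s i' < j then ?s i' else Suc (?s i'))"
    have "mat_delete C i 0 = transpose_mat (mat (r - 1) (r - 1) (\<lambda>(m, i'). A $$ (?F m, ?G i')))"
      using C i by (intro eq_matI) (auto simp: mat_delete_def Cij)
    moreover have "\<bar>Determinant.det (mat (r - 1) (r - 1) (\<lambda>(m, i'). A $$ (?F m, ?G i')))\<bar> \<le> 1"
      by (rule totally_unimodular_det_le_1[OF tu]) (auto intro!: f g)
    ultimately have "\<bar>Determinant.det (mat_delete C i 0)\<bar> \<le> 1"
      using Determinant.det_transpose[of "mat (r - 1) (r - 1) (\<lambda>(m, i'). A $$ (?F m, ?G i'))" "r - 1"] by simp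
    then show ?thesis by (simp add: cofactor_def abs_mult power_abs)
  qed
  then have "(\<Sum>i<r. \<bar>C $$ (i, 0) * cofactor C i 0\<bar>) \<le> (\<Sum>i<r. 1)"
    using l by (intro sum_mono) (simp add: Cij)
  moreover have "\<bar>Determinant.det C\<bar> \<le> (\<Sum>i<r. \<bar>C $$ (i, 0) * cofactor C i 0\<bar>)"
    using laplace_expansion_column[OF C, of 0] l by (simp add: sum_abs)
  ultimately have "\<bar>Determinant.det C\<bar> \<le> real r" by simp
  then have "\<bar>cofactor B j (Suc l)\<bar> \<le> real r"
    by (simp add: cofactor_def C_def abs_mult power_abs)
  then have "\<bar>cofactor B j (Suc l)\<bar> * \<bar>c\<bar> \<le> real r * \<bar>c\<bar>" by (rule mult_right_mono) simp
  moreover have "1 * \<bar>u l\<bar> \<le> \<bar>Determinant.det B\<bar> * \<bar>u l\<bar>" using det1 by (rule mult_right_mono) simp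
  ultimately show ?thesis using cramer by simp
qed

section \<open>Basic solutions of linear programs and their size\<close>

lemma inner_coord_space:
  "x \<in> coord_space n \<Longrightarrow> inner x y = (\<Sum>l<n. Poly_Mapping.lookup x l * Poly_Mapping.lookup y l)"
  by (subst inner_poly_mapping_superset[of "{..<n}"]) (auto simp: coord_space_def in_keys_iff not_less[symmetric])

lemma norm_coord_space_le:
  assumes x: "x \<in> coord_space n" and M: "\<And>l. l < n \<Longrightarrow> \<bar>Poly_Mapping.lookup x l\<bar> \<le> M" "0 \<le> M"
  shows "norm x \<le> sqrt (real n) * M"
proof -
  have "(norm x)\<^sup>2 = (\<Sum>l<n. (Poly_Mapping.lookup x l)\<^sup>2)"
    unfolding power2_norm_eq_inner inner_coord_space[OF x] by (simp add: power2_eq_square)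
  also have "\<dots> \<le> (\<Sum>l<n. M\<^sup>2)"
  proof (rule sum_mono)
    fix l assume "l \<in> {..<n}"
    then have "\<bar>Poly_Mapping.lookup x l\<bar>\<^sup>2 \<le> M\<^sup>2" using M by (intro power_mono) auto
    then show "(Poly_Mapping.lookup x l)\<^sup>2 \<le> M\<^sup>2" by simp
  qed
  also have "\<dots> = (sqrt (real n) * M)\<^sup>2" by (simp add: power_mult_distrib)
  finally show ?thesis by (rule power2_le_imp_le) (use M(2) in simp)
qed

text \<open>
  Coordinates that vanish count as tight constraints, so that a point with the largest number of
  tight constraints is determined by them even if the polyhedron contains lines.
\<close>

lemma basic_solution_exists:
  fixes d :: "nat \<Rightarrow> nat \<Rightarrow>\<^sub>0 real" and b p :: "nat \<Rightarrow> real"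
  assumes x: "x \<in> coord_space n" "\<And>i. i < k \<Longrightarrow> b i \<le> inner (d i) x" and p: "\<And>i. i < k \<Longrightarrow> 0 \<le> p i"
  defines "T \<equiv> \<lambda>v. \<Sum>i<k. p i * inner (d i) v"
  obtains y where "y \<in> coord_space n" "\<forall>i<k. b i \<le> inner (d i) y" "T y \<le> T x"
    "\<forall>v\<in>coord_space n. (\<forall>i<k. inner (d i) y = b i \<longrightarrow> inner (d i) v = 0) \<longrightarrow>
      (\<forall>l<n. Poly_Mapping.lookup y l = 0 \<longrightarrow> Poly_Mapping.lookup v l = 0) \<longrightarrow> v = 0"
proof -
  define P where "P y \<longleftrightarrow> y \<in> coord_space n \<and> (\<forall>i<k. b i \<le> inner (d i) y) \<and> T y \<le> T x" for y
  define J where "J y = {i. i < k \<and> inner (d i) y = b i}" for y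
  define Z where "Z y = {l. l < n \<and> Poly_Mapping.lookup y l = 0}" for y :: "nat \<Rightarrow>\<^sub>0 real"
  have fin: "finite (J y)" "finite (Z y)" for y by (auto simp: J_def Z_def)
  have "card (J y) \<le> k" "card (Z y) \<le> n" for y
    using card_mono[of "{..<k}" "J y"] card_mono[of "{..<n}" "Z y"] by (auto simp: J_def Z_def)
  then have bd: "card (J y) + card (Z y) < Suc (k + n)" for y by (simp add: add_mono less_Suc_eq_le)
  have "P x" using x by (auto simp: P_def)
  then obtain y where y: "P y" "\<And>y'. P y' \<Longrightarrow> card (J y') + card (Z y') \<le> card (J y) + card (Z y)"
    using ex_has_greatest_nat[of P x "\<lambda>y. card (J y) + card (Z y)" "Suc (k + n)"] bd by blast
  have no_gain: False if "P y'" "J y \<subseteq> J y'" "Z y \<subseteq> Z y'" "J y \<noteq> J y' \<or> Z y \<noteq> Z y'" for y'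
  proof -
    have "card (J y) \<le> card (J y')" "card (Z y) \<le> card (Z y')"
      using that fin by (auto intro: card_mono)
    moreover have "card (J y) < card (J y') \<or> card (Z y) < card (Z y')"
      using that fin by (metis psubsetI psubset_card_mono)
    ultimately show False using y(2)[OF that(1)] by linarith
  qed
  \<comment> \<open>Otherwise walk from \<open>y\<close> along \<open>v\<close> to the first
    constraint that becomes tight. The objective does not increase and tight constraints stay tight,
    against the maximal choice of \<open>y\<close>.\<close>
  have key: "\<not> (inner (d i0) v < 0 \<and> T v \<le> 0)"
    if v: "v \<in> coord_space n" and vJ: "\<And>i. i \<in> J y \<Longrightarrow> inner (d i) v = 0"
      and vZ: "\<And>l. l \<in> Z y \<Longrightarrow> Poly_Mapping.lookup v l = 0" and i0: "i0 < k" for v i0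
  proof
    assume neg: "inner (d i0) v < 0 \<and> T v \<le> 0"
    define N where "N = {i. i < k \<and> inner (d i) v < 0}"
    define \<rho> where "\<rho> i = (inner (d i) y - b i) / - inner (d i) v" for i
    have N: "finite N" "N \<noteq> {}" using neg i0 by (auto simp: N_def)
    define s where "s = Min (\<rho> ` N)"
    have "s \<in> \<rho> ` N" unfolding s_def by (rule Min_in) (use N in auto)
    then obtain m where m: "m \<in> N" "s = \<rho> m" by auto
    have \<rho>0: "0 \<le> \<rho> i" if "i \<in> N" for i
      using that y(1) unfolding \<rho>_def by (intro divide_nonneg_pos) (auto simp: N_def P_def)
    have s: "0 \<le> s" unfolding m(2) by (rule \<rho>0[OF m(1)])
    have s_le: "s \<le> \<rho> i" if "i \<in> N" for i
      unfolding s_def by (rule Min_le) (use N that in auto)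
    define y' where "y' = y + s *\<^sub>R v"
    have in': "inner (d i) y' = inner (d i) y + s * inner (d i) v" for i
      by (simp add: y'_def inner_add_right)
    have "P y'" unfolding P_def
    proof (intro conjI allI impI)
      show "y' \<in> coord_space n" using y(1) v subspace_coord_space
        by (auto simp: y'_def P_def intro: subspace_add subspace_scale)
      fix i assume i: "i < k"
      have bi: "b i \<le> inner (d i) y" using y(1) i by (simp add: P_def)
      show "b i \<le> inner (d i) y'"
      proof (cases "i \<in> N")
        case True
        then have "s * - inner (d i) v \<le> inner (d i) y - b i"
          using s_le[OF True] unfolding \<rho>_def
          by (subst (asm) pos_le_divide_eq) (use True in \<open>auto simp: N_def\<close>)
        then show ?thesis by (simp add: in')
      next
        case False
        then have "0 \<le> s * inner (d i) v" using s i by (simp add: N_def)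
        then show ?thesis using bi by (simp add: in')
      qed
    next
      have "T y' = T y + s * T v"
        by (simp add: T_def in' distrib_left sum.distrib sum_distrib_left mult_ac)
      moreover have "s * T v \<le> 0" using s neg by (simp add: mult_nonneg_nonpos)
      ultimately show "T y' \<le> T x" using y(1) by (simp add: P_def)
    qed
    moreover have "J y \<subseteq> J y'" using vJ by (auto simp: J_def in')
    moreover have "Z y \<subseteq> Z y'" using vZ by (auto simp: Z_def y'_def lookup_add)
    moreover have "m \<in> J y'" using m by (auto simp: J_def in' \<rho>_def N_def)
    moreover have "m \<notin> J y" using vJ m by (force simp: N_def)
    ultimately show False using no_gain[of y'] by blast
  qed
  \<comment> \<open>\<open>key\<close> for \<open>v\<close> and \<open>- v\<close> forces all
    \<open>inner (d i) v\<close> to vanish. Walking along a nonzero \<open>v\<close> then affects no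
    constraint, so it can be continued until a further coordinate becomes 0.\<close>
  have trivial: "v = 0" if v: "v \<in> coord_space n" and vJ: "\<And>i. i \<in> J y \<Longrightarrow> inner (d i) v = 0"
      and vZ: "\<And>l. l \<in> Z y \<Longrightarrow> Poly_Mapping.lookup v l = 0" for v
  proof (rule ccontr)
    assume "v \<noteq> 0"
    have zero: "inner (d i) v = 0" if i: "i < k" for i
    proof (rule ccontr)
      assume nz: "inner (d i) v \<noteq> 0"
      have k1: "\<not> (inner (d i) v < 0 \<and> T v \<le> 0)" if "i < k" for i by (rule key[OF v vJ vZ that])
      have "T (- v) = - T v" by (simp add: T_def sum_negf)
      moreover have "\<not> (inner (d i) (- v) < 0 \<and> T (- v) \<le> 0)" if "i < k" for i
        by (rule key[OF subspace_neg[OF subspace_coord_space v] _ _ that]) (use vJ vZ in auto)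
      ultimately have k2: "\<not> (0 < inner (d i) v \<and> 0 \<le> T v)" if "i < k" for i
        using that by simp
      \<comment> \<open>For \<open>T v < 0\<close>, \<open>key\<close> makes every term of
        \<open>T v\<close> nonnegative, a contradiction; the positive case is symmetric.\<close>
      consider "T v < 0" | "T v = 0" | "0 < T v" by linarith
      then show False
      proof cases
        case 1
        have "0 \<le> T v" unfolding T_def
          using k1 1 p by (intro sum_nonneg mult_nonneg_nonneg) (auto simp: not_less)
        then show False using 1 by simp
      next
        case 2
        then show False using k1[OF i] k2[OF i] nz by linarith
      next
        case 3
        have "T v \<le> 0" unfolding T_def
          using k2 3 p by (intro sum_nonpos mult_nonneg_nonpos) (auto simp: not_less)
        then show False using 3 by simp
      qed
    qed
    obtain l where l: "l < n" "Poly_Mapping.lookup v l \<noteq> 0"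
      using coord_space_eq_0I[OF v] \<open>v \<noteq> 0\<close> by blast
    define s where "s = - Poly_Mapping.lookup y l / Poly_Mapping.lookup v l"
    define y' where "y' = y + s *\<^sub>R v"
    have in': "inner (d i) y' = inner (d i) y" if "i < k" for i
      using zero[OF that] by (simp add: y'_def inner_add_right)
    have "y' \<in> coord_space n" using y(1) v subspace_coord_space
      by (auto simp: y'_def P_def intro: subspace_add subspace_scale)
    moreover have "T y' = T y" by (simp add: T_def in')
    ultimately have "P y'" using y(1) by (auto simp: P_def in')
    moreover have "J y \<subseteq> J y'" by (auto simp: J_def in')
    moreover have "Z y \<subseteq> Z y'" using vZ by (auto simp: Z_def y'_def lookup_add)
    moreover have "l \<in> Z y'" using l by (auto simp: Z_def y'_def lookup_add lookup_minus s_def)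
    moreover have "l \<notin> Z y" using vZ l by blast
    ultimately show False using no_gain[of y'] by blast
  qed
  show ?thesis
    by (rule that[of y]) (use y(1) trivial in \<open>auto simp: P_def J_def Z_def\<close>)
qed

text \<open>\<open>I\<close> will be the support of a basic solution and \<open>J\<close> its tight
  constraints. A smallest subset \<open>J'\<close> of \<open>J\<close> with trivial kernel on the
  vectors supported in \<open>I\<close> has a dual family by minimality; counting equations and
  unknowns in both directions shows that the system is square.\<close>

lemma basic_solution_dual_basis:
  fixes d :: "nat \<Rightarrow> nat \<Rightarrow>\<^sub>0 real"
  assumes fin: "finite J" and In: "I \<subseteq> {..<n}"
    and ker: "\<And>v. v \<in> coord_space n \<Longrightarrow> (\<And>i. i \<in> J \<Longrightarrow> inner (d i) v = 0) \<Longrightarrow>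
      (\<And>l. l \<in> {..<n} - I \<Longrightarrow> Poly_Mapping.lookup v l = 0) \<Longrightarrow> v = 0"
  obtains J' w where "J' \<subseteq> J" "card J' = card I"
    "\<forall>v\<in>coord_space n. (\<forall>i\<in>J'. inner (d i) v = 0) \<longrightarrow>
      (\<forall>l\<in>{..<n} - I. Poly_Mapping.lookup v l = 0) \<longrightarrow> v = 0"
    "\<forall>j\<in>J'. w j \<in> coord_space n"
    "\<forall>j\<in>J'. \<forall>l\<in>{..<n} - I. Poly_Mapping.lookup (w j) l = 0"
    "\<forall>i\<in>J'. \<forall>j\<in>J'. inner (d i) (w j) = (if i = j then 1 else 0)"
proof -
  define V where "V = {v \<in> coord_space n. \<forall>l\<in>{..<n} - I. Poly_Mapping.lookup v l = 0}"
  have V: "subspace V"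
    using subspace_coord_space[of n] by (auto simp: V_def subspace_def lookup_add)
  have VI: "v = 0" if "v \<in> V" "\<And>l. l \<in> I \<Longrightarrow> Poly_Mapping.lookup v l = 0" for v
    using that coord_space_eq_0I[of v n] by (force simp: V_def)
  define K where "K J' \<longleftrightarrow> J' \<subseteq> J \<and> (\<forall>v\<in>V. (\<forall>i\<in>J'. inner (d i) v = 0) \<longrightarrow> v = 0)" for J'
  have "K J" using ker by (auto simp: K_def V_def)
  then obtain J' where J': "K J'" "\<And>J''. K J'' \<Longrightarrow> card J' \<le> card J''"
    using ex_has_least_nat[of K J card] by blast
  have finJ': "finite J'" using J'(1) fin finite_subset by (auto simp: K_def)
  have finI: "finite I" using In finite_subset by blast
  have "\<exists>w. w \<in> V \<and> (\<forall>i\<in>J'. inner (d i) w = (if i = j then 1 else 0))" if j: "j \<in> J'" for j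
  proof -
    have "card (J' - {j}) < card J'" using j finJ' by (rule card_Diff1_less[rotated])
    then have "\<not> K (J' - {j})" using J'(2)[of "J' - {j}"] by auto
    then obtain v where v: "v \<in> V" "\<And>i. i \<in> J' - {j} \<Longrightarrow> inner (d i) v = 0" "v \<noteq> 0"
      using J'(1) by (auto simp: K_def)
    have nz: "inner (d j) v \<noteq> 0"
    proof
      assume "inner (d j) v = 0"
      then have "\<forall>i\<in>J'. inner (d i) v = 0" using v(2) by blast
      then show False using J'(1) v(1,3) by (auto simp: K_def)
    qed
    have "(1 / inner (d j) v) *\<^sub>R v \<in> V" using V v(1) by (rule subspace_scale)
    moreover have "\<forall>i\<in>J'. inner (d i) ((1 / inner (d j) v) *\<^sub>R v) = (if i = j then 1 else 0)"
      using v(2) nz by auto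
    ultimately show ?thesis by blast
  qed
  then obtain w where w: "\<And>j. j \<in> J' \<Longrightarrow> w j \<in> V"
    "\<And>i j. j \<in> J' \<Longrightarrow> i \<in> J' \<Longrightarrow> inner (d i) (w j) = (if i = j then 1 else 0)"
    by metis
  obtain e where e: "bij_betw e {..<card J'} J'"
    using ex_bij_betw_nat_finite[OF finJ'] by (auto simp: lessThan_atLeast0)
  obtain f where f: "bij_betw f {..<card I} I"
    using ex_bij_betw_nat_finite[OF finI] by (auto simp: lessThan_atLeast0)
  have "\<not> card J' < card I"
  proof
    assume "card J' < card I"
    then obtain v where v: "\<exists>j<card I. v j \<noteq> 0"
      "\<And>i. i < card J' \<Longrightarrow> (\<Sum>j<card I. Poly_Mapping.lookup (d (e i)) (f j) * v j) = 0"
      using nontrivial_kernel[of "card J'" "card I" "\<lambda>i j. Poly_Mapping.lookup (d (e i)) (f j)"] by metis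
    define u where "u = (\<Sum>j<card I. Poly_Mapping.single (f j) (v j))"
    have fI: "f j \<in> I" if "j < card I" for j using bij_betwE[OF f] that by auto
    have "u \<in> V"
      unfolding u_def
    proof (intro subspace_sum V)
      fix j assume "j \<in> {..<card I}"
      then have "f j \<in> I" using fI by simp
      then show "Poly_Mapping.single (f j) (v j) \<in> V"
        using In by (auto simp: V_def coord_space_def lookup_single when_def)
    qed
    moreover have "inner (d i) u = 0" if i: "i \<in> J'" for i
    proof -
      obtain i' where i': "i' < card J'" "i = e i'" using i e by (auto simp: bij_betw_def)
      show ?thesis using v(2)[OF i'(1)] by (simp add: u_def inner_sum_right i'(2) mult.commute)
    qed
    ultimately have "u = 0" using J'(1) by (auto simp: K_def)
    moreover have "Poly_Mapping.lookup u (f m) = v m" if m: "m < card I" for m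
    proof -
      have "f j = f m \<longleftrightarrow> j = m" if "j < card I" for j
        using f m that by (auto simp: bij_betw_def inj_on_def)
      then have "Poly_Mapping.lookup u (f m) = (\<Sum>j<card I. if j = m then v j else 0)"
        unfolding u_def lookup_sum by (intro sum.cong) (auto simp: lookup_single when_def)
      then show ?thesis using m by simp
    qed
    ultimately show False using v(1) by (metis lookup_zero)
  qed
  moreover have "\<not> card I < card J'"
  proof
    assume "card I < card J'"
    then obtain c where c: "\<exists>j<card J'. c j \<noteq> 0"
      "\<And>i. i < card I \<Longrightarrow> (\<Sum>j<card J'. Poly_Mapping.lookup (w (e j)) (f i) * c j) = 0"
      using nontrivial_kernel[of "card I" "card J'" "\<lambda>i j. Poly_Mapping.lookup (w (e j)) (f i)"] by metis
    define u where "u = (\<Sum>j<card J'. c j *\<^sub>R w (e j))"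
    have eJ: "e j \<in> J'" if "j < card J'" for j using bij_betwE[OF e] that by auto
    have "u \<in> V" unfolding u_def
      by (intro subspace_sum subspace_scale V w(1) eJ) simp
    moreover have "Poly_Mapping.lookup u l = 0" if l: "l \<in> I" for l
    proof -
      obtain i where i: "i < card I" "l = f i" using l f by (auto simp: bij_betw_def)
      show ?thesis using c(2)[OF i(1)] by (simp add: u_def lookup_sum i(2) mult.commute)
    qed
    ultimately have "u = 0" by (rule VI)
    have "c m = 0" if m: "m < card J'" for m
    proof -
      have "e m = e j \<longleftrightarrow> j = m" if "j < card J'" for j
        using e m that by (auto simp: bij_betw_def inj_on_def)
      then have "inner (d (e m)) u = (\<Sum>j<card J'. if j = m then c j else 0)"
        unfolding u_def inner_sum_right by (intro sum.cong) (auto simp: w(2)[OF eJ eJ[OF m]])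
      then show ?thesis using m \<open>u = 0\<close> by simp
    qed
    then show False using c(1) by blast
  qed
  ultimately have "card J' = card I" by simp
  then show ?thesis
    using J'(1) w by (intro that[of J' w]) (auto simp: K_def V_def)
qed

text \<open>Gram-Schmidt over the finite generating set.\<close>

lemma orthogonal_projection_exists:
  fixes x :: "'a::real_inner"
  assumes "finite B"
  obtains y where "y \<in> span B" "\<And>b. b \<in> span B \<Longrightarrow> inner (x - y) b = 0"
proof -
  have "\<exists>y\<in>span B. \<forall>b\<in>span B. inner (x - y) b = 0"
    using assms
  proof (induction B arbitrary: x)
    case empty
    then show ?case by simp
  next
    case (insert c B)
    obtain c' where c': "c' \<in> span B" "\<And>b. b \<in> span B \<Longrightarrow> inner (c - c') b = 0" using insert.IH by blast
    obtain y where y: "y \<in> span B" "\<And>b. b \<in> span B \<Longrightarrow> inner (x - y) b = 0" using insert.IH by blast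
    define e where "e = c - c'"
    \<comment> \<open>For \<open>e = 0\<close> the quotient is 0 and the new generator adds
      nothing.\<close>
    define s where "s = inner (x - y) e / inner e e"
    have sub: "span B \<subseteq> span (insert c B)" by (rule span_mono) blast
    have "e \<in> span (insert c B)"
      unfolding e_def by (rule span_diff[OF span_base[OF insertI1] subsetD[OF sub c'(1)]])
    then have in': "y + s *\<^sub>R e \<in> span (insert c B)" by (rule span_add[OF subsetD[OF sub y(1)] span_scale])
    have e: "inner (x - (y + s *\<^sub>R e)) e = 0"
      by (cases "e = 0") (simp_all add: s_def inner_diff_left inner_add_left)
    have b0: "inner (x - (y + s *\<^sub>R e)) b = 0" if "b \<in> span B" for b
      using y(2)[OF that] c'(2)[OF that] by (simp add: e_def inner_diff_left inner_add_left)
    have "inner (x - (y + s *\<^sub>R e)) b = 0" if b: "b \<in> span (insert c B)" for b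
    proof -
      obtain r where r: "b - r *\<^sub>R c \<in> span B" using b unfolding span_breakdown_eq ..
      have b': "b = (b - r *\<^sub>R c + r *\<^sub>R c') + r *\<^sub>R e" by (simp add: e_def scaleR_diff_right)
      have z: "inner (x - (y + s *\<^sub>R e)) (b - r *\<^sub>R c + r *\<^sub>R c') = 0"
        by (rule b0) (intro span_add span_scale r c'(1))
      show ?thesis
        by (subst b', subst inner_add_right) (simp only: z inner_scaleR_right e mult_zero_right add_0_right)
    qed
    then show ?case using in' by blast
  qed
  then show ?thesis using that by blast
qed

lemma norm_projection_le:
  fixes x y :: "'a::real_inner"
  assumes "inner (x - y) y = 0"
  shows "norm y \<le> norm x"
proof -
  have "inner x x = inner (x - y) (x - y) + inner y y"
    using assms by (simp add: inner_diff_left inner_diff_right inner_commute)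
  moreover have "0 \<le> inner (x - y) (x - y)" by (rule inner_ge_zero)
  ultimately have "(norm y)\<^sup>2 \<le> (norm x)\<^sup>2" by (simp add: power2_norm_eq_inner)
  then show ?thesis by (rule power2_le_imp_le) simp
qed

text \<open>A basic solution is a combination of dual vectors \<open>w j\<close> with coefficients
  \<open>b j \<le> L\<close>. By Cramer's rule the entries of \<open>w j\<close> are at most n,
  there are at most n summands, and the Euclidean norm adds a factor sqrt n.\<close>

lemma basic_solution_bounded:
  fixes \<omega> :: "nat \<Rightarrow> nat \<Rightarrow>\<^sub>0 real"
  assumes \<omega>: "\<And>i. i < k \<Longrightarrow> \<omega> i \<in> int_coord_space n" and tu: "totally_unimodular (column_matrix n k \<omega>)"
    and m: "m < k" and L: "0 \<le> L"
    and x: "x \<in> coord_space n" "\<And>i. i < k \<Longrightarrow> min (inner (\<omega> m - \<omega> i) x) L \<ge> 0"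
    and p: "\<And>i. i < k \<Longrightarrow> 0 \<le> p i"
  obtains y where "y \<in> coord_space n" "\<And>i. i < k \<Longrightarrow> min (inner (\<omega> m - \<omega> i) x) L \<le> inner (\<omega> m - \<omega> i) y"
    "(\<Sum>i<k. p i * inner (\<omega> m - \<omega> i) y) \<le> (\<Sum>i<k. p i * inner (\<omega> m - \<omega> i) x)"
    "norm y \<le> sqrt (real n) * (real n * (real n * L))"
proof -
  define d where "d i = \<omega> m - \<omega> i" for i
  define b where "b i = min (inner (d i) x) L" for i
  have b0: "0 \<le> b i" "b i \<le> L" if "i < k" for i using x(2)[OF that] by (auto simp: b_def d_def)
  have bx: "b i \<le> inner (d i) x" if "i < k" for i by (simp add: b_def)
  obtain y where y0: "y \<in> coord_space n" "\<forall>i<k. b i \<le> inner (d i) y"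
    "(\<Sum>i<k. p i * inner (d i) y) \<le> (\<Sum>i<k. p i * inner (d i) x)"
    and ker0: "\<forall>v\<in>coord_space n. (\<forall>i<k. inner (d i) y = b i \<longrightarrow> inner (d i) v = 0) \<longrightarrow>
      (\<forall>l<n. Poly_Mapping.lookup y l = 0 \<longrightarrow> Poly_Mapping.lookup v l = 0) \<longrightarrow> v = 0"
    by (rule basic_solution_exists[where d = d and b = b and p = p and k = k, OF x(1)]) (auto simp: bx p)
  have y: "y \<in> coord_space n" "\<And>i. i < k \<Longrightarrow> b i \<le> inner (d i) y"
    "(\<Sum>i<k. p i * inner (d i) y) \<le> (\<Sum>i<k. p i * inner (d i) x)"
    using y0 by auto
  define J where "J = {i. i < k \<and> inner (d i) y = b i}"
  define I where "I = {l. l < n \<and> Poly_Mapping.lookup y l \<noteq> 0}"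
  have finJ: "finite J" and In: "I \<subseteq> {..<n}" and finI: "finite I" by (auto simp: J_def I_def)
  have ker1: "v = 0" if "v \<in> coord_space n" "\<And>i. i \<in> J \<Longrightarrow> inner (d i) v = 0"
      "\<And>l. l \<in> {..<n} - I \<Longrightarrow> Poly_Mapping.lookup v l = 0" for v
    using bspec[OF ker0 that(1)] that(2,3) by (auto simp: J_def I_def)
  obtain J' w where J': "J' \<subseteq> J" "card J' = card I"
    and ker2: "\<forall>v\<in>coord_space n. (\<forall>i\<in>J'. inner (d i) v = 0) \<longrightarrow>
      (\<forall>l\<in>{..<n} - I. Poly_Mapping.lookup v l = 0) \<longrightarrow> v = 0"
    and w0: "\<forall>j\<in>J'. w j \<in> coord_space n"
    "\<forall>j\<in>J'. \<forall>l\<in>{..<n} - I. Poly_Mapping.lookup (w j) l = 0"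
    "\<forall>i\<in>J'. \<forall>j\<in>J'. inner (d i) (w j) = (if i = j then 1 else 0)"
    using basic_solution_dual_basis[OF finJ In ker1] by blast
  have w: "\<And>j. j \<in> J' \<Longrightarrow> w j \<in> coord_space n"
    "\<And>j l. j \<in> J' \<Longrightarrow> l \<in> {..<n} - I \<Longrightarrow> Poly_Mapping.lookup (w j) l = 0"
    "\<And>i j. i \<in> J' \<Longrightarrow> j \<in> J' \<Longrightarrow> inner (d i) (w j) = (if i = j then 1 else 0)"
    using w0 by blast+
  have ker: "v = 0" if "v \<in> coord_space n" "\<And>i. i \<in> J' \<Longrightarrow> inner (d i) v = 0"
      "\<And>l. l \<in> {..<n} - I \<Longrightarrow> Poly_Mapping.lookup v l = 0" for v
    using bspec[OF ker2 that(1)] that(2,3) by blast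
  have finJ': "finite J'" using J'(1) finJ by (rule finite_subset)
  define r where "r = card I"
  have rn: "r \<le> n" using card_mono[OF _ In] by (simp add: r_def)
  obtain e where e: "bij_betw e {..<r} J'"
    using ex_bij_betw_nat_finite[OF finJ'] J'(2) by (auto simp: lessThan_atLeast0 r_def)
  obtain f where f: "bij_betw f {..<r} I"
    using ex_bij_betw_nat_finite[OF finI] by (auto simp: lessThan_atLeast0 r_def)
  have eJ: "e i \<in> J'" if "i < r" for i using bij_betwE[OF e] that by auto
  have ek: "e i < k" if "i < r" for i using eJ[OF that] J'(1) by (auto simp: J_def)
  have fI: "f l \<in> I" if "l < r" for l using bij_betwE[OF f] that by auto
  have fn: "f l < n" if "l < r" for l using fI[OF that] In by auto
  define A where "A = column_matrix n k \<omega>"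
  \<comment> \<open>Index 0 is the reference column \<open>m\<close>, the others are the selected
    tight constraints.\<close>
  define h where "h i = (if i = 0 then m else e (i - 1))" for i
  have A: "A $$ (l, i) = Poly_Mapping.lookup (\<omega> i) l" "dim_row A = n" "dim_col A = k" if "l < n" "i < k" for l i
    using that by (auto simp: A_def column_matrix_def)
  have hk: "h i < k" if "i < Suc r" for i using that m ek by (cases i) (auto simp: h_def)
  have inner_restrict: "inner (\<omega> i) v = (\<Sum>l<r. A $$ (f l, i) * Poly_Mapping.lookup v (f l))"
    if i: "i < k" and v: "v \<in> coord_space n" "\<And>l. l \<in> {..<n} - I \<Longrightarrow> Poly_Mapping.lookup v l = 0" for i v
  proof -
    have "\<omega> i \<in> coord_space n" using \<omega>[OF i] by (simp add: int_coord_space_def)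
    then have "inner (\<omega> i) v = (\<Sum>l<n. Poly_Mapping.lookup (\<omega> i) l * Poly_Mapping.lookup v l)"
      by (rule inner_coord_space)
    also have "\<dots> = (\<Sum>l\<in>I. Poly_Mapping.lookup (\<omega> i) l * Poly_Mapping.lookup v l)"
      using In v(2) by (intro sum.mono_neutral_right) auto
    also have "\<dots> = (\<Sum>l<r. Poly_Mapping.lookup (\<omega> i) (f l) * Poly_Mapping.lookup v (f l))"
      by (rule sum.reindex_bij_betw[OF f, symmetric])
    also have "\<dots> = (\<Sum>l<r. A $$ (f l, i) * Poly_Mapping.lookup v (f l))"
      using fn i by (intro sum.cong) (auto simp: A)
    finally show ?thesis .
  qed
  have w_bound: "\<bar>Poly_Mapping.lookup (w j) l\<bar> \<le> real n" if j: "j \<in> J'" and l: "l < n" for j l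
  proof (cases "l \<in> I")
    case False
    then show ?thesis using w(2)[OF j] l by simp
  next
    case True
    obtain l' where l': "l' < r" "l = f l'" using True f by (auto simp: bij_betw_def)
    obtain j' where j': "j' < r" "j = e j'" using j e by (auto simp: bij_betw_def)
    \<comment> \<open>With - <\<omega> m, w j> as the unknown of the column of ones, the row of
      \<open>m\<close> gives 0 and that of a tight index i gives - <d i, w j>; hence a right-hand
      side with a single entry - 1.\<close>
    have "\<bar>Poly_Mapping.lookup (w j) (f l')\<bar> \<le> real r * \<bar>- 1\<bar>"
    proof (rule bordered_solution_bound[OF tu[folded A_def], where g = h and f = f and c = "- 1" and l = l' and u = "\<lambda>l. Poly_Mapping.lookup (w j) (f l)" and j = "Suc j'" and s = "- inner (\<omega> m) (w j)"])
      show "A $$ (i, j) \<in> \<int>" if "i < dim_row A" "j < dim_col A" for i j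
        using that \<omega>[of j] by (auto simp: A_def column_matrix_def int_coord_space_def)
      show "f l < dim_row A" if "l < r" for l using fn[OF that] by (simp add: A_def column_matrix_def)
      show "h i < dim_col A" if "i < Suc r" for i using hk[OF that] by (simp add: A_def column_matrix_def)
      show "- inner (\<omega> m) (w j) + (\<Sum>l<r. A $$ (f l, h i) * Poly_Mapping.lookup (w j) (f l)) = (if i = Suc j' then - 1 else 0)"
        if i: "i < Suc r" for i
      proof (cases i)
        case 0
        then show ?thesis using inner_restrict[OF m w(1)[OF j] w(2)[OF j]] by (simp add: h_def)
      next
        case (Suc i')
        then have i': "i' < r" using i by simp
        have "e i' = e j' \<longleftrightarrow> i' = j'" using e i' j' by (auto simp: bij_betw_def inj_on_def)
        then have "inner (d (e i')) (w j) = (if i' = j' then 1 else 0)" using w(3)[OF eJ[OF i'] j] j' by auto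
        then show ?thesis
          using inner_restrict[OF ek[OF i'] w(1)[OF j] w(2)[OF j]] Suc
          by (auto simp: h_def d_def inner_diff_left)
      qed
      show "\<forall>l<r. u l = 0" if u: "\<And>i. i < Suc r \<Longrightarrow> s + (\<Sum>l<r. A $$ (f l, h i) * u l) = 0" for s u
      proof -
        define v where "v = (\<Sum>l<r. Poly_Mapping.single (f l) (u l))"
        have lv: "Poly_Mapping.lookup v (f l) = u l" if l: "l < r" for l
        proof -
          have "f l' = f l \<longleftrightarrow> l' = l" if "l' < r" for l'
            using f l that by (auto simp: bij_betw_def inj_on_def)
          then have "Poly_Mapping.lookup v (f l) = (\<Sum>l'<r. if l' = l then u l' else 0)"
            unfolding v_def lookup_sum by (intro sum.cong) (auto simp: lookup_single when_def)
          then show ?thesis using l by simp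
        qed
        have v0: "Poly_Mapping.lookup v l = 0" if "l \<notin> I" for l
          unfolding v_def lookup_sum using fI that by (intro sum.neutral) (auto simp: lookup_single when_def)
        have vc: "v \<in> coord_space n" by (auto simp: coord_space_def intro!: v0 dest: subsetD[OF In])
        have iv: "inner (\<omega> (h i)) v = - s" if i: "i < Suc r" for i
          using inner_restrict[OF hk[OF i] vc v0] u[OF i] lv by simp
        have "inner (d i) v = 0" if i: "i \<in> J'" for i
        proof -
          obtain i' where i': "i' < r" "i = e i'" using i e by (auto simp: bij_betw_def)
          show ?thesis using iv[of 0] iv[of "Suc i'"] i' by (simp add: h_def d_def inner_diff_left)
        qed
        then have "v = 0" using ker[OF vc] v0 by auto
        then show ?thesis using lv by (metis lookup_zero)
      qed
    qed (use j' l' in auto)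
    then show ?thesis using rn l'(2) by simp
  qed
  have Jb: "inner (d i) y = b i" "i < k" if "i \<in> J'" for i using that J'(1) by (auto simp: J_def)
  define z where "z = (\<Sum>j\<in>J'. b j *\<^sub>R w j)"
  have zc: "z \<in> coord_space n" unfolding z_def
    by (intro subspace_sum subspace_scale subspace_coord_space w)
  \<comment> \<open>Both have the same values at the constraints in \<open>J'\<close> and vanish
    outside \<open>I\<close>.\<close>
  have "y - z = 0"
  proof (rule ker)
    show "y - z \<in> coord_space n" by (rule subspace_diff[OF subspace_coord_space y(1) zc])
    fix i assume i: "i \<in> J'"
    have "inner (d i) z = (\<Sum>j\<in>J'. if i = j then b j else 0)"
      unfolding z_def inner_sum_right by (intro sum.cong) (auto simp: w(3)[OF i])
    then show "inner (d i) (y - z) = 0" using i finJ' Jb[OF i] by (simp add: inner_diff_right)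
  next
    fix l assume l: "l \<in> {..<n} - I"
    have "Poly_Mapping.lookup z l = 0"
      unfolding z_def lookup_sum using w(2)[OF _ l] by (intro sum.neutral) auto
    then show "Poly_Mapping.lookup (y - z) l = 0" using l by (auto simp: lookup_minus I_def)
  qed
  then have yz: "y = z" by simp
  have "norm y \<le> sqrt (real n) * (real n * (real n * L))"
  proof (rule norm_coord_space_le[OF y(1)])
    fix l assume l: "l < n"
    have "\<bar>Poly_Mapping.lookup y l\<bar> \<le> (\<Sum>j\<in>J'. \<bar>b j * Poly_Mapping.lookup (w j) l\<bar>)"
      by (simp add: yz z_def lookup_sum sum_abs)
    also have "\<dots> \<le> (\<Sum>j\<in>J'. L * real n)"
    proof (rule sum_mono)
      fix j assume j: "j \<in> J'"
      show "\<bar>b j * Poly_Mapping.lookup (w j) l\<bar> \<le> L * real n"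
        unfolding abs_mult using b0[OF Jb(2)[OF j]] w_bound[OF j l] by (intro mult_mono) auto
    qed
    also have "\<dots> = real r * (L * real n)" using J'(2) by (simp add: r_def)
    also have "\<dots> \<le> real n * (L * real n)" using rn L by (intro mult_right_mono) auto
    finally show "\<bar>Poly_Mapping.lookup y l\<bar> \<le> real n * (real n * L)" by (simp add: mult_ac)
  qed (use L in simp)
  then show ?thesis using that y by (simp add: b_def d_def)
qed

text \<open>The weights belong to indices, since \<omega> may list a point several times.\<close>

lemma convex_hull_weights:
  fixes \<omega> :: "nat \<Rightarrow> 'a::real_vector"
  assumes "\<theta> \<in> convex hull (\<omega> ` {..<k})"
  obtains p where "\<And>i. i < k \<Longrightarrow> 0 \<le> p i" "(\<Sum>i<k. p i) = 1" "\<theta> = (\<Sum>i<k. p i *\<^sub>R \<omega> i)"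
proof -
  define C where "C = {x. \<exists>p. (\<forall>i<k. 0 \<le> p i) \<and> (\<Sum>i<k. p i) = 1 \<and> x = (\<Sum>i<k. p i *\<^sub>R \<omega> i)}"
  have "convex C"
    unfolding convex_def
  proof (intro ballI allI impI)
    fix x y and u v :: real assume x: "x \<in> C" and y: "y \<in> C" and uv: "0 \<le> u" "0 \<le> v" "u + v = 1"
    obtain p where p: "\<forall>i<k. 0 \<le> p i" "(\<Sum>i<k. p i) = 1" "x = (\<Sum>i<k. p i *\<^sub>R \<omega> i)" using x by (auto simp: C_def)
    obtain p' where p': "\<forall>i<k. 0 \<le> p' i" "(\<Sum>i<k. p' i) = 1" "y = (\<Sum>i<k. p' i *\<^sub>R \<omega> i)" using y by (auto simp: C_def)
    show "u *\<^sub>R x + v *\<^sub>R y \<in> C" unfolding C_def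
    proof (intro CollectI exI[of _ "\<lambda>i. u * p i + v * p' i"] conjI allI impI)
      show "0 \<le> u * p i + v * p' i" if "i < k" for i using p(1) p'(1) uv that by auto
      show "(\<Sum>i<k. u * p i + v * p' i) = 1"
        using p(2) p'(2) uv(3) by (simp add: sum.distrib flip: sum_distrib_left)
      show "u *\<^sub>R x + v *\<^sub>R y = (\<Sum>i<k. (u * p i + v * p' i) *\<^sub>R \<omega> i)"
        by (simp add: p(3) p'(3) scaleR_sum_right scaleR_add_left sum.distrib)
    qed
  qed
  moreover have "\<omega> ` {..<k} \<subseteq> C"
  proof
    fix x assume "x \<in> \<omega> ` {..<k}"
    then obtain j where j: "j < k" "x = \<omega> j" by auto
    have "(\<Sum>i<k. (if i = j then 1 else 0) *\<^sub>R \<omega> i) = (\<Sum>i<k. if i = j then \<omega> i else 0)"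
      by (intro sum.cong) auto
    then show "x \<in> C" unfolding C_def using j
      by (intro CollectI exI[of _ "\<lambda>i. if i = j then 1 else 0"]) auto
  qed
  ultimately have "convex hull (\<omega> ` {..<k}) \<subseteq> C" by (rule hull_minimal[rotated])
  then show ?thesis using assms that by (auto simp: C_def)
qed

section \<open>Short near-minimizers\<close>

locale gp_instance = positive_weights k q for k :: nat and q :: "nat \<Rightarrow> real" +
  fixes \<omega> :: "nat \<Rightarrow> 'a::real_inner" and \<theta> :: 'a
  assumes theta: "\<theta> \<in> convex hull (\<omega> ` {..<k})"
begin

abbreviation F :: "'a \<Rightarrow> real" where "F \<equiv> gp_fun k \<omega> q \<theta>"

definition Fsum :: "'a \<Rightarrow> real" where "Fsum x = (\<Sum>i<k. q i * exp (inner (\<omega> i - \<theta>) x))"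

lemma F_eq: "F x = ln (Fsum x)"
  by (simp add: gp_fun_def Fsum_def)

lemma Fsum_pos: "0 < Fsum x"
  unfolding Fsum_def using k_pos q_pos by (intro sum_pos) auto

lemma Fsum_0: "Fsum 0 = l1_norm k q"
  by (simp add: Fsum_def l1_norm_eq)

lemma term_le_Fsum: "i < k \<Longrightarrow> q i * exp (inner (\<omega> i - \<theta>) x) \<le> Fsum x"
  unfolding Fsum_def by (rule member_le_sum) (auto intro!: less_imp_le mult_pos_pos q_pos)

text \<open>The weights of \<theta> make a convex combination of these inner products vanish.
  Through \<open>qmin_le_Fsum\<close> this bounds F from below by ln \<open>qmin\<close>.\<close>

lemma exists_nonneg_direction:
  obtains i where "i < k" "0 \<le> inner (\<omega> i - \<theta>) x"
proof -
  obtain p where p: "\<And>i. i < k \<Longrightarrow> 0 \<le> p i" "(\<Sum>i<k. p i) = 1" "\<theta> = (\<Sum>i<k. p i *\<^sub>R \<omega> i)"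
    using convex_hull_weights[OF theta] by blast
  have "(\<Sum>i<k. p i * inner (\<omega> i - \<theta>) x) = inner (\<Sum>i<k. p i *\<^sub>R \<omega> i) x - (\<Sum>i<k. p i) * inner \<theta> x"
    by (simp add: inner_diff_left right_diff_distrib sum_subtractf inner_sum_left sum_distrib_right)
  then have s: "(\<Sum>i<k. p i * inner (\<omega> i - \<theta>) x) = 0" using p(2,3) by simp
  have "\<exists>i<k. 0 \<le> inner (\<omega> i - \<theta>) x"
  proof (rule ccontr)
    assume "\<not> (\<exists>i<k. 0 \<le> inner (\<omega> i - \<theta>) x)"
    then have neg: "inner (\<omega> i - \<theta>) x < 0" if "i < k" for i using that by (auto simp: not_le)
    have "\<exists>i<k. p i \<noteq> 0"
    proof (rule ccontr)
      assume "\<not> (\<exists>i<k. p i \<noteq> 0)"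
      then show False using p(2) by simp
    qed
    then obtain i where i: "i < k" "p i \<noteq> 0" by blast
    have "0 < (\<Sum>i<k. - (p i * inner (\<omega> i - \<theta>) x))"
    proof (rule sum_pos2[of _ i])
      show "0 < - (p i * inner (\<omega> i - \<theta>) x)"
        using i p(1)[OF i(1)] neg[OF i(1)] by (simp add: mult_pos_neg)
      show "0 \<le> - (p j * inner (\<omega> j - \<theta>) x)" if "j \<in> {..<k}" for j
        using that p(1)[of j] neg[of j] by (simp add: mult_nonneg_nonpos)
    qed (use i in auto)
    then show False using s by (simp add: sum_negf)
  qed
  then show ?thesis using that by blast
qed

lemma qmin_le_Fsum: "qmin \<le> Fsum x"
proof -
  obtain i where i: "i < k" "0 \<le> inner (\<omega> i - \<theta>) x" by (rule exists_nonneg_direction)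
  have "qmin * 1 \<le> q i * exp (inner (\<omega> i - \<theta>) x)"
    using qmin_le[OF i(1)] i(2) qmin_pos by (intro mult_mono) auto
  then show ?thesis using term_le_Fsum[OF i(1), of x] by simp
qed

end

locale tu_instance = gp_instance k q \<omega> \<theta>
  for k :: nat and q :: "nat \<Rightarrow> real" and \<omega> :: "nat \<Rightarrow> nat \<Rightarrow>\<^sub>0 real" and \<theta> :: "nat \<Rightarrow>\<^sub>0 real" +
  fixes n :: nat
  assumes n_pos: "1 \<le> n"
    and omega_int: "\<And>i. i < k \<Longrightarrow> \<omega> i \<in> int_coord_space n"
    and tu: "totally_unimodular (column_matrix n k \<omega>)"
begin

lemma omega_in: "i < k \<Longrightarrow> \<omega> i \<in> coord_space n"
  using omega_int by (simp add: int_coord_space_def)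

lemma theta_in: "\<theta> \<in> coord_space n"
proof -
  have "convex hull (\<omega> ` {..<k}) \<subseteq> coord_space n"
    using omega_in by (intro hull_minimal subspace_imp_convex subspace_coord_space) auto
  then show ?thesis using theta by blast
qed

lemma W_subset: "span_W k \<omega> \<theta> \<subseteq> coord_space n"
  unfolding span_W_def
  using omega_in theta_in subspace_diff[OF subspace_coord_space]
  by (intro span_minimal subspace_coord_space) auto

text \<open>
  Truncation at \<open>ln (2 \<beta> / \<delta>)\<close> costs at most \<open>\<delta> / 2\<close> because the sum contains the term of the
  maximizing index \<open>m\<close>, whose gap is \<open>0\<close>.
\<close>

lemma diameter_bound:
  assumes x: "x \<in> coord_space n" and \<delta>: "0 < \<delta>" "\<delta> < 1"
  obtains y where "y \<in> span_W k \<omega> \<theta>"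
    "norm y \<le> sqrt (real n) * (real n * (real n * ln (2 * gp_beta k q / \<delta>)))"
    "Fsum y \<le> (1 + \<delta> / 2) * Fsum x"
proof -
  define L where "L = ln (2 * gp_beta k q / \<delta>)"
  have pos: "0 < 2 * gp_beta k q / \<delta>" using beta_ge_1 \<delta> by simp
  have "1 \<le> 2 * gp_beta k q / \<delta>" using beta_ge_1 \<delta> by (simp add: pos_le_divide_eq)
  then have L0: "0 \<le> L" by (simp add: L_def)
  obtain m where m: "m < k" "\<And>i. i < k \<Longrightarrow> inner (\<omega> i) x \<le> inner (\<omega> m) x"
  proof -
    have "Max ((\<lambda>i. inner (\<omega> i) x) ` {..<k}) \<in> (\<lambda>i. inner (\<omega> i) x) ` {..<k}"
      by (rule Max_in) (use k_pos in auto)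
    then obtain m where m: "m < k" "Max ((\<lambda>i. inner (\<omega> i) x) ` {..<k}) = inner (\<omega> m) x" by auto
    have "inner (\<omega> i) x \<le> inner (\<omega> m) x" if "i < k" for i
      unfolding m(2)[symmetric] by (rule Max_ge) (use that in auto)
    then show ?thesis using that m(1) by blast
  qed
  obtain p where p: "\<And>i. i < k \<Longrightarrow> 0 \<le> p i" "(\<Sum>i<k. p i) = 1" "\<theta> = (\<Sum>i<k. p i *\<^sub>R \<omega> i)"
    using convex_hull_weights[OF theta] by blast
  \<comment> \<open>Weighted by the coefficients of \<theta>, the gaps add up to the objective, so
    the linear program has nonnegative costs and \<open>basic_solution_bounded\<close>
    applies.\<close>
  have T: "(\<Sum>i<k. p i * inner (\<omega> m - \<omega> i) v) = inner (\<omega> m - \<theta>) v" for v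
  proof -
    have "(\<Sum>i<k. p i * inner (\<omega> m - \<omega> i) v) = (\<Sum>i<k. p i) * inner (\<omega> m) v - inner (\<Sum>i<k. p i *\<^sub>R \<omega> i) v"
      by (simp add: inner_diff_left right_diff_distrib sum_subtractf inner_sum_left sum_distrib_right)
    then show ?thesis using p(2,3) by (simp add: inner_diff_left)
  qed
  have gap: "0 \<le> min (inner (\<omega> m - \<omega> i) x) L" if "i < k" for i
    using m(2)[OF that] L0 by (simp add: inner_diff_left)
  have "\<exists>y\<in>coord_space n. (\<forall>i<k. min (inner (\<omega> m - \<omega> i) x) L \<le> inner (\<omega> m - \<omega> i) y) \<and>
    (\<Sum>i<k. p i * inner (\<omega> m - \<omega> i) y) \<le> (\<Sum>i<k. p i * inner (\<omega> m - \<omega> i) x) \<and>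
    norm y \<le> sqrt (real n) * (real n * (real n * L))"
    by (rule basic_solution_bounded[of k \<omega> n m L x p]) (use omega_int tu m(1) L0 x gap p(1) in blast)+
  then obtain y where y: "y \<in> coord_space n" "\<And>i. i < k \<Longrightarrow> min (inner (\<omega> m - \<omega> i) x) L \<le> inner (\<omega> m - \<omega> i) y"
    "(\<Sum>i<k. p i * inner (\<omega> m - \<omega> i) y) \<le> (\<Sum>i<k. p i * inner (\<omega> m - \<omega> i) x)"
    "norm y \<le> sqrt (real n) * (real n * (real n * L))"
    by blast
  \<comment> \<open>Projection onto W leaves the inner products with \<omega> i - \<theta>
    unchanged, hence also F, and does not lengthen y.\<close>
  obtain z where z: "z \<in> span_W k \<omega> \<theta>" "\<And>b. b \<in> span_W k \<omega> \<theta> \<Longrightarrow> inner (y - z) b = 0"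
    using orthogonal_projection_exists[of "(\<lambda>i. \<omega> i - \<theta>) ` {..<k}" y] unfolding span_W_def by blast
  have nz: "norm z \<le> norm y" by (rule norm_projection_le) (rule z(2)[OF z(1)])
  have az: "inner (\<omega> i - \<theta>) z = inner (\<omega> i - \<theta>) y" if "i < k" for i
  proof -
    have "\<omega> i - \<theta> \<in> span_W k \<omega> \<theta>" unfolding span_W_def using that by (intro span_base) auto
    from z(2)[OF this] show ?thesis by (simp add: inner_diff_left inner_commute)
  qed
  have "exp (- L) = 1 / (2 * gp_beta k q / \<delta>)"
    using pos by (simp add: L_def exp_minus inverse_eq_divide)
  \<comment> \<open>The truncation level is chosen for this identity: all truncated terms together
    weigh at most \<delta> / 2 times the smallest coefficient.\<close>
  then have eL: "l1_norm k q * exp (- L) = qmin * (\<delta> / 2)"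
    using l1_norm_pos qmin_pos \<delta> by (simp add: beta_eq field_simps)
  have "Fsum z \<le> (\<Sum>i<k. exp (inner (\<omega> m - \<theta>) x) * (q i * exp (- inner (\<omega> m - \<omega> i) x) + q i * exp (- L)))"
    unfolding Fsum_def
  proof (rule sum_mono)
    fix i assume "i \<in> {..<k}"
    then have i: "i < k" by simp
    have "inner (\<omega> i - \<theta>) z = inner (\<omega> m - \<theta>) y - inner (\<omega> m - \<omega> i) y"
      unfolding az[OF i] by (simp add: inner_diff_left)
    also have "\<dots> \<le> inner (\<omega> m - \<theta>) x - min (inner (\<omega> m - \<omega> i) x) L"
      using y(2)[OF i] y(3) unfolding T by linarith
    finally have "exp (inner (\<omega> i - \<theta>) z) \<le> exp (inner (\<omega> m - \<theta>) x + - min (inner (\<omega> m - \<omega> i) x) L)" by simp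
    also have "\<dots> = exp (inner (\<omega> m - \<theta>) x) * exp (- min (inner (\<omega> m - \<omega> i) x) L)" by (rule exp_add)
    also have "\<dots> \<le> exp (inner (\<omega> m - \<theta>) x) * (exp (- inner (\<omega> m - \<omega> i) x) + exp (- L))"
      by (intro mult_left_mono) (auto simp: min_def add_increasing add_increasing2)
    finally have "q i * exp (inner (\<omega> i - \<theta>) z) \<le> q i * (exp (inner (\<omega> m - \<theta>) x) * (exp (- inner (\<omega> m - \<omega> i) x) + exp (- L)))"
      using q_pos[OF i] by (intro mult_left_mono) auto
    then show "q i * exp (inner (\<omega> i - \<theta>) z) \<le> exp (inner (\<omega> m - \<theta>) x) * (q i * exp (- inner (\<omega> m - \<omega> i) x) + q i * exp (- L))"
      by (simp add: algebra_simps)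
  qed
  also have "\<dots> = (\<Sum>i<k. q i * (exp (inner (\<omega> m - \<theta>) x) * exp (- inner (\<omega> m - \<omega> i) x))) + exp (inner (\<omega> m - \<theta>) x) * (l1_norm k q * exp (- L))"
    by (simp add: l1_norm_eq distrib_left sum.distrib sum_distrib_left sum_distrib_right mult_ac)
  also have "(\<Sum>i<k. q i * (exp (inner (\<omega> m - \<theta>) x) * exp (- inner (\<omega> m - \<omega> i) x))) = Fsum x"
    by (simp add: Fsum_def exp_add[symmetric] inner_diff_left)
  also have "exp (inner (\<omega> m - \<theta>) x) * (l1_norm k q * exp (- L)) \<le> \<delta> / 2 * Fsum x"
  proof -
    have "exp (inner (\<omega> m - \<theta>) x) * (l1_norm k q * exp (- L)) = \<delta> / 2 * (qmin * exp (inner (\<omega> m - \<theta>) x))"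
      unfolding eL by simp
    also have "\<dots> \<le> \<delta> / 2 * (q m * exp (inner (\<omega> m - \<theta>) x))"
      using qmin_le[OF m(1)] \<delta> by (intro mult_left_mono mult_right_mono) auto
    also have "\<dots> \<le> \<delta> / 2 * Fsum x"
      using term_le_Fsum[OF m(1), of x] \<delta> by (intro mult_left_mono) auto
    finally show ?thesis .
  qed
  finally have "Fsum z \<le> (1 + \<delta> / 2) * Fsum x" by (simp add: distrib_right)
  then show ?thesis using that[OF z(1)] nz y(4) by (simp add: L_def)
qed

lemma entry_bound:
  assumes "i < k" "l < n"
  shows "\<bar>Poly_Mapping.lookup (\<omega> i) l\<bar> \<le> 1"
  using totally_unimodular_det_le_1[OF tu, of 1 "\<lambda>_. l" "\<lambda>_. i"] assms
  by (simp add: column_matrix_def Determinant.det_single)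

lemma norm_omega_le: "i < k \<Longrightarrow> norm (\<omega> i) \<le> sqrt (real n)"
  using norm_coord_space_le[OF omega_in, of i 1] entry_bound by simp

lemma norm_a_le:
  assumes "i < k" shows "norm (\<omega> i - \<theta>) \<le> 2 * sqrt (real n)"
proof -
  have "convex hull (\<omega> ` {..<k}) \<subseteq> cball 0 (sqrt (real n))"
    using norm_omega_le by (intro hull_minimal convex_cball) auto
  then have "norm \<theta> \<le> sqrt (real n)" using theta by auto
  then show ?thesis using norm_omega_le[OF assms] norm_triangle_ineq4[of "\<omega> i" \<theta>] by linarith
qed

lemma diff_eq_0_if_k_1: "k = 1 \<Longrightarrow> i < k \<Longrightarrow> \<omega> i - \<theta> = 0"
  using theta by (auto simp: lessThan_Suc)

end

section \<open>Step counts\<close>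

text \<open>Along the line, the second derivative of the logarithm is the variance of
  \<open>y\<close> under the tilted weights, which is at most the second moment and hence at most
  M^2.\<close>

lemma log_sum_exp_descent:
  fixes c y :: "nat \<Rightarrow> real"
  assumes k: "0 < k" and c: "\<And>i. i < k \<Longrightarrow> 0 < c i" and M: "\<And>i. i < k \<Longrightarrow> \<bar>y i\<bar> \<le> M"
  shows "ln (\<Sum>i<k. c i * exp (y i)) \<le> ln (\<Sum>i<k. c i) + (\<Sum>i<k. c i * y i) / (\<Sum>i<k. c i) + M\<^sup>2 / 2"
proof -
  define A where "A s = (\<Sum>i<k. c i * exp (s * y i))" for s
  define B where "B s = (\<Sum>i<k. c i * exp (s * y i) * y i)" for s
  define C where "C s = (\<Sum>i<k. c i * exp (s * y i) * (y i)\<^sup>2)" for s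
  have A: "0 < A s" for s unfolding A_def using k c by (intro sum_pos) auto
  have dA: "(A has_real_derivative B s) (at s)" for s
    unfolding A_def B_def by (rule DERIV_cong, rule DERIV_sum, (rule derivative_eq_intros refl)+) (simp add: mult_ac)
  have dB: "(B has_real_derivative C s) (at s)" for s
    unfolding B_def C_def by (rule DERIV_cong, rule DERIV_sum, (rule derivative_eq_intros refl)+) (simp add: power2_eq_square mult_ac)
  have CA: "C s \<le> M\<^sup>2 * A s" for s
    unfolding C_def A_def sum_distrib_left
  proof (rule sum_mono)
    fix i assume "i \<in> {..<k}"
    then have i: "i < k" by simp
    have "\<bar>y i\<bar>\<^sup>2 \<le> M\<^sup>2" using M[OF i] by (intro power_mono) auto
    then show "c i * exp (s * y i) * (y i)\<^sup>2 \<le> M\<^sup>2 * (c i * exp (s * y i))"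
      using c[OF i] by (simp add: mult.commute mult_left_mono)
  qed
  have dBA: "((\<lambda>s. B s / A s) has_real_derivative (C s * A s - B s * B s) / (A s * A s)) (at s)" for s
    by (rule DERIV_divide[OF dB dA]) (use A[of s] in simp)
  have slope: "B s / A s \<le> B 0 / A 0 + M\<^sup>2 * s" if s: "0 \<le> s" for s
  proof -
    have "B s / A s - M\<^sup>2 * s \<le> B 0 / A 0 - M\<^sup>2 * 0"
    proof (rule DERIV_nonpos_imp_nonincreasing[OF s, where f = "\<lambda>s. B s / A s - M\<^sup>2 * s"])
      fix x
      have "(C x * A x - B x * B x) / (A x * A x) \<le> C x * A x / (A x * A x)"
        by (intro divide_right_mono) auto
      also have "\<dots> \<le> M\<^sup>2" using CA[of x] A[of x] by (simp add: pos_divide_le_eq)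
      finally have "(C x * A x - B x * B x) / (A x * A x) - M\<^sup>2 \<le> 0" by simp
      moreover have "((\<lambda>s. B s / A s - M\<^sup>2 * s) has_real_derivative (C x * A x - B x * B x) / (A x * A x) - M\<^sup>2) (at x)"
        by (rule DERIV_cong[OF DERIV_diff[OF dBA DERIV_cmult[OF DERIV_ident]]]) simp
      ultimately show "\<exists>d. ((\<lambda>s. B s / A s - M\<^sup>2 * s) has_real_derivative d) (at x) \<and> d \<le> 0" by blast
    qed
    then show ?thesis by simp
  qed
  have dln: "((\<lambda>s. ln (A s)) has_real_derivative B s / A s) (at s)" for s
    by (rule DERIV_cong[OF DERIV_chain2[OF DERIV_ln_divide[OF A] dA]]) simp
  have "ln (A 1) - (B 0 / A 0 * 1 + M\<^sup>2 / 2 * 1\<^sup>2) \<le> ln (A 0) - (B 0 / A 0 * 0 + M\<^sup>2 / 2 * 0\<^sup>2)"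
  proof (rule DERIV_nonpos_imp_nonincreasing[of 0 1 "\<lambda>s. ln (A s) - (B 0 / A 0 * s + M\<^sup>2 / 2 * s\<^sup>2)"])
    fix x :: real assume x: "0 \<le> x"
    have "((\<lambda>s. ln (A s) - (B 0 / A 0 * s + M\<^sup>2 / 2 * s\<^sup>2)) has_real_derivative B x / A x - (B 0 / A 0 + M\<^sup>2 * x)) (at x)"
      by (rule DERIV_cong[OF DERIV_diff[OF dln DERIV_add[OF DERIV_cmult[OF DERIV_ident] DERIV_cmult[OF DERIV_power[OF DERIV_ident]]]]]) simp
    then show "\<exists>d. ((\<lambda>s. ln (A s) - (B 0 / A 0 * s + M\<^sup>2 / 2 * s\<^sup>2)) has_real_derivative d) (at x) \<and> d \<le> 0"
      using slope[OF x] by (intro exI conjI) auto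
  qed simp
  then show ?thesis by (simp add: A_def B_def)
qed

lemma ln_mono_real: "0 < x \<Longrightarrow> x \<le> y \<Longrightarrow> ln x \<le> ln y" for x y :: real
  by simp

lemma ln_le_of_le_two_power:
  fixes x :: real
  assumes "0 < x" "x \<le> 2 ^ m"
  shows "ln x \<le> real m"
proof -
  have "(2::real) \<le> exp 1" using exp_ge_add_one_self[of 1] by simp
  then have "2 ^ m \<le> exp (1::real) ^ m" by (rule power_mono) simp
  also have "\<dots> = exp (real m)" by (simp add: exp_of_nat_mult[symmetric])
  finally have "x \<le> exp (real m)" using assms(2) by simp
  from ln_mono_real[OF assms(1) this] show ?thesis by simp
qed

text \<open>
  \<open>m\<close> will be the dimension \<open>n\<close>, except for \<open>k = 1\<close>, where the claimed bounds do not grow with \<open>n\<close>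
  for \<open>\<delta>\<close> close to \<open>1\<close>, and \<open>m = 1\<close>.
\<close>

lemma step_count_bound:
  fixes \<beta> \<delta> m NR :: real and k :: nat
  assumes k: "0 < k" and \<beta>: "1 \<le> \<beta>" and \<delta>: "0 < \<delta>" "\<delta> < 1" and m: "1 \<le> m"
    and NR: "0 \<le> NR" "NR \<le> 2 * m ^ 3 * ln (4 * \<beta> / \<delta>)"
  defines "\<nu> \<equiv> 2 * real k + 3" and "\<Lambda> \<equiv> ln (5 * real k * \<beta>)"
    and "Y \<equiv> real k * m * (1 + ln \<beta>) / \<delta>"
  shows "3 + 8 * sqrt \<nu> * ln (18 * (6 * real k + 2 + 2 * real k * NR + (real k + 3) * \<Lambda>))
      + 10 * sqrt \<nu> * ln (72 / 5 * \<nu> * \<Lambda> / \<delta>) \<le> 500 * sqrt (real k) * (1 + ln Y)"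
proof -
  define B where "B = 1 + ln \<beta>"
  define K where "K = real k"
  define d where "d = 1 / \<delta>"
  have K: "1 \<le> K" using k by (simp add: K_def)
  have B: "1 \<le> B" using \<beta> by (simp add: B_def)
  have d: "1 \<le> d" using \<delta> by (simp add: d_def)
  have Y: "Y = K * m * B * d" by (simp add: Y_def K_def B_def d_def)
  have ge1: "1 \<le> x * y" if "1 \<le> x" "1 \<le> y" for x y :: real
    using mult_mono[of 1 x 1 y] that by simp
  have Y1: "1 \<le> Y" unfolding Y by (intro ge1 K m B d)
  have ln5: "ln 5 \<le> (2::real)"
  proof -
    have "(5/2::real) \<le> exp 1" using exp_lower_Taylor_quadratic[of 1] by simp
    then have "(5/2) * (5/2) \<le> exp 1 * exp (1::real)" by (intro mult_mono) auto
    then have "5 \<le> exp (2::real)" by (simp add: exp_add[symmetric])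
    from ln_mono_real[OF _ this] show ?thesis by simp
  qed
  have ln4: "ln 4 \<le> (2::real)" using ln_le_of_le_two_power[of 4 2] by simp
  have \<Lambda>: "\<Lambda> \<le> 3 * (K * B)"
  proof -
    have "\<Lambda> = ln 5 + ln K + ln \<beta>" using K \<beta> by (simp add: \<Lambda>_def K_def ln_mult_pos)
    also have "\<dots> \<le> 2 + (K - 1) + (B - 1)"
      using ln5 ln_le_minus_one[of K] K by (simp add: B_def)
    also have "\<dots> \<le> K * B + K * B" using mult_left_mono[of 1 B K] mult_right_mono[of 1 K B] K B by linarith
    also have "\<dots> \<le> 3 * (K * B)" using K B by simp
    finally show ?thesis .
  qed
  have \<Lambda>1: "1 \<le> \<Lambda>"
  proof -
    have "exp 1 \<le> (3::real)" by (rule exp_le)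
    also have "\<dots> \<le> 5 * K * \<beta>" using ge1[OF K \<beta>] by simp
    finally have "exp 1 \<le> 5 * K * \<beta>" .
    then show ?thesis unfolding \<Lambda>_def K_def[symmetric] using ge1[OF K \<beta>] by (subst ln_ge_iff) auto
  qed
  have lnd: "ln (4 * \<beta> / \<delta>) \<le> 3 * (B * d)"
  proof -
    have "ln (4 * \<beta> / \<delta>) = ln 4 + ln \<beta> + ln d" using \<beta> \<delta> by (simp add: d_def ln_div ln_mult_pos)
    also have "\<dots> \<le> 2 + (B - 1) + (d - 1)" using ln4 ln_le_minus_one[of d] d by (simp add: B_def)
    also have "\<dots> \<le> B * d + B * d" using mult_left_mono[of 1 d B] mult_right_mono[of 1 B d] B d by linarith
    also have "\<dots> \<le> 3 * (B * d)" using B d by simp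
    finally show ?thesis .
  qed
  have pow: "1 \<le> m ^ 3" using m by simp
  have Y3: "K ^ 2 * m ^ 3 * B * d \<le> Y ^ 3"
  proof -
    have "K ^ 2 * m ^ 3 * B * d \<le> K ^ 3 * m ^ 3 * B ^ 3 * d ^ 3"
      using K m B d power_increasing[of 2 3 K] power_increasing[of 1 3 B] power_increasing[of 1 3 d]
      by (intro mult_mono mult_nonneg_nonneg) auto
    then show ?thesis by (simp add: Y power_mult_distrib)
  qed
  have Y2: "K ^ 2 * B * d \<le> Y ^ 2"
  proof -
    have "K ^ 2 * 1 * B * d \<le> K ^ 2 * m ^ 2 * B ^ 2 * d ^ 2"
      using K m B d power_increasing[of 1 2 B] power_increasing[of 1 2 d]
      by (intro mult_mono mult_nonneg_nonneg) auto
    then show ?thesis by (simp add: Y power_mult_distrib)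
  qed
  define G where "G = 6 * K + 2 + 2 * K * NR + (K + 3) * \<Lambda>"
  have G0: "0 < G" using K NR(1) \<Lambda>1 by (simp add: G_def add_pos_nonneg)
  have "G \<le> 32 * (K ^ 2 * m ^ 3 * B * d)"
  proof -
    have t: "K \<le> K ^ 2 * m ^ 3 * B * d" "1 \<le> K ^ 2 * m ^ 3 * B * d"
      using mult_mono[of K "K ^ 2" 1 "m ^ 3 * B * d"] K pow B d ge1 by (auto simp: power2_eq_square mult.assoc intro!: ge1)
    have "K * NR \<le> K * (2 * m ^ 3 * (3 * (B * d)))"
      using NR(2) lnd K m by (intro mult_left_mono order_trans[OF NR(2)]) auto
    also have "\<dots> = 6 * (K * (m ^ 3 * B * d))" by simp
    also have "\<dots> \<le> 6 * (K ^ 2 * (m ^ 3 * B * d))"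
      using K m pow B d by (intro mult_left_mono mult_right_mono mult_nonneg_nonneg) (auto simp: power2_eq_square)
    finally have u: "K * NR \<le> 6 * (K ^ 2 * m ^ 3 * B * d)" by (simp add: mult.assoc)
    have "(K + 3) * \<Lambda> \<le> (4 * K) * (3 * (K * B))" using K \<Lambda> \<Lambda>1 by (intro mult_mono) auto
    also have "\<dots> = 12 * (K ^ 2 * 1 * B * 1)" by (simp add: power2_eq_square)
    also have "\<dots> \<le> 12 * (K ^ 2 * m ^ 3 * B * d)"
      using K m pow B d by (intro mult_left_mono mult_mono mult_nonneg_nonneg) auto
    finally have v: "(K + 3) * \<Lambda> \<le> 12 * (K ^ 2 * m ^ 3 * B * d)" .
    have "2 * K * NR = 2 * (K * NR)" by simp
    then show ?thesis unfolding G_def using t u v by linarith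
  qed
  \<comment> \<open>18 * 32 = 576 is rounded up to a power of 2 for
    \<open>ln_le_of_le_two_power\<close>; likewise 216 to 256 further down.\<close>
  then have "18 * G \<le> 1024 * Y ^ 3" using Y3 zero_le_power[of Y 3] Y1 by linarith
  then have "ln (18 * G) \<le> ln (1024 * Y ^ 3)" using G0 Y1 by simp
  also have "\<dots> = ln 1024 + 3 * ln Y" using Y1 by (simp add: ln_mult_pos ln_realpow)
  also have "ln 1024 \<le> (10::real)" using ln_le_of_le_two_power[of 1024 10] by simp
  finally have lnG: "ln (18 * G) \<le> 10 + 3 * ln Y" by simp
  have \<nu>: "5 \<le> \<nu>" "\<nu> \<le> 5 * K" using K by (auto simp: \<nu>_def K_def)
  have "72 / 5 * \<nu> * \<Lambda> / \<delta> \<le> 256 * Y ^ 2"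
  proof -
    have "72 / 5 * \<nu> * \<Lambda> / \<delta> = 72 / 5 * (\<nu> * \<Lambda> * d)" by (simp add: d_def)
    also have "\<dots> \<le> 72 / 5 * ((5 * K) * (3 * (K * B)) * d)"
      using \<nu> \<Lambda> \<Lambda>1 K B d by (intro mult_left_mono mult_right_mono mult_mono) auto
    also have "\<dots> = 216 * (K ^ 2 * B * d)" by (simp add: power2_eq_square)
    also have "\<dots> \<le> 256 * Y ^ 2" using Y2 zero_le_power2[of Y] by linarith
    finally show ?thesis .
  qed
  moreover have "0 < 72 / 5 * \<nu> * \<Lambda> / \<delta>" using \<nu> \<Lambda>1 \<delta> by simp
  ultimately have "ln (72 / 5 * \<nu> * \<Lambda> / \<delta>) \<le> ln (256 * Y ^ 2)" using Y1 by simp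
  also have "\<dots> = ln 256 + 2 * ln Y" using Y1 by (simp add: ln_mult_pos ln_realpow)
  also have "ln 256 \<le> (8::real)" using ln_le_of_le_two_power[of 256 8] by simp
  finally have lnT: "ln (72 / 5 * \<nu> * \<Lambda> / \<delta>) \<le> 8 + 2 * ln Y" by simp
  have lnY: "0 \<le> ln Y" using Y1 by simp
  have sK: "1 \<le> sqrt K" using K by simp
  have "sqrt \<nu> \<le> sqrt (9 * K)" using \<nu> K by simp
  also have "\<dots> = 3 * sqrt K" by (simp add: real_sqrt_mult)
  finally have s: "sqrt \<nu> \<le> 3 * sqrt K" .
  have s0: "0 \<le> sqrt \<nu>" using \<nu> by simp
  have "sqrt \<nu> * ln (18 * G) \<le> sqrt \<nu> * (10 + 3 * ln Y)" using lnG s0 by (rule mult_left_mono)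
  also have "\<dots> \<le> 3 * sqrt K * (10 + 3 * ln Y)" using s lnY by (intro mult_right_mono) auto
  finally have 1: "8 * (sqrt \<nu> * ln (18 * G)) \<le> 240 * sqrt K + 72 * (sqrt K * ln Y)" by (simp add: algebra_simps)
  have "sqrt \<nu> * ln (72 / 5 * \<nu> * \<Lambda> / \<delta>) \<le> sqrt \<nu> * (8 + 2 * ln Y)" using lnT s0 by (rule mult_left_mono)
  also have "\<dots> \<le> 3 * sqrt K * (8 + 2 * ln Y)" using s lnY by (intro mult_right_mono) auto
  finally have 2: "10 * (sqrt \<nu> * ln (72 / 5 * \<nu> * \<Lambda> / \<delta>)) \<le> 240 * sqrt K + 60 * (sqrt K * ln Y)" by (simp add: algebra_simps)
  have 3: "0 \<le> sqrt K * ln Y" using sK lnY by simp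
  \<comment> \<open>3 + 240 + 240 and 72 + 60 are both below 500.\<close>
  have "3 + 8 * (sqrt \<nu> * ln (18 * G)) + 10 * (sqrt \<nu> * ln (72 / 5 * \<nu> * \<Lambda> / \<delta>)) \<le> 500 * sqrt K + 500 * (sqrt K * ln Y)"
    using 1 2 3 sK by linarith
  then show "3 + 8 * sqrt \<nu> * ln (18 * (6 * real k + 2 + 2 * real k * NR + (real k + 3) * \<Lambda>))
      + 10 * sqrt \<nu> * ln (72 / 5 * \<nu> * \<Lambda> / \<delta>) \<le> 500 * sqrt (real k) * (1 + ln Y)"
    unfolding G_def K_def by (simp add: distrib_left mult.assoc)
qed

section \<open>Comparison with the claimed bounds\<close>

lemma size_parameter_ge_1:
  fixes \<beta> \<delta> m :: real
  assumes "0 < k" "1 \<le> \<beta>" "0 < \<delta>" "\<delta> < 1" "1 \<le> m"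
  shows "1 \<le> real k * m * (1 + ln \<beta>) / \<delta>"
proof -
  have "1 * 1 * 1 \<le> real k * m * (1 + ln \<beta>)"
    using assms ln_ge_zero[of \<beta>] by (intro mult_mono) auto
  then have "1 * \<delta> \<le> real k * m * (1 + ln \<beta>)" using assms(4) by linarith
  then show ?thesis unfolding pos_le_divide_eq[OF assms(3)] .
qed

lemma olog_bounds: "1 \<le> olog y" "ln y \<le> olog y"
  by (simp_all add: olog_def)

lemma ln_2_ge_half: "1 / 2 \<le> ln (2::real)"
proof -
  have "- ln (2::real) = ln (1 / 2)" by (simp add: ln_div)
  also have "\<dots> \<le> 1 / 2 - 1" by (rule ln_le_minus_one) simp
  finally show ?thesis by simp
qed

lemma one_le_ln_4: "1 \<le> ln (4::real)"
proof -
  have "ln (4::real) = 2 * ln 2" using ln_realpow[of 2 2] by simp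
  then show ?thesis using ln_2_ge_half by simp
qed

text \<open>For k = 1, \<beta> = 1 and the inner logarithm ln (1 / \<delta>) may be arbitrarily
  small; if it is at most 1, the floor 1 of \<open>olog\<close> suffices, otherwise it only enlarges
  the argument. For k \<ge> 2 the inner logarithm is at least ln 4 \<ge> 1 and at least ln
  \<beta>.\<close>

lemma olog_bound_value:
  fixes \<beta> \<delta> m n :: real and k :: nat
  assumes k: "0 < k" and \<beta>: "real k \<le> \<beta>" "k = 1 \<Longrightarrow> \<beta> = 1" and \<delta>: "0 < \<delta>" "\<delta> < 1" and n: "1 \<le> n"
    and m: "m = (if k = 1 then 1 else n)"
  shows "1 + ln (real k * m * (1 + ln \<beta>) / \<delta>) \<le> 4 * olog (real k * n * (1 / \<delta>) * ln (real k * \<beta> / \<delta>))"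
proof (cases "k = 1")
  case True
  have Y: "real k * m * (1 + ln \<beta>) / \<delta> = 1 / \<delta>" using True \<beta>(2) m by simp
  show ?thesis
  proof (cases "ln (1 / \<delta>) \<le> 1")
    case True
    then show ?thesis unfolding Y using olog_bounds(1)[of "real k * n * (1 / \<delta>) * ln (real k * \<beta> / \<delta>)"] by linarith
  next
    case False
    have "1 / \<delta> \<le> n * (1 / \<delta>) * ln (1 / \<delta>)"
      using mult_mono[of "1 / \<delta>" "n * (1 / \<delta>)" 1 "ln (1 / \<delta>)"] mult_right_mono[of 1 n "1 / \<delta>"] False \<delta> n by simp
    moreover have "0 < 1 / \<delta>" using \<delta> by simp
    ultimately have "ln (1 / \<delta>) \<le> ln (n * (1 / \<delta>) * ln (1 / \<delta>))" by (intro ln_mono_real)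
    also have "\<dots> \<le> olog (n * (1 / \<delta>) * ln (1 / \<delta>))" by (rule olog_bounds)
    finally show ?thesis unfolding Y
      using olog_bounds(1)[of "n * (1 / \<delta>) * ln (1 / \<delta>)"] \<open>k = 1\<close> \<beta>(2) by simp
  qed
next
  case False
  then have k2: "2 \<le> real k" using k by simp
  then have \<beta>2: "2 \<le> \<beta>" using \<beta>(1) by simp
  define y where "y = real k * n * (1 / \<delta>) * ln (real k * \<beta> / \<delta>)"
  have e: "real k * \<beta> / \<delta> \<ge> real k * \<beta>" using k2 \<beta>2 \<delta> by (simp add: pos_le_divide_eq)
  have "4 \<le> real k * \<beta>" using mult_mono[of 2 "real k" 2 \<beta>] k2 \<beta>2 by simp
  then have "ln 4 \<le> ln (real k * \<beta> / \<delta>)" using e by simp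
  then have l1: "1 \<le> ln (real k * \<beta> / \<delta>)" using one_le_ln_4 by simp
  have "\<beta> \<le> real k * \<beta>" using k2 \<beta>2 by simp
  from order_trans[OF this e] have "ln \<beta> \<le> ln (real k * \<beta> / \<delta>)" using \<beta>2 by (intro ln_mono_real) auto
  then have "1 + ln \<beta> \<le> 2 * ln (real k * \<beta> / \<delta>)" using l1 by simp
  then have "real k * n * (1 / \<delta>) * (1 + ln \<beta>) \<le> real k * n * (1 / \<delta>) * (2 * ln (real k * \<beta> / \<delta>))"
    using k2 n \<delta> by (intro mult_left_mono) auto
  also have "\<dots> = 2 * y" by (simp add: y_def)
  also have "real k * n * (1 / \<delta>) * (1 + ln \<beta>) = real k * m * (1 + ln \<beta>) / \<delta>" using False m by simp
  finally have "real k * m * (1 + ln \<beta>) / \<delta> \<le> 2 * y" .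
  moreover have "0 < real k * m * (1 + ln \<beta>) / \<delta>"
    using k2 n \<delta> \<beta>2 m ln_ge_zero[of \<beta>] by (auto intro!: divide_pos_pos mult_pos_pos add_pos_nonneg)
  ultimately have "ln (real k * m * (1 + ln \<beta>) / \<delta>) \<le> ln (2 * y)" by (subst ln_le_cancel_iff) auto
  also have "0 < y" unfolding y_def using k2 n \<delta> l1 by (intro mult_pos_pos) auto
  then have "ln (2 * y) = ln 2 + ln y" by (simp add: ln_mult_pos)
  finally have "ln (real k * m * (1 + ln \<beta>) / \<delta>) \<le> ln 2 + ln y" .
  moreover have "ln 2 \<le> (1::real)" using ln_le_minus_one[of 2] by simp
  ultimately show ?thesis using olog_bounds[of y] unfolding y_def by linarith
qed

text \<open>With L the size of the instance, k, m and 1 + ln \<beta> are at most 3 + L, and so is e,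
  which absorbs the summand 1. The exponent 8 is shared with the gradient bound.\<close>

lemma soft_bound_value:
  fixes \<beta> m n :: real and k :: nat
  assumes k: "0 < k" and \<beta>: "1 \<le> \<beta>" and \<delta>: "0 < \<delta>" and n: "1 \<le> n" and m: "1 \<le> m" "m \<le> n"
  shows "1 + ln (real k * m * (1 + ln \<beta>) / \<delta>) \<le> ln ((3 + (n + real k + ln \<beta>)) ^ 8 * (1 / \<delta>))"
proof -
  define L where "L = n + real k + ln \<beta>"
  have lnb: "0 \<le> ln \<beta>" using \<beta> by simp
  have L: "0 \<le> L" "real k \<le> 3 + L" "m \<le> 3 + L" "1 + ln \<beta> \<le> 3 + L" "3 \<le> 3 + L"
    using k n m lnb by (auto simp: L_def)
  have Y0: "0 < real k * m * (1 + ln \<beta>) / \<delta>"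
    using k m lnb \<delta> by (intro divide_pos_pos mult_pos_pos) auto
  have "3 * (real k * m * (1 + ln \<beta>)) \<le> (3 + L) * ((3 + L) * (3 + L) * (3 + L))"
    using L k m lnb by (intro mult_mono mult_nonneg_nonneg) auto
  also have "\<dots> = (3 + L) ^ 4" by (simp add: eval_nat_numeral)
  also have "\<dots> \<le> (3 + L) ^ 8" using L(1) by (intro power_increasing) auto
  finally have "3 * (real k * m * (1 + ln \<beta>)) * (1 / \<delta>) \<le> (3 + L) ^ 8 * (1 / \<delta>)"
    using \<delta> by (intro mult_right_mono) auto
  then have "3 * (real k * m * (1 + ln \<beta>) / \<delta>) \<le> (3 + L) ^ 8 * (1 / \<delta>)" by simp
  moreover have "exp 1 * (real k * m * (1 + ln \<beta>) / \<delta>) \<le> 3 * (real k * m * (1 + ln \<beta>) / \<delta>)"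
    using exp_le Y0 by (intro mult_right_mono) auto
  ultimately have "exp 1 * (real k * m * (1 + ln \<beta>) / \<delta>) \<le> (3 + L) ^ 8 * (1 / \<delta>)" by linarith
  then have "ln (exp 1 * (real k * m * (1 + ln \<beta>) / \<delta>)) \<le> ln ((3 + L) ^ 8 * (1 / \<delta>))"
    using Y0 by (intro ln_mono_real mult_pos_pos) auto
  then show ?thesis using Y0 by (simp add: ln_mult_pos L_def del: times_divide_eq_right)
qed

text \<open>1 / \<delta> is at most of order n / \<epsilon>^2, so for k \<ge> 2 the size parameter
  is at most 32 times the square of the argument of \<open>olog\<close>, and squaring only doubles
  the logarithm. For k = 1 the size parameter is 2.\<close>

lemma olog_bound_gradient:
  fixes \<beta> \<delta> \<epsilon> m n :: real and k :: nat
  assumes k: "0 < k" and \<beta>: "real k \<le> \<beta>" "k = 1 \<Longrightarrow> \<beta> = 1" and \<delta>: "0 < \<delta>" "1 / \<delta> \<le> 8 * n / \<epsilon>\<^sup>2" "k = 1 \<Longrightarrow> \<delta> = 1 / 2"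
    and n: "1 \<le> n" and m: "m = (if k = 1 then 1 else n)" and \<epsilon>: "0 < \<epsilon>" "\<epsilon> \<le> 2 * sqrt n"
  shows "1 + ln (real k * m * (1 + ln \<beta>) / \<delta>) \<le> 8 * olog (real k * n * (1 / \<epsilon>) * ln (real k * n * \<beta> / \<epsilon>))"
proof (cases "k = 1")
  case True
  then have "real k * m * (1 + ln \<beta>) / \<delta> = 2" unfolding \<delta>(3)[OF True] using \<beta>(2) m by simp
  moreover have "ln 2 \<le> (1::real)" using ln_le_minus_one[of 2] by simp
  ultimately show ?thesis using olog_bounds(1)[of "real k * n * (1 / \<epsilon>) * ln (real k * n * \<beta> / \<epsilon>)"] by simp
next
  case False
  then have k2: "2 \<le> real k" using k by simp
  then have \<beta>2: "2 \<le> \<beta>" using \<beta>(1) by simp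
  have mn: "m = n" using False m by simp
  define l where "l = ln (real k * n * \<beta> / \<epsilon>)"
  define y where "y = real k * n * (1 / \<epsilon>) * l"
  have "sqrt n * sqrt n = n" using n by simp
  moreover have "1 \<le> sqrt n" using n by simp
  ultimately have "sqrt n \<le> n" using mult_left_mono[of 1 "sqrt n" "sqrt n"] by simp
  then have "\<epsilon> \<le> real k * n" using \<epsilon>(2) mult_mono[of 2 "real k" "sqrt n" n] k2 n by simp
  then have kn: "1 \<le> real k * n / \<epsilon>" using \<epsilon>(1) by (simp add: pos_le_divide_eq)
  have "1 * \<beta> \<le> real k * n / \<epsilon> * \<beta>" using kn \<beta>2 by (intro mult_right_mono) auto
  then have b: "\<beta> \<le> real k * n * \<beta> / \<epsilon>" by simp
  then have lb: "ln \<beta> \<le> l" unfolding l_def using \<beta>2 by (subst ln_le_cancel_iff) auto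
  have "ln 2 \<le> ln \<beta>" using \<beta>2 by simp
  then have l2: "1 / 2 \<le> l" using lb ln_2_ge_half by linarith
  have y0: "0 < y" unfolding y_def using k2 n \<epsilon> l2 by (intro mult_pos_pos) auto
  have Y0: "0 < real k * m * (1 + ln \<beta>) / \<delta>"
    using k2 n \<delta>(1) \<beta>2 mn ln_ge_zero[of \<beta>] by (auto intro!: divide_pos_pos mult_pos_pos add_pos_nonneg)
  have "real k * m * (1 + ln \<beta>) / \<delta> = real k * n * (1 + ln \<beta>) * (1 / \<delta>)" by (simp add: mn)
  also have "\<dots> \<le> real k * n * (3 * l) * (8 * n / \<epsilon>\<^sup>2)"
    using \<delta> lb l2 k2 n \<beta>2 ln_ge_zero[of \<beta>] by (intro mult_mono mult_left_mono mult_nonneg_nonneg) auto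
  also have "\<dots> = 24 * (1 / \<epsilon>)\<^sup>2 * n\<^sup>2 * l * (real k * 1)" by (simp add: power2_eq_square)
  also have "\<dots> \<le> 24 * (1 / \<epsilon>)\<^sup>2 * n\<^sup>2 * l * (real k * (real k * l))"
  proof (intro mult_left_mono)
    show "1 \<le> real k * l" using mult_mono[of 2 "real k" "1 / 2" l] k2 l2 by simp
  qed (use l2 in auto)
  also have "\<dots> = 24 * y\<^sup>2" by (simp add: y_def power2_eq_square)
  also have "\<dots> \<le> 32 * y\<^sup>2" by simp
  finally have "ln (real k * m * (1 + ln \<beta>) / \<delta>) \<le> ln (32 * y\<^sup>2)" using Y0 y0 by (subst ln_le_cancel_iff) auto
  also have "\<dots> = ln 32 + 2 * ln y" using y0 by (simp add: ln_mult_pos ln_realpow)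
  also have "ln 32 \<le> (5::real)" using ln_le_of_le_two_power[of 32 5] by simp
  finally have "1 + ln (real k * m * (1 + ln \<beta>) / \<delta>) \<le> 6 + 2 * ln y" by simp
  then show ?thesis using olog_bounds[of y] unfolding y_def l_def by linarith
qed

text \<open>As 1 / \<delta> brings 1 / \<epsilon>^2, the bound is compared with a square. The
  constant 3 * 8 is below 3^4, which goes into four of the factors 3 + L.\<close>

lemma soft_bound_gradient:
  fixes \<beta> \<delta> \<epsilon> m n :: real and k :: nat
  assumes k: "0 < k" and \<beta>: "1 \<le> \<beta>" and \<delta>: "0 < \<delta>" "1 / \<delta> \<le> 8 * n / \<epsilon>\<^sup>2"
    and n: "1 \<le> n" and m: "1 \<le> m" "m \<le> n" and \<epsilon>: "0 < \<epsilon>"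
  shows "1 + ln (real k * m * (1 + ln \<beta>) / \<delta>) \<le> 2 * ln ((3 + (n + real k + ln \<beta>)) ^ 8 * (1 / \<epsilon>))"
proof -
  define L where "L = n + real k + ln \<beta>"
  have lnb: "0 \<le> ln \<beta>" using \<beta> by simp
  have L: "0 \<le> L" "real k \<le> 3 + L" "m \<le> 3 + L" "n \<le> 3 + L" "1 + ln \<beta> \<le> 3 + L" "3 \<le> 3 + L"
    using k n m lnb by (auto simp: L_def)
  have Y0: "0 < real k * m * (1 + ln \<beta>) / \<delta>"
    using k m lnb \<delta> by (intro divide_pos_pos mult_pos_pos) auto
  have c4: "c * c * c * (8 * c / \<epsilon>\<^sup>2) = 8 * c ^ 4 * (1 / \<epsilon>\<^sup>2)" for c
    by (simp add: eval_nat_numeral)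
  have "real k * m * (1 + ln \<beta>) * (1 / \<delta>) \<le> (3 + L) * (3 + L) * (3 + L) * (8 * (3 + L) / \<epsilon>\<^sup>2)"
    using L k m lnb \<delta> n by (intro mult_mono mult_nonneg_nonneg order_trans[OF \<delta>(2)] divide_right_mono) auto
  then have Y: "real k * m * (1 + ln \<beta>) / \<delta> \<le> 8 * (3 + L) ^ 4 * (1 / \<epsilon>\<^sup>2)"
    unfolding c4 by simp
  have "exp 1 * (real k * m * (1 + ln \<beta>) / \<delta>) \<le> 3 * (8 * (3 + L) ^ 4 * (1 / \<epsilon>\<^sup>2))"
    using exp_le Y Y0 by (intro mult_mono) auto
  also have "\<dots> \<le> 81 * (3 + L) ^ 4 * (1 / \<epsilon>\<^sup>2)" using L(1) \<epsilon> by (simp add: divide_right_mono)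
  also have "81 * (3 + L) ^ 4 \<le> (3 + L) ^ 4 * (3 + L) ^ 4"
    using power_mono[OF L(6), of 4] L(1) by (intro mult_right_mono) auto
  also have "\<dots> = (3 + L) ^ 8" by (simp flip: power_add)
  also have "\<dots> \<le> (3 + L) ^ 16" using L(1) by (intro power_increasing) auto
  finally have "exp 1 * (real k * m * (1 + ln \<beta>) / \<delta>) \<le> (3 + L) ^ 16 * (1 / \<epsilon>\<^sup>2)"
    using \<epsilon> by (simp add: divide_right_mono)
  also have "\<dots> = ((3 + L) ^ 8 * (1 / \<epsilon>))\<^sup>2" by (simp add: power_mult_distrib power_divide flip: power_mult)
  finally have "ln (exp 1 * (real k * m * (1 + ln \<beta>) / \<delta>)) \<le> ln (((3 + L) ^ 8 * (1 / \<epsilon>))\<^sup>2)"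
    using Y0 by (intro ln_mono_real mult_pos_pos) auto
  moreover have "0 < (3 + L) ^ 8 * (1 / \<epsilon>)" using L(1) \<epsilon> by simp
  ultimately show ?thesis using Y0 by (simp add: ln_mult_pos ln_realpow L_def del: times_divide_eq_right)
qed

section \<open>The algorithm\<close>

locale gp_ipm = gp_instance k q \<omega> \<theta> + gp_barrier k q \<omega> \<theta> R
  for k :: nat and q :: "nat \<Rightarrow> real" and \<omega> :: "nat \<Rightarrow> 'a::real_inner" and \<theta> :: 'a and R :: real
begin

sublocale sc: self_concordant_barrier E S "grad_on E \<Psi>" "hess_on E \<Psi>" "2 * real k + 3"
  by (rule self_concordant_barrier)

definition \<Lambda> :: real where "\<Lambda> = ln (5 * real k * gp_beta k q)"

lemma tau_minus_ln_qmin: "\<tau> - ln qmin = \<Lambda>"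
  using k_pos l1_norm_pos qmin_pos by (simp add: \<tau>_def \<Lambda>_def beta_eq ln_mult_pos ln_div)

lemma Fsum_le_exp_tc:
  assumes p: "p \<in> S"
  shows "Fsum (xc p) \<le> exp (tc p)"
proof -
  note P = in_S_D[OF p]
  have "Fsum (xc p) \<le> (\<Sum>i<k. zc p i * exp (tc p))"
    unfolding Fsum_def
  proof (rule sum_mono)
    fix i assume "i \<in> {..<k}"
    then have i: "i < k" by simp
    have "exp (ln (q i) + inner (\<omega> i - \<theta>) (xc p)) \<le> exp (ln (zc p i) + tc p)"
      using P(4)[OF i] by (simp add: w_def)
    then show "q i * exp (inner (\<omega> i - \<theta>) (xc p)) \<le> zc p i * exp (tc p)"
      using P(3)[OF i] q_pos[OF i] by (simp add: exp_add)
  qed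
  also have "\<dots> = zs p * exp (tc p)" by (simp add: zs_def sum_distrib_right)
  also have "\<dots> \<le> 1 * exp (tc p)" using P(6) by (intro mult_right_mono) auto
  finally show ?thesis by simp
qed

text \<open>The constraints state only an upper bound for t; the lower one follows from t \<ge> F
  \<ge> ln \<open>qmin\<close>. So t ranges over an interval of length \<Lambda>.\<close>

lemma ln_qmin_le_tc: "p \<in> S \<Longrightarrow> ln qmin \<le> tc p"
  using order_trans[OF qmin_le_Fsum Fsum_le_exp_tc] qmin_pos ln_mono_real[of qmin "exp (tc p)"] by simp

lemma unit_ball_bounds:
  assumes p: "p \<in> S" and v: "v \<in> E" and less: "sc.nrm p v < 1"
  shows "\<bar>tc v\<bar> \<le> \<Lambda> / 2" "norm (xc v) \<le> R" "(\<Sum>i<k. \<bar>zc v i\<bar>) \<le> 1"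
proof -
  have "sc.nrm p (- v) < 1" using less sc.nrm_scale[OF p, of "-1" v] by simp
  moreover have "- v \<in> E" using v by (rule subspace_neg[OF subspace_E])
  ultimately have m: "p + - v \<in> S" by (intro sc.dikin p) (auto simp: sc.nrm_def)
  then have m': "p - v \<in> S" by simp
  have a: "p + v \<in> S" using less by (intro sc.dikin p v) (simp add: sc.nrm_def)
  note P = in_S_D[OF p] and A = in_S_D[OF a] and M = in_S_D[OF m']
  show "\<bar>tc v\<bar> \<le> \<Lambda> / 2"
    using A(5) M(5) ln_qmin_le_tc[OF a] ln_qmin_le_tc[OF m'] tau_minus_ln_qmin by simp
  have "norm (xc (p + v)) < R" "norm (xc (p - v)) < R" using A(7) M(7) by (simp_all add: Q_pos_iff)
  moreover have "norm (2 *\<^sub>R xc v) = norm (xc (p + v) - xc (p - v))" by (simp add: scaleR_2)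
  moreover have "norm (xc (p + v) - xc (p - v)) \<le> norm (xc (p + v)) + norm (xc (p - v))" by (rule norm_triangle_ineq4)
  ultimately show "norm (xc v) \<le> R" by simp
  have "(\<Sum>i<k. \<bar>zc v i\<bar>) \<le> (\<Sum>i<k. zc p i)"
  proof (rule sum_mono)
    fix i assume "i \<in> {..<k}"
    then show "\<bar>zc v i\<bar> \<le> zc p i" using A(3)[of i] M(3)[of i] by simp
  qed
  then show "(\<Sum>i<k. \<bar>zc v i\<bar>) \<le> 1" using P(6) by (simp add: zs_def)
qed

lemma Lambda_pos: "0 < \<Lambda>"
  unfolding \<Lambda>_def using beta_ge_1 k_pos mult_mono[of 1 "real k" 1 "gp_beta k q"] by (intro ln_gt_zero) simp

definition c :: "'a point" where "c = (0, 0, 1)"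

lemma c_in: "c \<in> E"
  by (auto simp: c_def ipm_space_def span_W_def coord_space_def span_zero)

lemma inner_c: "inner c v = tc v"
  by (simp add: c_def inner_prod_def)

lemma dual_le_c: "p \<in> S \<Longrightarrow> sc.dual_le p c (\<Lambda> / 2)"
  using unit_ball_bounds(1) Lambda_pos by (intro sc.dual_leI) (auto simp: inner_c)

section \<open>The starting point and its gradient\<close>

abbreviation p0 :: "'a point" where "p0 \<equiv> ipm_start k q"

lemma start_coords:
  "xc p0 = 0" "i < k \<Longrightarrow> zc p0 i = 1 / (2 * real k)" "tc p0 = ln (4 * real k * l1_norm k q)" "zs p0 = 1 / 2" "Q p0 = R\<^sup>2"
proof -
  show "xc p0 = 0" "tc p0 = ln (4 * real k * l1_norm k q)" by (simp_all add: ipm_start_def)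
  show z: "zc p0 i = 1 / (2 * real k)" if "i < k" for i
  proof -
    have "zc p0 i = (\<Sum>j<k. if j = i then 1 / (2 * real k) else 0)"
      unfolding zc_def ipm_start_def by (simp add: lookup_sum) (auto intro!: sum.cong simp: lookup_single when_def)
    then show ?thesis using that by simp
  qed
  show "zs p0 = 1 / 2" using z k_pos by (simp add: zs_def)
  show "Q p0 = R\<^sup>2" by (simp add: Q_def ipm_start_def)
qed

lemma w_start: "i < k \<Longrightarrow> w p0 i = ln (2 * l1_norm k q / q i)"
  using k_pos l1_norm_pos q_pos[of i]
  by (simp add: w_def start_coords ln_div ln_mult_pos ln_realpow[of 2 2, simplified])

lemma w_start_ge:
  assumes i: "i < k" shows "1 / 2 \<le> w p0 i"
proof -
  have "2 \<le> 2 * l1_norm k q / q i" using q_le_l1[OF i] q_pos[OF i] by (simp add: pos_le_divide_eq)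
  then have "ln 2 \<le> ln (2 * l1_norm k q / q i)" by (intro ln_mono_real) auto
  then show ?thesis unfolding w_start[OF i] using ln_2_ge_half by linarith
qed

lemma tau_minus_start: "1 / 5 \<le> \<tau> - tc p0"
proof -
  have "\<tau> - tc p0 = - ln (4 / 5)"
    using k_pos l1_norm_pos by (simp add: \<tau>_def start_coords ln_mult_pos ln_div)
  moreover have "ln (4 / 5) \<le> 4 / 5 - (1::real)" by (rule ln_le_minus_one) simp
  ultimately show ?thesis by simp
qed

lemma start_in: "p0 \<in> S"
proof -
  have "p0 \<in> E"
    unfolding ipm_start_def
    by (auto simp: ipm_space_def span_W_def span_zero coord_space_def lookup_sum lookup_single when_def intro!: sum.neutral)
  moreover have "0 < w p0 i" if "i < k" for i using w_start_ge[OF that] by linarith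
  moreover have "tc p0 < \<tau>" using tau_minus_start by linarith
  ultimately show ?thesis using k_pos R_pos by (simp add: S_def U_def start_coords)
qed

text \<open>Term by term on the unit ball of the local norm. The slacks at the start are at least
  1/2, so each slack term counts twice: 6 k collects 2 k from ln z and 4 k from the slacks, and 2
  bounds the term of 1 - \<open>zs\<close>. From \<tau> - t \<ge> 1/5 comes 5/2 \<Lambda>, rounded
  up to 3 \<Lambda>.\<close>

lemma dual_le_start_gradient:
  assumes p: "p \<in> S" and N: "\<And>i. i < k \<Longrightarrow> norm (\<omega> i - \<theta>) * R \<le> NR"
  shows "sc.dual_le p (grad_on E \<Psi> p0) (6 * real k + 2 + 2 * real k * NR + (real k + 3) * \<Lambda>)"
proof (rule sc.dual_leI[OF p])
  have NR0: "0 \<le> NR" using N[of 0] k_pos R_pos by (meson mult_nonneg_nonneg norm_ge_zero order_trans less_imp_le)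
  then show "0 \<le> 6 * real k + 2 + 2 * real k * NR + (real k + 3) * \<Lambda>" using Lambda_pos by simp
  fix v assume v: "v \<in> E" and less: "sc.nrm p v < 1"
  note b = unit_ball_bounds[OF p v less]
  let ?Z = "\<Sum>i<k. \<bar>zc v i\<bar>"
  have 1: "\<bar>\<Sum>i<k. zc v i / zc p0 i\<bar> \<le> 2 * real k * ?Z"
  proof -
    have "\<bar>\<Sum>i<k. zc v i / zc p0 i\<bar> \<le> (\<Sum>i<k. \<bar>zc v i / zc p0 i\<bar>)" by (rule sum_abs)
    also have "\<dots> = (\<Sum>i<k. 2 * real k * \<bar>zc v i\<bar>)"
      using k_pos by (intro sum.cong) (auto simp: start_coords abs_mult)
    finally show ?thesis by (simp add: sum_distrib_left)
  qed
  have 2: "\<bar>\<Sum>i<k. D p0 v i / w p0 i\<bar> \<le> 2 * (2 * real k * ?Z + real k * NR + real k * (\<Lambda> / 2))"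
  proof -
    have "\<bar>\<Sum>i<k. D p0 v i / w p0 i\<bar> \<le> (\<Sum>i<k. \<bar>D p0 v i / w p0 i\<bar>)" by (rule sum_abs)
    also have "\<dots> \<le> (\<Sum>i<k. 2 * (2 * real k * \<bar>zc v i\<bar> + NR + \<Lambda> / 2))"
    proof (rule sum_mono)
      fix i assume "i \<in> {..<k}"
      then have i: "i < k" by simp
      have "\<bar>inner (\<omega> i - \<theta>) (xc v)\<bar> \<le> norm (\<omega> i - \<theta>) * norm (xc v)" by (rule Cauchy_Schwarz_ineq2)
      also have "\<dots> \<le> norm (\<omega> i - \<theta>) * R" using b(2) by (intro mult_left_mono) auto
      finally have x: "\<bar>inner (\<omega> i - \<theta>) (xc v)\<bar> \<le> NR" using N[OF i] by linarith
      have "\<bar>zc v i / zc p0 i\<bar> = 2 * real k * \<bar>zc v i\<bar>" using i k_pos by (simp add: start_coords abs_mult)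
      then have D: "\<bar>D p0 v i\<bar> \<le> 2 * real k * \<bar>zc v i\<bar> + NR + \<Lambda> / 2"
        using x b(1) unfolding D_def by linarith
      have w: "0 < w p0 i" using w_start_ge[OF i] by linarith
      have "\<bar>D p0 v i / w p0 i\<bar> = \<bar>D p0 v i\<bar> / w p0 i" using w by simp
      also have "\<dots> \<le> \<bar>D p0 v i\<bar> / (1 / 2)" using w_start_ge[OF i] w by (intro divide_left_mono) auto
      finally show "\<bar>D p0 v i / w p0 i\<bar> \<le> 2 * (2 * real k * \<bar>zc v i\<bar> + NR + \<Lambda> / 2)" using D by simp
    qed
    also have "\<dots> = 2 * (2 * real k * ?Z + real k * NR + real k * (\<Lambda> / 2))"
      by (simp add: sum.distrib sum_distrib_left[symmetric])
    finally show ?thesis .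
  qed
  have 3: "\<bar>tc v / (\<tau> - tc p0)\<bar> \<le> 5 * (\<Lambda> / 2)"
  proof -
    have t: "0 < \<tau> - tc p0" using tau_minus_start by linarith
    have "\<bar>tc v / (\<tau> - tc p0)\<bar> = \<bar>tc v\<bar> / (\<tau> - tc p0)" using t by simp
    also have "\<dots> \<le> \<bar>tc v\<bar> / (1 / 5)" using tau_minus_start t by (intro divide_left_mono) auto
    also have "\<bar>tc v\<bar> / (1 / 5) = 5 * \<bar>tc v\<bar>" by simp
    finally show ?thesis using b(1) by linarith
  qed
  have 4: "\<bar>zs v / (1 - zs p0)\<bar> \<le> 2 * ?Z"
    using sum_abs[of "zc v" "{..<k}"] by (simp add: start_coords zs_def)
  have 5: "2 * inner (xc p0) (xc v) / Q p0 = 0" by (simp add: start_coords)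
  have kZ: "real k * ?Z \<le> real k" using mult_left_mono[OF b(3), of "real k"] by simp
  have kL: "(real k + 3) * \<Lambda> = real k * \<Lambda> + 3 * \<Lambda>" by (rule distrib_right)
  have "\<bar>inner (grad p0) v\<bar> \<le> 2 * real k * ?Z + 2 * (2 * real k * ?Z + real k * NR + real k * (\<Lambda> / 2)) + 5 * (\<Lambda> / 2) + 2 * ?Z"
    unfolding inner_grad 5 using 1 2 3 4 by linarith
  also have "\<dots> = 6 * (real k * ?Z) + 2 * (real k * NR) + real k * \<Lambda> + 5 / 2 * \<Lambda> + 2 * ?Z" by (simp add: algebra_simps)
  also have "\<dots> \<le> 6 * real k + 2 + 2 * real k * NR + (real k + 3) * \<Lambda>"
    unfolding kL using kZ b(3) Lambda_pos by simp
  finally show "\<bar>inner (grad_on E \<Psi> p0) v\<bar> \<le> 6 * real k + 2 + 2 * real k * NR + (real k + 3) * \<Lambda>"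
    by (simp add: grad_on_barrier[OF start_in])
qed

text \<open>With z proportional to the terms of \<open>Fsum y\<close> and t = ln (Fsum y), all
  exponential constraints and the sum constraint are tight. Shrinking z by exp (- e) and raising t
  by 2 e leaves slack e in the former and makes the sum of z less than 1.\<close>

lemma feasible_point:
  assumes y: "y \<in> span_W k \<omega> \<theta>" "norm y < R" and F: "Fsum y * exp (2 * e) < 5 * real k * l1_norm k q" and e: "0 < e"
  shows "\<exists>p\<in>S. tc p = ln (Fsum y) + 2 * e"
proof -
  define p where "p = (y, zvec (\<lambda>i. q i * exp (inner (\<omega> i - \<theta>) y) / Fsum y * exp (- e)), ln (Fsum y) + 2 * e)"
  have z: "zc p i = q i * exp (inner (\<omega> i - \<theta>) y) / Fsum y * exp (- e)" if "i < k" for i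
    using that by (simp add: zc_def p_def lookup_zvec)
  have "p \<in> E" using y zvec_in by (simp add: E_iff p_def)
  moreover have "0 < zc p i" if "i < k" for i
    using z[OF that] Fsum_pos[of y] q_pos[OF that] by simp
  moreover have "0 < w p i" if i: "i < k" for i
  proof -
    have "ln (zc p i) = ln (q i) + inner (\<omega> i - \<theta>) y - ln (Fsum y) - e"
      using z[OF i] Fsum_pos[of y] q_pos[OF i] by (simp add: ln_mult_pos ln_div)
    then show ?thesis using e by (simp add: w_def p_def)
  qed
  moreover have "tc p < \<tau>"
  proof -
    have "ln (Fsum y) + 2 * e = ln (Fsum y * exp (2 * e))" using Fsum_pos[of y] by (simp add: ln_mult_pos)
    also have "0 < 5 * real k * l1_norm k q" using k_pos l1_norm_pos by simp
    then have "ln (Fsum y * exp (2 * e)) < \<tau>"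
      unfolding \<tau>_def using F Fsum_pos[of y] by (subst ln_less_cancel_iff) auto
    finally show ?thesis by (simp add: p_def)
  qed
  moreover have "zs p < 1"
  proof -
    have "zs p = (\<Sum>i<k. q i * exp (inner (\<omega> i - \<theta>) y) * (exp (- e) / Fsum y))"
      unfolding zs_def by (intro sum.cong) (auto simp: z)
    also have "\<dots> = Fsum y * (exp (- e) / Fsum y)" by (simp only: Fsum_def sum_distrib_right)
    also have "\<dots> = exp (- e)" using Fsum_pos[of y] by simp
    also have "\<dots> < 1" using e by simp
    finally show ?thesis .
  qed
  moreover have "0 < Q p" unfolding Q_pos_iff using y(2) by (simp add: p_def)
  ultimately have "p \<in> S" by (simp add: S_def U_def)
  moreover have "tc p = ln (Fsum y) + 2 * e" by (simp add: p_def)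
  ultimately show ?thesis by blast
qed

text \<open>The factor 10 in place of 8 covers the loss in ln (1 + \<kappa>) \<ge> 15/16 \<kappa>:
  10 * 15/16 * 1/8 = 150/128 > 1.\<close>

lemma kappa_power_ge:
  assumes "10 * sqrt (2 * real k + 3) * X \<le> real T"
  shows "exp X \<le> (1 + sc.\<kappa>) ^ T"
proof (cases "0 \<le> X")
  case False
  then have "exp X \<le> 1" by simp
  also have "1 \<le> (1 + sc.\<kappa>) ^ T" using sc.kappa_bounds by (intro one_le_power) simp
  finally show ?thesis .
next
  case True
  have "sc.\<kappa> * sc.\<kappa> \<le> sc.\<kappa> * (1 / 16)" using sc.kappa_bounds by (intro mult_left_mono) auto
  then have "15 / 16 * sc.\<kappa> \<le> sc.\<kappa> - sc.\<kappa>\<^sup>2" by (simp add: power2_eq_square)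
  also have "\<dots> \<le> ln (1 + sc.\<kappa>)" using sc.kappa_bounds by (intro ln_one_plus_pos_lower_bound) auto
  finally have "15 / 16 * sc.\<kappa> \<le> ln (1 + sc.\<kappa>)" .
  then have "10 * sqrt (2 * real k + 3) * X * (15 / 16 * sc.\<kappa>) \<le> real T * ln (1 + sc.\<kappa>)"
    using assms sc.kappa_bounds by (intro mult_mono) auto
  moreover have "10 * sqrt (2 * real k + 3) * X * (15 / 16 * sc.\<kappa>) = 150 / 16 * X * (sc.\<kappa> * sqrt (2 * real k + 3))" by simp
  moreover have "150 / 16 * X * (sc.\<kappa> * sqrt (2 * real k + 3)) = 150 / 128 * X"
    unfolding sc.kappa_bounds(3) by simp
  ultimately have "X \<le> real T * ln (1 + sc.\<kappa>)" using True by linarith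
  also have "\<dots> = ln ((1 + sc.\<kappa>) ^ T)" using sc.kappa_bounds(1) by (simp add: ln_realpow)
  finally have "exp X \<le> exp (ln ((1 + sc.\<kappa>) ^ T))" by simp
  then show ?thesis using sc.kappa_bounds(1) by simp
qed

lemma ipm_result:
  assumes R: "R = ipm_radius n k q \<phi> \<delta>" and \<delta>: "0 < \<delta>"  "\<delta> < 1" and N: "\<And>i. i < k \<Longrightarrow> norm (\<omega> i - \<theta>) * R \<le> NR"
  obtains x M where "ipm n k \<omega> q \<theta> \<phi> \<delta> = Some (x, M)" "x \<in> span_W k \<omega> \<theta>"
    "\<forall>p\<in>S. ln (Fsum x) \<le> tc p + 53 / 120 * \<delta>"
    "real M \<le> 3 + 8 * sqrt (2 * real k + 3) * ln (18 * (6 * real k + 2 + 2 * real k * NR + (real k + 3) * \<Lambda>))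
      + 10 * sqrt (2 * real k + 3) * ln (72 / 5 * (2 * real k + 3) * \<Lambda> / \<delta>)"
proof -
  define \<nu> where "\<nu> = 2 * real k + 3"
  have \<nu>: "5 \<le> \<nu>" using sc.nu_ge by (simp add: \<nu>_def)
  define G where "G = 6 * real k + 2 + 2 * real k * NR + (real k + 3) * \<Lambda>"
  have NR0: "0 \<le> NR" using N[of 0] k_pos R_pos by (meson mult_nonneg_nonneg norm_ge_zero order_trans less_imp_le)
  have "1 \<le> 6 * real k + 2" "0 \<le> 2 * real k * NR" "0 \<le> (real k + 3) * \<Lambda>" using NR0 Lambda_pos by auto
  then have G1: "1 \<le> G" unfolding G_def by linarith
  note G = dual_le_start_gradient[OF _ N, folded G_def]
  obtain i \<mu> p' where while: "while_option (\<lambda>(i, \<mu>, p'). sc.nrm p' (sc.Hinv p' (grad_on E \<Psi> p')) > 1 / 6)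
      (\<lambda>(i, \<mu>, p'). let \<mu>' = (1 - 1 / (8 * sqrt (2 * real k + 3))) * \<mu>
        in (i + 1, \<mu>', p' - sc.Hinv p' (- \<mu>' *\<^sub>R grad_on E \<Psi> p0 + grad_on E \<Psi> p')))
      (0 :: nat, 1, p0) = Some (i, \<mu>, p')"
    and p': "p' \<in> S" "sc.dual_le p' (grad_on E \<Psi> p') (1 / 6)"
    and i: "real i \<le> 8 * sqrt (2 * real k + 3) * ln (18 * G) + 1"
    by (rule sc.preliminary_stage[OF start_in G G1])
  define nc where "nc = sc.nrm p' (sc.Hinv p' c)"
  define \<eta>0 where "\<eta>0 = 1 / (12 * nc)"
  have Hc: "sc.Hinv p' c \<in> E" by (rule sc.Hinv_in[OF p'(1) c_in])
  have "sc.Hinv p' c \<noteq> 0"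
  proof
    assume "sc.Hinv p' c = 0"
    then have "c = 0" using sc.H_Hinv[OF p'(1) c_in] linear_0[OF sc.linear_H[OF p'(1)]] by simp
    then show False by (simp add: c_def zero_prod_def)
  qed
  then have nc: "0 < nc" unfolding nc_def by (rule sc.nrm_pos[OF p'(1) Hc])
  have ncL: "nc \<le> \<Lambda> / 2"
    unfolding nc_def using dual_le_c[OF p'(1)] Lambda_pos by (subst sc.nrm_Hinv_le_iff[OF p'(1) c_in]) auto
  have \<eta>0: "0 < \<eta>0" using nc by (simp add: \<eta>0_def)
  have "sc.dual_le p' c nc"
    using sc.nrm_Hinv_le_iff[OF p'(1) c_in, of nc] nc by (simp add: nc_def)
  \<comment> \<open>\<open>\<eta>0\<close> is chosen so that c contributes 1/12 on top of the 1/6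
    left by the preliminary stage.\<close>
  from sc.dual_le_add[OF sc.dual_le_scale[OF this, of \<eta>0] p'(2)]
  have "sc.dual_le p' (\<eta>0 *\<^sub>R c + grad_on E \<Psi> p') (\<bar>\<eta>0\<bar> * nc + 1 / 6)" .
  moreover have "\<bar>\<eta>0\<bar> * nc + 1 / 6 = 1 / 4" using nc by (simp add: \<eta>0_def)
  ultimately have quarter: "sc.dual_le p' (\<eta>0 *\<^sub>R c + grad_on E \<Psi> p') (1 / 4)" by simp
  have \<eta>c: "\<eta>0 *\<^sub>R c \<in> E" using c_in by (rule sc.E_intros)
  define p0' where "p0' = p' - sc.Hinv p' (\<eta>0 *\<^sub>R c + grad_on E \<Psi> p')"
  note start = sc.newton_step_quarter[OF p'(1) \<eta>c quarter, folded p0'_def]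
  define X where "X = ln (6 / 5 * (\<nu> / (\<eta>0 * (\<delta> / 2))))"
  define T where "T = nat \<lceil>10 * sqrt \<nu> * X\<rceil>"
  obtain pT where main: "((\<lambda>(\<eta>, p). let \<eta>' = (1 + 1 / (8 * sqrt (2 * real k + 3))) * \<eta>
        in (\<eta>', p - sc.Hinv p (\<eta>' *\<^sub>R c + grad_on E \<Psi> p))) ^^ T) (\<eta>0, p0') = ((1 + sc.\<kappa>) ^ T * \<eta>0, pT)"
    and pT: "pT \<in> S" "sc.dual_le pT (((1 + sc.\<kappa>) ^ T * \<eta>0) *\<^sub>R c + grad_on E \<Psi> pT) (1 / 9)"
    by (rule sc.main_stage[OF start(1) c_in start(2)])
  have ipm: "ipm n k \<omega> q \<theta> \<phi> \<delta> = Some (xc pT, i + 1 + T)"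
  proof -
    have lnorm: "local_norm_on E \<Psi> = sc.nrm"
      by (intro ext) (simp add: local_norm_on_def sc.nrm_def)
    have Hinv: "hess_inv_on E \<Psi> = (\<lambda>p. sc.Hinv p)"
      by (intro ext) (simp add: hess_inv_on_def)
    show ?thesis
      unfolding ipm_def Let_def R[symmetric] lnorm Hinv c_def[symmetric]
      by (simp only: while[unfolded Let_def] option.map prod.case nc_def[symmetric] \<eta>0_def[symmetric]
          p0'_def[symmetric] X_def[unfolded \<nu>_def, symmetric]
          T_def[unfolded \<nu>_def, symmetric] main[unfolded Let_def] fst_conv)
  qed
  define \<eta> where "\<eta> = (1 + sc.\<kappa>) ^ T * \<eta>0"
  have pos: "0 < 6 / 5 * (\<nu> / (\<eta>0 * (\<delta> / 2)))" using \<nu> \<eta>0 \<delta> by simp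
  have "10 * sqrt (2 * real k + 3) * X \<le> real T"
    unfolding T_def \<nu>_def by (rule real_nat_ceiling_ge)
  then have "exp X \<le> (1 + sc.\<kappa>) ^ T" by (rule kappa_power_ge)
  then have "6 / 5 * (\<nu> / (\<eta>0 * (\<delta> / 2))) * \<eta>0 \<le> \<eta>"
    using pos \<eta>0 unfolding X_def \<eta>_def by (intro mult_right_mono) auto
  moreover have "6 / 5 * (\<nu> / (\<eta>0 * (\<delta> / 2))) * \<eta>0 = 12 / 5 * \<nu> / \<delta>" using \<eta>0 by simp
  ultimately have \<eta>: "12 / 5 * \<nu> / \<delta> \<le> \<eta>" by simp
  then have \<eta>': "12 / 5 * \<nu> \<le> \<eta> * \<delta>" using \<delta> by (simp add: pos_divide_le_eq)
  \<comment> \<open>53/120 is 53/50 from \<open>objective_gap\<close> times 5/12 from \<eta>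
    \<delta> \<ge> 12/5 \<nu>.\<close>
  have acc: "ln (Fsum (xc pT)) \<le> tc p + 53 / 120 * \<delta>" if p: "p \<in> S" for p
  proof -
    have g: "\<eta> * (tc pT - tc p) \<le> 53 / 50 * \<nu>"
      using sc.objective_gap[OF pT(1) p pT(2)] by (simp add: inner_c \<eta>_def \<nu>_def)
    also have "\<dots> \<le> 53 / 120 * (\<eta> * \<delta>)" using \<eta>' by linarith
    finally have "\<eta> * (tc pT - tc p) \<le> \<eta> * (53 / 120 * \<delta>)" by simp
    moreover have "0 < \<eta>" using \<eta> \<nu> \<delta> by (intro less_le_trans[OF _ \<eta>]) simp
    ultimately have "tc pT - tc p \<le> 53 / 120 * \<delta>" by simp
    moreover have "ln (Fsum (xc pT)) \<le> tc pT"
      using ln_mono_real[OF Fsum_pos Fsum_le_exp_tc[OF pT(1)]] by simp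
    ultimately show ?thesis by linarith
  qed
  have "real T \<le> 10 * sqrt \<nu> * ln (72 / 5 * \<nu> * \<Lambda> / \<delta>) + 1"
  proof -
    have "6 / 5 * (\<nu> / (\<eta>0 * (\<delta> / 2))) = 144 / 5 * \<nu> * nc / \<delta>" using nc by (simp add: \<eta>0_def)
    also have "\<dots> \<le> 144 / 5 * \<nu> * (\<Lambda> / 2) / \<delta>"
      using ncL \<nu> \<delta> by (intro divide_right_mono mult_left_mono) auto
    finally have le: "6 / 5 * (\<nu> / (\<eta>0 * (\<delta> / 2))) \<le> 72 / 5 * \<nu> * \<Lambda> / \<delta>" by simp
    have X: "X \<le> ln (72 / 5 * \<nu> * \<Lambda> / \<delta>)" unfolding X_def by (rule ln_mono_real[OF pos le])
    have "1 \<le> 72 / 5 * \<nu> * \<Lambda> / \<delta>"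
    proof -
      have "1 \<le> \<Lambda>"
      proof -
        have "exp 1 \<le> (3::real)" by (rule exp_le)
        also have "\<dots> \<le> 5 * real k * gp_beta k q"
          using beta_ge_1 k_pos mult_mono[of 1 "real k" 1 "gp_beta k q"] by simp
        finally have "exp 1 \<le> 5 * real k * gp_beta k q" .
        from ln_mono_real[OF _ this] show ?thesis by (simp add: \<Lambda>_def)
      qed
      then have "5 * 1 \<le> \<nu> * \<Lambda>" using \<nu> by (intro mult_mono) auto
      then have "\<delta> \<le> 72 / 5 * (\<nu> * \<Lambda>)" using \<delta> by linarith
      then show ?thesis using \<delta> by (simp add: pos_le_divide_eq mult.assoc)
    qed
    then have l0: "0 \<le> ln (72 / 5 * \<nu> * \<Lambda> / \<delta>)" by simp
    have "10 * sqrt \<nu> * X \<le> 10 * sqrt \<nu> * ln (72 / 5 * \<nu> * \<Lambda> / \<delta>)" using X \<nu> by (intro mult_left_mono) auto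
    moreover have "0 \<le> 10 * sqrt \<nu> * ln (72 / 5 * \<nu> * \<Lambda> / \<delta>)" using l0 \<nu> by simp
    \<comment> \<open>\<open>nat\<close> turns a negative ceiling into 0, hence the maximum.\<close>
    moreover have "real T \<le> max 0 (10 * sqrt \<nu> * X) + 1" unfolding T_def by linarith
    ultimately show ?thesis by linarith
  qed
  \<comment> \<open>The 3 collects the additive 1 of the loop count, the Newton step producing
    \<open>p0'\<close>, and the rounding of T.\<close>
  then have "real (i + 1 + T) \<le> 3 + 8 * sqrt (2 * real k + 3) * ln (18 * G) + 10 * sqrt (2 * real k + 3) * ln (72 / 5 * (2 * real k + 3) * \<Lambda> / \<delta>)"
    using i by (simp add: \<nu>_def)
  moreover have "xc pT \<in> span_W k \<omega> \<theta>" using in_S_D(1)[OF pT(1)] by (simp add: E_iff)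
  ultimately show ?thesis using that[OF ipm] acc by (simp add: G_def)
qed

end

section \<open>The gradient of F\<close>

context gp_instance
begin

definition Fgrad :: "'a \<Rightarrow> 'a" where
  "Fgrad x = (\<Sum>i<k. (q i * exp (inner (\<omega> i - \<theta>) x) / Fsum x) *\<^sub>R (\<omega> i - \<theta>))"

lemma inner_Fgrad:
  "inner (Fgrad x) h = (\<Sum>i<k. q i * exp (inner (\<omega> i - \<theta>) x) * inner (\<omega> i - \<theta>) h) / Fsum x"
  by (simp add: Fgrad_def inner_sum_left sum_divide_distrib)

lemma norm_Fgrad_le:
  assumes N: "\<And>i. i < k \<Longrightarrow> norm (\<omega> i - \<theta>) \<le> N"
  shows "norm (Fgrad x) \<le> N"
proof -
  have "norm (Fgrad x) \<le> (\<Sum>i<k. q i * exp (inner (\<omega> i - \<theta>) x) * (N / Fsum x))"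
    unfolding Fgrad_def
  proof (rule sum_norm_le)
    fix i assume "i \<in> {..<k}"
    then have i: "i < k" by simp
    have pos: "0 < q i * exp (inner (\<omega> i - \<theta>) x) / Fsum x" using q_pos[OF i] Fsum_pos by simp
    then have "norm ((q i * exp (inner (\<omega> i - \<theta>) x) / Fsum x) *\<^sub>R (\<omega> i - \<theta>)) = q i * exp (inner (\<omega> i - \<theta>) x) / Fsum x * norm (\<omega> i - \<theta>)"
      by (simp only: norm_scaleR abs_of_pos[OF pos])
    also have "\<dots> \<le> q i * exp (inner (\<omega> i - \<theta>) x) / Fsum x * N"
      using N[OF i] pos by (intro mult_left_mono) auto
    finally show "norm ((q i * exp (inner (\<omega> i - \<theta>) x) / Fsum x) *\<^sub>R (\<omega> i - \<theta>)) \<le> q i * exp (inner (\<omega> i - \<theta>) x) * (N / Fsum x)"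
      by simp
  qed
  also have "\<dots> = Fsum x * (N / Fsum x)" by (simp only: Fsum_def sum_distrib_right)
  also have "\<dots> = N" using Fsum_pos[of x] by simp
  finally show ?thesis .
qed

lemma F_descent:
  assumes N: "\<And>i. i < k \<Longrightarrow> norm (\<omega> i - \<theta>) \<le> N"
  shows "F (x + h) \<le> F x + inner (Fgrad x) h + (N * norm h)\<^sup>2 / 2"
proof -
  have "\<bar>inner (\<omega> i - \<theta>) h\<bar> \<le> N * norm h" if "i < k" for i
    using Cauchy_Schwarz_ineq2[of "\<omega> i - \<theta>" h] mult_right_mono[OF N[OF that], of "norm h"] by simp
  moreover have "0 < q i * exp (inner (\<omega> i - \<theta>) x)" if "i < k" for i using q_pos[OF that] by simp
  ultimately have "ln (\<Sum>i<k. q i * exp (inner (\<omega> i - \<theta>) x) * exp (inner (\<omega> i - \<theta>) h))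
      \<le> ln (\<Sum>i<k. q i * exp (inner (\<omega> i - \<theta>) x))
        + (\<Sum>i<k. q i * exp (inner (\<omega> i - \<theta>) x) * inner (\<omega> i - \<theta>) h) / (\<Sum>i<k. q i * exp (inner (\<omega> i - \<theta>) x))
        + (N * norm h)\<^sup>2 / 2"
    by (intro log_sum_exp_descent k_pos)
  then show ?thesis
    unfolding F_eq inner_Fgrad Fsum_def by (simp add: inner_add_right exp_add mult.assoc)
qed

lemma F_has_derivative: "(F has_derivative inner (Fgrad x)) (at x within V)"
proof -
  have 1: "((\<lambda>x. q i * exp (inner (\<omega> i - \<theta>) x)) has_derivative (\<lambda>h. q i * exp (inner (\<omega> i - \<theta>) x) * inner (\<omega> i - \<theta>) h)) (at x within V)" for i
    by (rule derivative_eq_intros refl | simp add: fun_eq_iff mult_ac)+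
  have "(Fsum has_derivative (\<lambda>h. \<Sum>i<k. q i * exp (inner (\<omega> i - \<theta>) x) * inner (\<omega> i - \<theta>) h)) (at x within V)"
    unfolding Fsum_def[abs_def] by (rule has_derivative_sum) (rule 1)
  from has_derivative_ln[OF Fsum_pos this]
  have "((\<lambda>x. ln (Fsum x)) has_derivative inner (Fgrad x)) (at x within V)"
    by (rule has_derivative_eq_rhs) (simp add: fun_eq_iff inner_Fgrad divide_inverse mult.commute)
  then show ?thesis by (simp add: F_eq[abs_def])
qed

text \<open>1 / N^2 is the length of the gradient step that minimizes the quadratic upper bound of
  \<open>F_descent\<close>.\<close>

lemma norm_Fgrad_sq_le:
  assumes N: "\<And>i. i < k \<Longrightarrow> norm (\<omega> i - \<theta>) \<le> N" "0 < N"
    and le: "F x \<le> F (x - (1 / N\<^sup>2) *\<^sub>R Fgrad x) + \<delta>"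
  shows "(norm (Fgrad x))\<^sup>2 \<le> 2 * N\<^sup>2 * \<delta>"
proof -
  define g where "g = (norm (Fgrad x))\<^sup>2"
  have f1: "F (x + - ((1 / N\<^sup>2) *\<^sub>R Fgrad x)) \<le> F x + inner (Fgrad x) (- ((1 / N\<^sup>2) *\<^sub>R Fgrad x))
      + (N * norm (- ((1 / N\<^sup>2) *\<^sub>R Fgrad x)))\<^sup>2 / 2"
    by (rule F_descent[OF N(1)])
  have f2: "inner (Fgrad x) (- ((1 / N\<^sup>2) *\<^sub>R Fgrad x)) = - (g / N\<^sup>2)"
    by (simp add: g_def power2_norm_eq_inner)
  have f3: "(N * norm (- ((1 / N\<^sup>2) *\<^sub>R Fgrad x)))\<^sup>2 = g / N\<^sup>2"
    using N(2) by (simp add: g_def power_mult_distrib power2_eq_square)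
  have "F (x - (1 / N\<^sup>2) *\<^sub>R Fgrad x) \<le> F x + - (g / N\<^sup>2) + g / N\<^sup>2 / 2"
    using f1 unfolding f2 f3 by (simp only: add_uminus_conv_diff)
  then have "g / N\<^sup>2 / 2 \<le> \<delta>" using le by linarith
  then have "g \<le> 2 * N\<^sup>2 * \<delta>" using N(2) by (simp add: pos_divide_le_eq mult_ac)
  then show ?thesis by (simp add: g_def)
qed

end

section \<open>Accuracy of the output for totally unimodular instances\<close>

context tu_instance
begin

text \<open>For k = 1 the vector \<omega> 0 - \<theta> is 0, so the radius drops out of the bound
  for the starting gradient and the dimension counts as 1.\<close>

definition eff_dim :: real where
  "eff_dim = (if k = 1 then 1 else real n)"

lemma ipm_function_value:
  assumes \<delta>: "0 < \<delta>" "\<delta> < 1"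
  obtains x M where "ipm n k \<omega> q \<theta> (real n powr (- 3 / 2)) \<delta> = Some (x, M)" "x \<in> coord_space n"
    "\<forall>y\<in>coord_space n. F x \<le> F y + \<delta>"
    "real M \<le> 500 * sqrt (real k) * (1 + ln (real k * eff_dim * (1 + ln (gp_beta k q)) / \<delta>))"
proof -
  define \<phi> where "\<phi> = real n powr (- 3 / 2)"
  define R where "R = ipm_radius n k q \<phi> \<delta>"
  define l where "l = ln (4 * gp_beta k q / \<delta>)"
  have n0: "0 < real n" using n_pos by simp
  have "\<phi> = inverse (real n powr (3 / 2))" using powr_minus[of "real n" "3 / 2"] by (simp add: \<phi>_def)
  then have "real n / \<phi> = real n * real n powr (3 / 2)" by (simp only: divide_inverse inverse_inverse_eq)
  also have "real n powr (3 / 2) = real n powr (1 + 1 / 2)" by simp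
  also have "\<dots> = real n * sqrt (real n)" unfolding powr_add using n0 by (simp add: powr_half_sqrt)
  finally have R_eq: "R = sqrt (real n) * (real n * (real n * l))"
    by (simp add: R_def ipm_radius_def l_def mult_ac)
  have "4 \<le> 4 * gp_beta k q / \<delta>" using beta_ge_1 \<delta> by (simp add: pos_le_divide_eq)
  then have "ln 4 \<le> l" unfolding l_def by (rule ln_mono_real[rotated]) simp
  then have l1: "1 \<le> l" using one_le_ln_4 by linarith
  have R0: "0 < R" unfolding R_eq using n0 l1 by simp
  interpret gp_ipm k q \<omega> \<theta> R
    by unfold_locales (rule R0)
  define NR where "NR = (if k = 1 then 0 else 2 * real n ^ 3 * l)"
  have NR: "norm (\<omega> i - \<theta>) * R \<le> NR" if i: "i < k" for i
  proof (cases "k = 1")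
    case True
    then show ?thesis using diff_eq_0_if_k_1[OF True i] by (simp add: NR_def)
  next
    case False
    have "norm (\<omega> i - \<theta>) * R \<le> 2 * sqrt (real n) * R"
      using norm_a_le[OF i] R0 by (intro mult_right_mono) auto
    also have "\<dots> = 2 * (sqrt (real n) * sqrt (real n)) * (real n * (real n * l))" by (simp only: R_eq mult_ac)
    also have "\<dots> = NR" using False n0 by (simp add: NR_def eval_nat_numeral)
    finally show ?thesis .
  qed
  obtain x M where x: "ipm n k \<omega> q \<theta> \<phi> \<delta> = Some (x, M)" "x \<in> span_W k \<omega> \<theta>"
    "\<forall>p\<in>S. ln (Fsum x) \<le> snd (snd p) + 53 / 120 * \<delta>"
    "real M \<le> 3 + 8 * sqrt (2 * real k + 3) * ln (18 * (6 * real k + 2 + 2 * real k * NR + (real k + 3) * \<Lambda>))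
      + 10 * sqrt (2 * real k + 3) * ln (72 / 5 * (2 * real k + 3) * \<Lambda> / \<delta>)"
    by (rule ipm_result[OF R_def \<delta> NR])
  have "F x \<le> F y + \<delta>" if y: "y \<in> coord_space n" for y
  proof -
    \<comment> \<open>Comparison points worse than 0 are replaced by 0; this keeps t below \<tau>
      for the lifted point.\<close>
    define y' where "y' = (if Fsum y \<le> l1_norm k q then y else 0)"
    have y': "y' \<in> coord_space n" "Fsum y' \<le> Fsum y" "Fsum y' \<le> l1_norm k q"
      using y Fsum_0 by (auto simp: y'_def coord_space_def)
    obtain z where z: "z \<in> span_W k \<omega> \<theta>"
      "norm z \<le> sqrt (real n) * (real n * (real n * ln (2 * gp_beta k q / \<delta>)))"
      "Fsum z \<le> (1 + \<delta> / 2) * Fsum y'"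
      by (rule diameter_bound[OF y'(1) \<delta>])
    \<comment> \<open>R is formed with 4 \<beta> where the truncation level has 2 \<beta>; this
      makes the norm bound strict and puts z inside the open ball.\<close>
    have "ln (2 * gp_beta k q / \<delta>) < l"
      unfolding l_def using beta_ge_1 \<delta> by (subst ln_less_cancel_iff) (auto simp: divide_strict_right_mono)
    then have "sqrt (real n) * (real n * (real n * ln (2 * gp_beta k q / \<delta>))) < R"
      unfolding R_eq using n0 by (intro mult_strict_left_mono) auto
    then have zR: "norm z < R" using z(2) by simp
    \<comment> \<open>\<delta> / 2 from truncation, 2 e = \<delta> / 50 from the lift into the
      interior and 53/120 \<delta> from the main stage add up to less than \<delta>.\<close>
    define e where "e = \<delta> / 100"
    have e: "0 < e" using \<delta> by (simp add: e_def)
    \<comment> \<open>3/2 * 3 = 9/2 stays below the factor 5 in the upper bound for t.\<close>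
    have "Fsum z * exp (2 * e) \<le> (3 / 2 * l1_norm k q) * 3"
    proof (rule mult_mono)
      have "(1 + \<delta> / 2) * Fsum y' \<le> 3 / 2 * l1_norm k q"
        using \<delta> y'(3) Fsum_pos[of y'] by (intro mult_mono) auto
      then show "Fsum z \<le> 3 / 2 * l1_norm k q" using z(3) by simp
      have "exp (2 * e) \<le> exp 1" using \<delta> by (simp add: e_def)
      then show "exp (2 * e) \<le> 3" using exp_le by linarith
    qed (use l1_norm_pos in auto)
    also have "\<dots> < 5 * 1 * l1_norm k q" using l1_norm_pos by simp
    also have "\<dots> \<le> 5 * real k * l1_norm k q" using k_pos l1_norm_pos by (intro mult_right_mono mult_left_mono) auto
    finally obtain p where p: "p \<in> S" "snd (snd p) = ln (Fsum z) + 2 * e"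
      using feasible_point[OF z(1) zR _ e] by blast
    have "ln (Fsum z) \<le> ln ((1 + \<delta> / 2) * Fsum y')" using z(3) by (rule ln_mono_real[OF Fsum_pos])
    also have "\<dots> = ln (1 + \<delta> / 2) + ln (Fsum y')" using \<delta> Fsum_pos[of y'] by (simp add: ln_mult_pos)
    also have "ln (1 + \<delta> / 2) \<le> \<delta> / 2" using \<delta> by (intro ln_add_one_self_le_self) simp
    also have "ln (Fsum y') \<le> ln (Fsum y)" using y'(2) by (rule ln_mono_real[OF Fsum_pos])
    finally have "ln (Fsum z) \<le> \<delta> / 2 + ln (Fsum y)" by simp
    moreover have "ln (Fsum x) \<le> ln (Fsum z) + 2 * e + 53 / 120 * \<delta>" using x(3) p by force
    ultimately show ?thesis unfolding F_eq e_def using \<delta> by linarith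
  qed
  moreover have "real M \<le> 500 * sqrt (real k) * (1 + ln (real k * eff_dim * (1 + ln (gp_beta k q)) / \<delta>))"
  proof -
    have "1 \<le> eff_dim" using n_pos by (simp add: eff_dim_def)
    moreover have "0 \<le> NR" using l1 by (simp add: NR_def)
    moreover have "NR \<le> 2 * eff_dim ^ 3 * ln (4 * gp_beta k q / \<delta>)"
      using l1 by (simp add: NR_def eff_dim_def l_def[symmetric])
    ultimately show ?thesis
      using x(4) step_count_bound[OF k_pos beta_ge_1 \<delta>, of eff_dim NR] unfolding \<Lambda>_def by linarith
  qed
  ultimately show ?thesis
    using that x(1,2) W_subset by (auto simp: \<phi>_def)
qed

lemma beta_k_1: "k = 1 \<Longrightarrow> gp_beta k q = 1"
  using q_pos[of 0] by (simp add: gp_beta_def l1_norm_def lessThan_Suc)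

lemma max_dist_bounds:
  shows "i < k \<Longrightarrow> norm (\<omega> i - \<theta>) \<le> max_dist k \<omega> \<theta>" "max_dist k \<omega> \<theta> \<le> 2 * sqrt (real n)" "0 \<le> max_dist k \<omega> \<theta>"
    "k = 1 \<Longrightarrow> max_dist k \<omega> \<theta> = 0"
proof -
  show le: "norm (\<omega> i - \<theta>) \<le> max_dist k \<omega> \<theta>" if "i < k" for i
    using that by (simp add: max_dist_def)
  show "max_dist k \<omega> \<theta> \<le> 2 * sqrt (real n)"
    unfolding max_dist_def using k_pos norm_a_le by (intro Max.boundedI) auto
  show "0 \<le> max_dist k \<omega> \<theta>" using le[OF k_pos] norm_ge_zero order_trans by blast
  show "max_dist k \<omega> \<theta> = 0" if "k = 1"
    using diff_eq_0_if_k_1[OF that, of 0] that by (simp add: max_dist_def lessThan_Suc)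
qed

text \<open>1 / \<delta> is 2 max(\<epsilon>, N)^2 / \<epsilon>^2. For \<epsilon> \<le> N the cap is
  inactive and N \<le> 2 sqrt n gives 8 n / \<epsilon>^2. For \<epsilon> > N it equals 2, and the
  capped accuracy is at most max 1 N \<le> 2 sqrt n.\<close>

lemma grad_accuracy_bounds:
  assumes \<epsilon>: "0 < \<epsilon>"
  defines "\<delta> \<equiv> grad_accuracy k \<omega> \<theta> \<epsilon>" and "\<epsilon>' \<equiv> capped_accuracy k \<omega> \<theta> \<epsilon>"
  shows "0 < \<delta>" "\<delta> < 1" "0 < \<epsilon>'" "\<epsilon>' \<le> 2 * sqrt (real n)" "1 / \<delta> \<le> 8 * real n / \<epsilon>'\<^sup>2" "k = 1 \<Longrightarrow> \<delta> = 1 / 2"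
proof -
  define N where "N = max_dist k \<omega> \<theta>"
  have N: "0 \<le> N" "N \<le> 2 * sqrt (real n)" using max_dist_bounds by (auto simp: N_def)
  have n1: "1 \<le> sqrt (real n)" using n_pos by simp
  have \<delta>_eq: "\<delta> = \<epsilon>\<^sup>2 / (2 * (max \<epsilon> N)\<^sup>2)" by (simp add: \<delta>_def grad_accuracy_def N_def)
  have e': "\<epsilon>' = min \<epsilon> (max 1 N)" by (simp add: \<epsilon>'_def capped_accuracy_def N_def)
  have mx: "0 < max \<epsilon> N" "\<epsilon> \<le> max \<epsilon> N" using \<epsilon> by auto
  then have sq: "0 < (max \<epsilon> N)\<^sup>2" "\<epsilon>\<^sup>2 \<le> (max \<epsilon> N)\<^sup>2" using \<epsilon> by (auto intro: power_mono)
  show "0 < \<delta>" unfolding \<delta>_eq using \<epsilon> sq by simp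
  have "\<epsilon>\<^sup>2 < 2 * (max \<epsilon> N)\<^sup>2" using sq by linarith
  then show "\<delta> < 1" unfolding \<delta>_eq using sq(1) by (subst pos_divide_less_eq) simp_all
  show e0: "0 < \<epsilon>'" unfolding e' using \<epsilon> by simp
  show e2: "\<epsilon>' \<le> 2 * sqrt (real n)" unfolding e' using N n1 by linarith
  show "1 / \<delta> \<le> 8 * real n / \<epsilon>'\<^sup>2"
  proof (cases "\<epsilon> \<le> N")
    case True
    then have "\<epsilon>' = \<epsilon>" unfolding e' by simp
    moreover have "1 / \<delta> = 2 * N\<^sup>2 / \<epsilon>\<^sup>2" unfolding \<delta>_eq using True by (simp add: max_def)
    moreover have "N\<^sup>2 \<le> (2 * sqrt (real n))\<^sup>2" using N by (intro power_mono) auto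
    then have "2 * N\<^sup>2 / \<epsilon>\<^sup>2 \<le> 8 * real n / \<epsilon>\<^sup>2"
      by (intro divide_right_mono) (auto simp: power_mult_distrib)
    ultimately show ?thesis by simp
  next
    case False
    then have "1 / \<delta> = 2" unfolding \<delta>_eq using \<epsilon> by (simp add: max_def)
    moreover have "\<epsilon>'\<^sup>2 \<le> (2 * sqrt (real n))\<^sup>2" using e0 e2 by (intro power_mono) auto
    then have "2 * \<epsilon>'\<^sup>2 \<le> 8 * real n" by (simp add: power_mult_distrib)
    then have "2 \<le> 8 * real n / \<epsilon>'\<^sup>2" using e0 by (simp add: pos_le_divide_eq)
    ultimately show ?thesis by simp
  qed
  show "\<delta> = 1 / 2" if "k = 1"
    unfolding \<delta>_eq using max_dist_bounds(4)[OF that] \<epsilon> by (simp add: N_def)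
qed

lemma grad_on_F:
  assumes "x \<in> coord_space n"
  shows "Fgrad x \<in> coord_space n" "grad_on (coord_space n) F x = Fgrad x"
proof -
  show in_c: "Fgrad x \<in> coord_space n"
    unfolding Fgrad_def
    by (intro subspace_sum subspace_scale subspace_diff subspace_coord_space theta_in omega_in) simp
  show "grad_on (coord_space n) F x = Fgrad x"
    by (rule grad_on_eq[OF subspace_coord_space assms in_c F_has_derivative])
qed

text \<open>If the largest norm N of the vectors \<omega> i - \<theta> is at most \<epsilon>, so is
  the norm of their convex combination, the gradient. Otherwise 2 N^2 times the accuracy is exactly
  \<epsilon>^2.\<close>

lemma norm_gradient_le:
  assumes \<epsilon>: "0 < \<epsilon>" and x: "x \<in> coord_space n"
    and opt: "\<forall>y\<in>coord_space n. F x \<le> F y + grad_accuracy k \<omega> \<theta> \<epsilon>"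
  shows "norm (Fgrad x) \<le> \<epsilon>"
proof (cases "max_dist k \<omega> \<theta> \<le> \<epsilon>")
  case True
  then show ?thesis using norm_Fgrad_le[OF max_dist_bounds(1)] order_trans by blast
next
  case False
  define N where "N = max_dist k \<omega> \<theta>"
  have N: "\<epsilon> < N" "0 < N" using False \<epsilon> by (auto simp: N_def)
  have "x - (1 / N\<^sup>2) *\<^sub>R Fgrad x \<in> coord_space n"
    by (intro subspace_diff subspace_scale subspace_coord_space x grad_on_F(1))
  then have "F x \<le> F (x - (1 / N\<^sup>2) *\<^sub>R Fgrad x) + grad_accuracy k \<omega> \<theta> \<epsilon>" using opt by blast
  then have "(norm (Fgrad x))\<^sup>2 \<le> 2 * N\<^sup>2 * grad_accuracy k \<omega> \<theta> \<epsilon>"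
    by (intro norm_Fgrad_sq_le N) (auto simp: N_def max_dist_bounds(1))
  also have "\<dots> = \<epsilon>\<^sup>2" using N by (simp add: grad_accuracy_def N_def[symmetric] max_def)
  finally show ?thesis by (rule power2_le_imp_le) (use \<epsilon> in simp)
qed

end

theorem corollary4p6:
  shows "\<exists>C > 0. \<exists>P :: real poly.
    \<forall>(n :: nat) (k :: nat) (\<omega> :: nat \<Rightarrow> nat \<Rightarrow>\<^sub>0 real) (q :: nat \<Rightarrow> real) (\<theta> :: nat \<Rightarrow>\<^sub>0 real).
      n \<ge> 1 \<longrightarrow>
      (\<forall>i<k. \<omega> i \<in> int_coord_space n) \<longrightarrow>
      totally_unimodular (column_matrix n k \<omega>) \<longrightarrow>
      (\<forall>i<k. q i > 0) \<longrightarrow>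
      \<theta> \<in> convex hull (\<omega> ` {..<k}) \<longrightarrow>
      (let F = gp_fun k \<omega> q \<theta>;
           \<beta> = gp_beta k q;
           L = instance_size n k q;
           \<phi>\<^sub>0 = real n powr (- 3 / 2)
       in
        (\<forall>\<delta>. 0 < \<delta> \<and> \<delta> < 1 \<longrightarrow>
          (\<exists>x N. ipm n k \<omega> q \<theta> \<phi>\<^sub>0 \<delta> = Some (x, N) \<and>
            x \<in> coord_space n \<and>
            F x \<le> (INF y\<in>coord_space n. F y) + \<delta> \<and>
            real N \<le> C * sqrt (real k) *
              olog (real k * real n * (1 / \<delta>) * ln (real k * \<beta> / \<delta>)) \<and>
            real N \<le> C * sqrt (real k) * ln (poly P L * (1 / \<delta>)))) \<and>
        (\<forall>\<epsilon>>0.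
          (\<exists>x N. ipm n k \<omega> q \<theta> \<phi>\<^sub>0 (grad_accuracy k \<omega> \<theta> \<epsilon>) = Some (x, N) \<and>
            x \<in> coord_space n \<and>
            norm (grad_on (coord_space n) F x) \<le> \<epsilon> \<and>
            (let \<epsilon>' = capped_accuracy k \<omega> \<theta> \<epsilon> in
              real N \<le> C * sqrt (real k) *
                olog (real k * real n * (1 / \<epsilon>') * ln (real k * real n * \<beta> / \<epsilon>')) \<and>
              real N \<le> C * sqrt (real k) * ln (poly P L * (1 / \<epsilon>'))))))"
proof (intro exI[of _ "4000 :: real"] conjI exI[of _ "[:3, 1:] ^ 8 :: real poly"] allI impI)
  show "(0 :: real) < 4000" by simp
  fix n k :: nat and \<omega> :: "nat \<Rightarrow> nat \<Rightarrow>\<^sub>0 real" and q :: "nat \<Rightarrow> real" and \<theta> :: "nat \<Rightarrow>\<^sub>0 real"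
  assume n: "n \<ge> 1" and \<omega>: "\<forall>i<k. \<omega> i \<in> int_coord_space n"
    and tu: "totally_unimodular (column_matrix n k \<omega>)" and q: "\<forall>i<k. q i > 0"
    and \<theta>: "\<theta> \<in> convex hull (\<omega> ` {..<k})"
  \<comment> \<open>The convex hull of the empty set has no element.\<close>
  have k0: "0 < k" using \<theta> by (cases "k = 0") auto
  interpret tu_instance k q \<omega> \<theta> n
    by unfold_locales (use n \<omega> tu q \<theta> k0 in auto)
  let ?\<beta> = "gp_beta k q" and ?L = "instance_size n k q" and ?P = "[:3, 1:] ^ 8 :: real poly"
  have P: "poly ?P ?L = (3 + (real n + real k + ln ?\<beta>)) ^ 8"
    by (simp add: poly_power instance_size_def)
  have eff: "1 \<le> eff_dim" "eff_dim \<le> real n" "eff_dim = (if k = 1 then 1 else real n)" "1 \<le> real n"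
    using n by (auto simp: eff_dim_def)
  \<comment> \<open>4000 = 8 * 500: the step count has the constant 500, and passing to the claimed
    logarithms costs at most a factor 8.\<close>
  have scale: "real M \<le> 4000 * sqrt (real k) * b"
    if M: "real M \<le> 500 * sqrt (real k) * a" and a: "a \<le> 8 * b" for M :: nat and a b :: real
  proof -
    have "500 * sqrt (real k) * a \<le> 500 * sqrt (real k) * (8 * b)" using a by (rule mult_left_mono) simp
    also have "\<dots> = 4000 * sqrt (real k) * b" by simp
    finally show ?thesis using M by linarith
  qed
  have i: "\<exists>x N. ipm n k \<omega> q \<theta> (real n powr (- 3 / 2)) \<delta> = Some (x, N) \<and> x \<in> coord_space n \<and>
      F x \<le> (INF y\<in>coord_space n. F y) + \<delta> \<and>
      real N \<le> 4000 * sqrt (real k) * olog (real k * real n * (1 / \<delta>) * ln (real k * ?\<beta> / \<delta>)) \<and>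
      real N \<le> 4000 * sqrt (real k) * ln (poly ?P ?L * (1 / \<delta>))"
    if \<delta>: "0 < \<delta>" "\<delta> < 1" for \<delta>
  proof -
    obtain x M where x: "ipm n k \<omega> q \<theta> (real n powr (- 3 / 2)) \<delta> = Some (x, M)" "x \<in> coord_space n"
      "\<forall>y\<in>coord_space n. F x \<le> F y + \<delta>"
      and M: "real M \<le> 500 * sqrt (real k) * (1 + ln (real k * eff_dim * (1 + ln ?\<beta>) / \<delta>))"
      by (rule ipm_function_value[OF \<delta>])
    have "F x - \<delta> \<le> (INF y\<in>coord_space n. F y)"
      using x(2,3) by (intro cINF_greatest) (auto simp: diff_le_eq)
    moreover have "real M \<le> 4000 * sqrt (real k) * olog (real k * real n * (1 / \<delta>) * ln (real k * ?\<beta> / \<delta>))"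
      using olog_bound_value[OF k_pos beta_ge_k beta_k_1 \<delta> eff(4,3)]
        olog_bounds(1)[of "real k * real n * (1 / \<delta>) * ln (real k * ?\<beta> / \<delta>)"]
      by (intro scale[OF M]) linarith
    moreover have "real M \<le> 4000 * sqrt (real k) * ln (poly ?P ?L * (1 / \<delta>))"
    proof (rule scale[OF M])
      have "1 \<le> real k * eff_dim * (1 + ln ?\<beta>) / \<delta>"
        by (rule size_parameter_ge_1[OF k_pos beta_ge_1 \<delta> eff(1)])
      then have "0 \<le> ln (real k * eff_dim * (1 + ln ?\<beta>) / \<delta>)" by simp
      then show "1 + ln (real k * eff_dim * (1 + ln ?\<beta>) / \<delta>) \<le> 8 * ln (poly ?P ?L * (1 / \<delta>))"
        unfolding P using soft_bound_value[OF k_pos beta_ge_1 \<delta>(1) eff(4,1,2)] by linarith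
    qed
    ultimately show ?thesis using x(1,2) by (intro exI conjI) auto
  qed
  have ii: "\<exists>x N. ipm n k \<omega> q \<theta> (real n powr (- 3 / 2)) (grad_accuracy k \<omega> \<theta> \<epsilon>) = Some (x, N) \<and> x \<in> coord_space n \<and>
      norm (grad_on (coord_space n) F x) \<le> \<epsilon> \<and>
      real N \<le> 4000 * sqrt (real k) * olog (real k * real n * (1 / capped_accuracy k \<omega> \<theta> \<epsilon>) * ln (real k * real n * ?\<beta> / capped_accuracy k \<omega> \<theta> \<epsilon>)) \<and>
      real N \<le> 4000 * sqrt (real k) * ln (poly ?P ?L * (1 / capped_accuracy k \<omega> \<theta> \<epsilon>))"
    if \<epsilon>: "0 < \<epsilon>" for \<epsilon>
  proof -
    define \<delta> where "\<delta> = grad_accuracy k \<omega> \<theta> \<epsilon>"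
    define \<epsilon>' where "\<epsilon>' = capped_accuracy k \<omega> \<theta> \<epsilon>"
    note b = grad_accuracy_bounds[OF \<epsilon>, folded \<delta>_def \<epsilon>'_def]
    obtain x M where x: "ipm n k \<omega> q \<theta> (real n powr (- 3 / 2)) \<delta> = Some (x, M)" "x \<in> coord_space n"
      "\<forall>y\<in>coord_space n. F x \<le> F y + \<delta>"
      and M: "real M \<le> 500 * sqrt (real k) * (1 + ln (real k * eff_dim * (1 + ln ?\<beta>) / \<delta>))"
      by (rule ipm_function_value[OF b(1,2)])
    have "norm (grad_on (coord_space n) F x) \<le> \<epsilon>"
      using norm_gradient_le[OF \<epsilon> x(2)] x(3) by (simp add: grad_on_F(2)[OF x(2)] \<delta>_def)
    moreover have "real M \<le> 4000 * sqrt (real k) * olog (real k * real n * (1 / \<epsilon>') * ln (real k * real n * ?\<beta> / \<epsilon>'))"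
      by (rule scale[OF M olog_bound_gradient[OF k_pos beta_ge_k beta_k_1 b(1,5,6) eff(4,3) b(3,4)]])
    moreover have "real M \<le> 4000 * sqrt (real k) * ln (poly ?P ?L * (1 / \<epsilon>'))"
    proof (rule scale[OF M])
      have "1 \<le> real k * eff_dim * (1 + ln ?\<beta>) / \<delta>"
        by (rule size_parameter_ge_1[OF k_pos beta_ge_1 b(1,2) eff(1)])
      then have "0 \<le> ln (real k * eff_dim * (1 + ln ?\<beta>) / \<delta>)" by simp
      then show "1 + ln (real k * eff_dim * (1 + ln ?\<beta>) / \<delta>) \<le> 8 * ln (poly ?P ?L * (1 / \<epsilon>'))"
        unfolding P using soft_bound_gradient[OF k_pos beta_ge_1 b(1,5) eff(4,1,2) b(3)] by linarith
    qed
    ultimately show ?thesis using x(1,2) unfolding \<delta>_def \<epsilon>'_def by (intro exI conjI) auto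
  qed
  show "let F = gp_fun k \<omega> q \<theta>;
           \<beta> = gp_beta k q;
           L = instance_size n k q;
           \<phi>\<^sub>0 = real n powr (- 3 / 2)
       in
        (\<forall>\<delta>. 0 < \<delta> \<and> \<delta> < 1 \<longrightarrow>
          (\<exists>x N. ipm n k \<omega> q \<theta> \<phi>\<^sub>0 \<delta> = Some (x, N) \<and>
            x \<in> coord_space n \<and>
            F x \<le> (INF y\<in>coord_space n. F y) + \<delta> \<and>
            real N \<le> 4000 * sqrt (real k) *
              olog (real k * real n * (1 / \<delta>) * ln (real k * \<beta> / \<delta>)) \<and>
            real N \<le> 4000 * sqrt (real k) * ln (poly ?P L * (1 / \<delta>)))) \<and>
        (\<forall>\<epsilon>>0.
          (\<exists>x N. ipm n k \<omega> q \<theta> \<phi>\<^sub>0 (grad_accuracy k \<omega> \<theta> \<epsilon>) = Some (x, N) \<and>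
            x \<in> coord_space n \<and>
            norm (grad_on (coord_space n) F x) \<le> \<epsilon> \<and>
            (let \<epsilon>' = capped_accuracy k \<omega> \<theta> \<epsilon> in
              real N \<le> 4000 * sqrt (real k) *
                olog (real k * real n * (1 / \<epsilon>') * ln (real k * real n * \<beta> / \<epsilon>')) \<and>
              real N \<le> 4000 * sqrt (real k) * ln (poly ?P L * (1 / \<epsilon>')))))"
    unfolding Let_def
    by (intro conjI allI impI, elim conjE, rule i, assumption, assumption, rule ii, assumption)
qed

end
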